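(* Let $l_0',l_1',l_2',l_3',E\in\mathbb{C}$, let $\alpha_i'\in\{-l_i',l_i'+1\}$ for each $i\in\{0,1,2,3\}$, and set $d=-\sum_{i=0}^3\alpha_i'/2$. Consider the equations $$(A)\ H^{(l_0',l_1',l_2',l_3')}\tilde f(x)=E\tilde f(x),\qquad (B)\ H^{(\alpha_0'+d,\alpha_1'+d,\alpha_2'+d,\alpha_3'+d)}f(x)=Ef(x).$$ (i) If $\alpha_0'\in\frac32+\mathbb{Z}_{\ge0}$ (resp. $\alpha_1'\in\frac32+\mathbb{Z}_{\ge0}$, $\alpha_2'\in\frac32+\mathbb{Z}_{\ge0}$, $\alpha_3'\in\frac32+\mathbb{Z}_{\ge0}$), $d\notin\mathbb{Z}$ and the singularity $x=0$ (resp. $x=\omega_1$, $x=\omega_2$, $x=\omega_3$) of $(A)$ is apparent, then there exists a non-zero solution of $(B)$ which belongs to the space $V_{-\alpha_0'-d,\,\alpha_1'+d+1,\,\alpha_2'+d+1,\,\alpha_3'+d+1}$ (resp. $V_{\alpha_0'+d+1,\,-\alpha_1'-d,\,\alpha_2'+d+1,\,\alpha_3'+d+1}$, $V_{\alpha_0'+d+1,\,\alpha_1'+d+1,\,-\alpha_2'-d,\,\alpha_3'+d+1}$, $V_{\alpha_0'+d+1,\,\alpha_1'+d+1,\,\alpha_2'+d+1,\,-\alpha_3'-d}$). (ii) If $\alpha_0'\in-\frac12+\mathbb{Z}_{\le0}$ (resp. $\alpha_1'\in-\frac12+\mathbb{Z}_{\le0}$, $\alpha_2'\in-\frac12+\mathbb{Z}_{\le0}$,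 $\alpha_3'\in-\frac12+\mathbb{Z}_{\le0}$), $\alpha_1'+d,\alpha_2'+d,\alpha_3'+d\notin\frac12+\mathbb{Z}$ (resp. $\alpha_0'+d,\alpha_2'+d,\alpha_3'+d\notin\frac12+\mathbb{Z}$; $\alpha_0'+d,\alpha_1'+d,\alpha_3'+d\notin\frac12+\mathbb{Z}$; $\alpha_0'+d,\alpha_1'+d,\alpha_2'+d\notin\frac12+\mathbb{Z}$), $d\notin\mathbb{Z}$ and the singularity $x=0$ (resp. $x=\omega_1$, $x=\omega_2$, $x=\omega_3$) of $(A)$ is apparent, then there exists a non-zero solution of $(B)$ which belongs to the space $V_{\alpha_0'+d+1,\,-\alpha_1'-d,\,-\alpha_2'-d,\,-\alpha_3'-d}$ (resp. $V_{-\alpha_0'-d,\,\alpha_1'+d+1,\,-\alpha_2'-d,\,-\alpha_3'-d}$, $V_{-\alpha_0'-d,\,-\alpha_1'-d,\,\alpha_2'+d+1,\,-\alpha_3'-d}$, $V_{-\alpha_0'-d,\,-\alpha_1'-d,\,-\alpha_2'-d,\,\alpha_3'+d+1}$). (iii) If $\alpha_0'+d\in\frac12+\mathbb{Z}_{\ge0}$ (resp. $\alpha_1'+d\in\frac12+\mathbb{Z}_{\ge0}$, $\alpha_2'+d\in\frac12+\mathbb{Z}_{\ge0}$, $\alpha_3'+d\in\frac12+\mathbb{Z}_{\ge0}$), $l_1',l_2',l_3'\notin\frac12+\mathbb{Z}$ (resp. $l_0',l_2',l_3'\notin\frac12+\mathbb{Z}$; $l_0',l_1',l_3'\notin\frac12+\mathbb{Z}$;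 $l_0',l_1',l_2'\notin\frac12+\mathbb{Z}$), $d\notin\mathbb{Z}$ and there exists a non-zero solution of $(A)$ which belongs to the space $V_{1-\alpha_0',\alpha_1',\alpha_2',\alpha_3'}$ (resp. $V_{\alpha_0',1-\alpha_1',\alpha_2',\alpha_3'}$, $V_{\alpha_0',\alpha_1',1-\alpha_2',\alpha_3'}$, $V_{\alpha_0',\alpha_1',\alpha_2',1-\alpha_3'}$), then the singularity $x=0$ (resp. $x=\omega_1$, $x=\omega_2$, $x=\omega_3$) of $(B)$ is apparent. (iv) If $\alpha_0'+d\in-\frac32+\mathbb{Z}_{\le0}$ (resp. $\alpha_1'+d\in-\frac32+\mathbb{Z}_{\le0}$, $\alpha_2'+d\in-\frac32+\mathbb{Z}_{\le0}$, $\alpha_3'+d\in-\frac32+\mathbb{Z}_{\le0}$), $l_1',l_2',l_3'\notin\frac12+\mathbb{Z}$ (resp. $l_0',l_2',l_3'\notin\frac12+\mathbb{Z}$; $l_0',l_1',l_3'\notin\frac12+\mathbb{Z}$; $l_0',l_1',l_2'\notin\frac12+\mathbb{Z}$), $d\notin\mathbb{Z}$ and there exists a non-zero solution of $(A)$ which belongs to the space $V_{\alpha_0',1-\alpha_1',1-\alpha_2',1-\alpha_3'}$ (resp. $V_{1-\alpha_0',\alpha_1',1-\alpha_2',1-\alpha_3'}$, $V_{1-\alpha_0',1-\alpha_1',\alpha_2',1-\alpha_3'}$, $V_{1-\alpha_0',1-\alpha_1',1-\alpha_2',\alpha_3'}$), then the singularity $x=0$ (resp. $x=\omega_1$, $x=\omega_2$,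 $x=\omega_3$) of $(B)$ is apparent.
   Context: $\wp(x)$ is the Weierstrass elliptic function with periods $(2\omega_1,2\omega_3)$; $\omega_0=0$, $\omega_2=-\omega_1-\omega_3$, $e_i=\wp(\omega_i)$ ($i=1,2,3$). For complex $m_0,\dots,m_3$, $$H^{(m_0,m_1,m_2,m_3)}=-\frac{d^2}{dx^2}+\sum_{i=0}^3m_i(m_i+1)\wp(x+\omega_i).$$ For numbers $\beta_0,\dots,\beta_3$ such that $\tilde d=-\sum_{i=0}^3\beta_i/2\in\mathbb{Z}_{\ge0}$, $V_{\beta_0,\beta_1,\beta_2,\beta_3}$ is the $(\tilde d+1)$-dimensional space spanned by $\widehat\Phi(\wp(x))\wp(x)^n$, $n=0,\dots,\tilde d$, where $\widehat\Phi(z)=(z-e_1)^{\beta_1/2}(z-e_2)^{\beta_2/2}(z-e_3)^{\beta_3/2}$. If $m_i\in\frac12+\mathbb{Z}$, the singularity $x=\omega_i$ of $H^{(m_0,m_1,m_2,m_3)}f=Ef$ (whose exponents are $-m_i$ and $m_i+1$) is called apparent if the monodromy matrix around $x=\omega_i$ is scalar, equivalently there are no logarithmic solutions there. $\mathbb{Z}_{\ge n}$ (resp. $\mathbb{Z}_{\le n}$) is the set of integers $\ge n$ (resp. $\le n$). *)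

theory Defs
  imports "HOL-Complex_Analysis.Complex_Analysis"
begin

text \<open>Throughout, the periods are \<open>2 * \<omega>1\<close> and \<open>2 * \<omega>3\<close>; quadruples such as
  \<open>(m\<^sub>0, m\<^sub>1, m\<^sub>2, m\<^sub>3)\<close> are functions on \<open>nat\<close> of which only the values at \<open>0, 1, 2, 3\<close> matter.\<close>

definition half_period :: "complex \<Rightarrow> complex \<Rightarrow> nat \<Rightarrow> complex" where
  "half_period \<omega>1 \<omega>3 i = [0, \<omega>1, - \<omega>1 - \<omega>3, \<omega>3] ! i"

definition period_lattice :: "complex \<Rightarrow> complex \<Rightarrow> complex set" where
  "period_lattice \<omega>1 \<omega>3 = {of_int a * (2 * \<omega>1) + of_int b * (2 * \<omega>3) | a b. True}"

definition weierstrass_p :: "complex \<Rightarrow> complex \<Rightarrow> complex \<Rightarrow> complex" where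
  "weierstrass_p \<omega>1 \<omega>3 x =
     1 / x\<^sup>2 + (\<Sum>\<^sub>\<infinity>w\<in>period_lattice \<omega>1 \<omega>3 - {0}. 1 / (x - w)\<^sup>2 - 1 / w\<^sup>2)"

definition e_val :: "complex \<Rightarrow> complex \<Rightarrow> nat \<Rightarrow> complex" where
  "e_val \<omega>1 \<omega>3 i = weierstrass_p \<omega>1 \<omega>3 (half_period \<omega>1 \<omega>3 i)"

definition singular_points :: "complex \<Rightarrow> complex \<Rightarrow> complex set" where
  "singular_points \<omega>1 \<omega>3 =
     {half_period \<omega>1 \<omega>3 i + w | i w. i \<in> {0..3} \<and> w \<in> period_lattice \<omega>1 \<omega>3}"

definition H_op ::
  "complex \<Rightarrow> complex \<Rightarrow> (nat \<Rightarrow> complex) \<Rightarrow> (complex \<Rightarrow> complex) \<Rightarrow> complex \<Rightarrow> complex" where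
  "H_op \<omega>1 \<omega>3 m f x =
     - deriv (deriv f) x
     + (\<Sum>i=0..3. m i * (m i + 1) * weierstrass_p \<omega>1 \<omega>3 (x + half_period \<omega>1 \<omega>3 i)) * f x"

text \<open>\<open>f\<close> is a single-valued solution of \<open>H f = E f\<close> on the open set \<open>U\<close>, which is meant to
  avoid the singular points.\<close>

definition solves_on ::
  "complex \<Rightarrow> complex \<Rightarrow> (nat \<Rightarrow> complex) \<Rightarrow> complex \<Rightarrow> complex set \<Rightarrow> (complex \<Rightarrow> complex) \<Rightarrow> bool" where
  "solves_on \<omega>1 \<omega>3 m E U f \<longleftrightarrow>
     f holomorphic_on U \<and> (\<forall>x\<in>U. H_op \<omega>1 \<omega>3 m f x = E * f x)"

definition log_branch :: "complex set \<Rightarrow> (complex \<Rightarrow> complex) \<Rightarrow> (complex \<Rightarrow> complex) \<Rightarrow> bool" where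
  "log_branch U h L \<longleftrightarrow> L holomorphic_on U \<and> (\<forall>x\<in>U. exp (L x) = h x)"


subsection \<open>The spaces V\<close>

text \<open>The elements of \<open>V\<close> are multivalued functions on the complement of the singular points.
  We represent such a function by the family of all its branches: it is a map \<open>F\<close> that sends
  a choice \<open>L\<close> of branches of \<open>log (\<wp>(x) - e\<^sub>i)\<close>, \<open>i = 1, 2, 3\<close>, on an open set \<open>U\<close> to the
  corresponding branch \<open>F L\<close> on \<open>U\<close>, with \<open>(\<wp>(x) - e\<^sub>i) ^ (\<beta>\<^sub>i / 2) = exp (\<beta>\<^sub>i / 2 * L i x)\<close>.\<close>

definition branch_choice ::
  "complex \<Rightarrow> complex \<Rightarrow> complex set \<Rightarrow> (nat \<Rightarrow> complex \<Rightarrow> complex) \<Rightarrow> bool" where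
  "branch_choice \<omega>1 \<omega>3 U L \<longleftrightarrow>
     open U \<and> U \<inter> singular_points \<omega>1 \<omega>3 = {} \<and>
     (\<forall>i\<in>{1..3}. log_branch U (\<lambda>x. weierstrass_p \<omega>1 \<omega>3 x - e_val \<omega>1 \<omega>3 i) (L i))"

definition Phi_hat :: "(nat \<Rightarrow> complex) \<Rightarrow> (nat \<Rightarrow> complex \<Rightarrow> complex) \<Rightarrow> complex \<Rightarrow> complex" where
  "Phi_hat \<beta> L x = (\<Prod>i=1..3. exp (\<beta> i / 2 * L i x))"

text \<open>The number \<open>\<beta> 0\<close> enters only through \<open>D\<close>. The set is empty unless
  \<open>- (\<beta> 0 + \<beta> 1 + \<beta> 2 + \<beta> 3) / 2\<close> is a nonnegative integer.\<close>

definition V_space ::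
  "complex \<Rightarrow> complex \<Rightarrow> (nat \<Rightarrow> complex) \<Rightarrow> ((nat \<Rightarrow> complex \<Rightarrow> complex) \<Rightarrow> complex \<Rightarrow> complex) set" where
  "V_space \<omega>1 \<omega>3 \<beta> =
     {(\<lambda>L x. \<Sum>n=0..D. c n * (Phi_hat \<beta> L x * weierstrass_p \<omega>1 \<omega>3 x ^ n)) | D c.
        of_nat D = - (\<Sum>i=0..3. \<beta> i / 2)}"

definition has_nonzero_solution_in_V ::
  "complex \<Rightarrow> complex \<Rightarrow> (nat \<Rightarrow> complex) \<Rightarrow> complex \<Rightarrow> (nat \<Rightarrow> complex) \<Rightarrow> bool" where
  "has_nonzero_solution_in_V \<omega>1 \<omega>3 m E \<beta> \<longleftrightarrow>
     (\<exists>F\<in>V_space \<omega>1 \<omega>3 \<beta>.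
        (\<exists>U L. branch_choice \<omega>1 \<omega>3 U L \<and> (\<exists>x\<in>U. F L x \<noteq> 0)) \<and>
        (\<forall>U L. branch_choice \<omega>1 \<omega>3 U L \<longrightarrow> solves_on \<omega>1 \<omega>3 m E U (F L)))"


subsection \<open>Monodromy and apparent singularities\<close>

text \<open>The half-plane \<open>Re t < ln r\<close> is the universal cover of the punctured disc of radius \<open>r\<close>
  around \<open>a\<close>, via \<open>t \<mapsto> a + exp t\<close>. Accordingly, a multivalued solution on the punctured disc is
  a holomorphic function \<open>g\<close> on the half-plane such that all branches of \<open>g (log (x - a))\<close> are
  solutions, and analytic continuation once around \<open>a\<close> is the shift of \<open>t\<close> by \<open>2 * pi * \<i>\<close>.\<close>

definition multivalued_solution ::
  "complex \<Rightarrow> complex \<Rightarrow> (nat \<Rightarrow> complex) \<Rightarrow> complex \<Rightarrow> complex \<Rightarrow> real \<Rightarrow> (complex \<Rightarrow> complex) \<Rightarrow> bool" where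
  "multivalued_solution \<omega>1 \<omega>3 m E a r g \<longleftrightarrow>
     g holomorphic_on {t. Re t < ln r} \<and>
     (\<forall>U L. open U \<and> U \<subseteq> ball a r - {a} \<and> log_branch U (\<lambda>x. x - a) L
        \<longrightarrow> solves_on \<omega>1 \<omega>3 m E U (g \<circ> L))"

text \<open>\<open>M\<close> is the monodromy matrix around \<open>a\<close> with respect to some basis \<open>(Y 1, Y 2)\<close> of solutions,
  written as a row vector.\<close>

definition is_monodromy_matrix ::
  "complex \<Rightarrow> complex \<Rightarrow> (nat \<Rightarrow> complex) \<Rightarrow> complex \<Rightarrow> complex \<Rightarrow> complex ^ 2 ^ 2 \<Rightarrow> bool" where
  "is_monodromy_matrix \<omega>1 \<omega>3 m E a M \<longleftrightarrow>
     (\<exists>r>0. (ball a r - {a}) \<inter> singular_points \<omega>1 \<omega>3 = {} \<and>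
       (\<exists>Y :: complex \<Rightarrow> complex ^ 2.
          (\<forall>j. multivalued_solution \<omega>1 \<omega>3 m E a r (\<lambda>t. Y t $ j)) \<and>
          (\<forall>c :: complex ^ 2.
             (\<forall>t. Re t < ln r \<longrightarrow> (\<Sum>j\<in>UNIV. c $ j * Y t $ j) = 0) \<longrightarrow> c = 0) \<and>
          (\<forall>t. Re t < ln r \<longrightarrow> Y (t + 2 * of_real pi * \<i>) = Y t v* M)))"

text \<open>Scalarity of the monodromy matrix does not depend on the basis of solutions. Apparentness is
  a notion only for \<open>m i \<in> 1/2 + \<int>\<close>.\<close>

definition apparent_singularity ::
  "complex \<Rightarrow> complex \<Rightarrow> (nat \<Rightarrow> complex) \<Rightarrow> complex \<Rightarrow> nat \<Rightarrow> bool" where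
  "apparent_singularity \<omega>1 \<omega>3 m E i \<longleftrightarrow>
     m i - 1/2 \<in> \<int> \<and>
     (\<exists>s. is_monodromy_matrix \<omega>1 \<omega>3 m E (half_period \<omega>1 \<omega>3 i) (mat s))"

end

theory Submission
  imports Defs
begin

text \<open>All four parts follow from one equivalence: if \<open>\<alpha> k - 3/2\<close> is a natural number \<open>D\<close> and \<open>d\<close> is not
  an integer, then the singularity \<open>k\<close> of (A) is apparent iff (B) has a nonzero solution in
  \<open>V\<close> with \<open>\<beta> k = - \<alpha> k - d\<close> and \<open>\<beta> i = \<alpha> i + d + 1\<close> for \<open>i \<noteq> k\<close>. Since \<open>H\<close> depends on \<open>m i\<close> only through
  \<open>m i * (m i + 1)\<close>, part (ii) is part (i) for \<open>1 - \<alpha>\<close>, and parts (iii) and (iv) are the converse direction for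
  \<open>\<alpha> + d + 1\<close> and \<open>- \<alpha> - d\<close>.

  In a coordinate built from \<open>\<wp>\<close> that vanishes doubly at the half period \<open>k\<close>, both equations become
  Heun equations with three-term recurrences. The singularity is apparent iff the Frobenius recurrence with the
  smaller exponent passes the resonance at step \<open>D + 1\<close>, and \<open>V\<close> contains a solution iff the recurrence
  for (B) has a nonzero solution supported on \<open>{0..D}\<close>. Both conditions say that a tridiagonal matrix of size
  \<open>D + 1\<close> is singular, and the two matrices have the same diagonal and the same products of opposite
  off-diagonal entries.\<close>

subsection \<open>The Weierstrass function\<close>

text \<open>Why the two matrices agree: write \<open>\<alpha> k = D + 3/2\<close>. The factor
  \<open>n - D\<close> sits in the lowering entry of (A), where it is the resonance, and in the
  raising entry of (B), where it stops the degree. The factor \<open>n - D - 1 - d\<close> sits in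
  the other entry of each, and \<open>d \<notin> \<int>\<close> keeps it away from 0. So the shift
  by \<open>d\<close> only exchanges factors within the products
  \<open>coeffX n * coeffZ (Suc n)\<close>.

  The analytic obstacle is the passage from scalar monodromy to the recurrence: the given basis on
  the universal cover has no relation to any Frobenius series. Wronskians with the solution of the
  larger exponent replace an expansion of that basis and reduce the claim to the vanishing of one
  residue.

  The coordinates rest on two facts about \<open>wp\<close>, its first-order differential equation
  and the effect of adding a half period. Both come from Liouville's theorem, applied to
  combinations whose poles cancel. The half period 0 is the pole of \<open>wp\<close> and needs a
  coordinate of its own, a Moebius image of \<open>wp\<close>.\<close>

locale lattice =
  fixes \<omega>1 \<omega>3 :: complex
  assumes indep: "Im (\<omega>3 / \<omega>1) \<noteq> 0"
begin

abbreviation "\<Lambda> \<equiv> period_lattice \<omega>1 \<omega>3"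
abbreviation "S \<equiv> singular_points \<omega>1 \<omega>3"
abbreviation "wp \<equiv> weierstrass_p \<omega>1 \<omega>3"
abbreviation "hp \<equiv> half_period \<omega>1 \<omega>3"

section \<open>Geometry of the lattice and of the singular points\<close>

lemma nonzero: "\<omega>1 \<noteq> 0" "\<omega>3 \<noteq> 0"
  using indep by auto

text \<open>Dividing by \<open>\<omega>1\<close> and taking the imaginary part isolates
  \<open>t\<close>; dividing by \<open>\<omega>3\<close> isolates \<open>s\<close>. This
  quantitative form of independence yields uniqueness of coordinates, discreteness and convergence
  alike.\<close>

lemma lattice_coord_bound:
  obtains c where "c > 0" "\<And>s t :: real. c * \<bar>s\<bar> \<le> norm (of_real s * \<omega>1 + of_real t * \<omega>3)"
    "\<And>s t :: real. c * \<bar>t\<bar> \<le> norm (of_real s * \<omega>1 + of_real t * \<omega>3)"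
proof -
  define \<tau> where "\<tau> = \<omega>3 / \<omega>1"
  have im: "Im \<tau> \<noteq> 0" "Im (inverse \<tau>) \<noteq> 0"
  proof -
    show "Im \<tau> \<noteq> 0" using indep by (simp add: \<tau>_def)
    then show "Im (inverse \<tau>) \<noteq> 0" by (auto simp: complex_eq_iff)
  qed
  have t: "norm \<omega>1 * \<bar>Im \<tau>\<bar> * \<bar>t\<bar> \<le> norm (of_real s * \<omega>1 + of_real t * \<omega>3)" for s t
  proof -
    have "of_real s * \<omega>1 + of_real t * \<omega>3 = \<omega>1 * (of_real s + of_real t * \<tau>)"
      using nonzero by (simp add: \<tau>_def field_simps)
    moreover have "\<bar>t * Im \<tau>\<bar> \<le> norm (of_real s + of_real t * \<tau>)"
      using abs_Im_le_cmod[of "of_real s + of_real t * \<tau>"] by simp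
    ultimately show ?thesis
      using nonzero by (simp add: norm_mult abs_mult mult.commute)
  qed
  have s: "norm \<omega>3 * \<bar>Im (inverse \<tau>)\<bar> * \<bar>s\<bar> \<le> norm (of_real s * \<omega>1 + of_real t * \<omega>3)" for s t
  proof -
    have "of_real s * \<omega>1 + of_real t * \<omega>3 = \<omega>3 * (of_real s * inverse \<tau> + of_real t)"
      using nonzero by (simp add: \<tau>_def field_simps)
    moreover have "Im (of_real s * inverse \<tau> + of_real t) = s * Im (inverse \<tau>)"
      by simp
    then have "\<bar>s * Im (inverse \<tau>)\<bar> \<le> norm (of_real s * inverse \<tau> + of_real t)"
      using abs_Im_le_cmod[of "of_real s * inverse \<tau> + of_real t"] by metis
    then have "norm \<omega>3 * \<bar>s * Im (inverse \<tau>)\<bar> \<le> norm \<omega>3 * norm (of_real s * inverse \<tau> + of_real t)"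
      by (rule mult_left_mono) simp
    ultimately show ?thesis
      by (simp only: norm_mult abs_mult mult_ac)
  qed
  define c where "c = min (norm \<omega>1 * \<bar>Im \<tau>\<bar>) (norm \<omega>3 * \<bar>Im (inverse \<tau>)\<bar>)"
  have "c * \<bar>x\<bar> \<le> norm \<omega>1 * \<bar>Im \<tau>\<bar> * \<bar>x\<bar>" "c * \<bar>x\<bar> \<le> norm \<omega>3 * \<bar>Im (inverse \<tau>)\<bar> * \<bar>x\<bar>" for x
    unfolding c_def by (intro mult_right_mono; simp)+
  from order_trans[OF this(2) s] order_trans[OF this(1) t]
  show ?thesis
    using im nonzero by (intro that[of c]) (auto simp: c_def simp del: inverse_complex.sel)
qed

lemma real_comb_eq_0_iff:
  "of_real s * \<omega>1 + of_real t * \<omega>3 = 0 \<longleftrightarrow> s = 0 \<and> t = 0"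
proof -
  obtain c where "c > 0" "\<And>s t :: real. c * \<bar>s\<bar> \<le> norm (of_real s * \<omega>1 + of_real t * \<omega>3)"
    "\<And>s t :: real. c * \<bar>t\<bar> \<le> norm (of_real s * \<omega>1 + of_real t * \<omega>3)"
    using lattice_coord_bound by blast
  from this(1) this(2)[of s t] this(3)[of t s] show ?thesis
    by (auto simp: mult_le_0_iff)
qed

lemma real_comb_eq_iff:
  "of_real s * \<omega>1 + of_real t * \<omega>3 = of_real s' * \<omega>1 + of_real t' * \<omega>3 \<longleftrightarrow> s = s' \<and> t = t'"
  using real_comb_eq_0_iff[of "s - s'" "t - t'"] by (auto simp: algebra_simps)

text \<open>The four half periods represent the four parity classes of
  \<open>(a, b)\<close>.\<close>

lemma singular_points_eq: "S = {of_int a * \<omega>1 + of_int b * \<omega>3 | a b. True}"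
proof (intro equalityI subsetI)
  fix x assume "x \<in> S"
  then obtain i a b where i: "i \<in> {0..3}"
    and x: "x = hp i + (of_int a * (2 * \<omega>1) + of_int b * (2 * \<omega>3))"
    by (auto simp: singular_points_def period_lattice_def)
  have "i = 0 \<or> i = 1 \<or> i = 2 \<or> i = 3" using i by auto
  then have "x = of_int (2*a) * \<omega>1 + of_int (2*b) * \<omega>3 \<or> x = of_int (2*a+1) * \<omega>1 + of_int (2*b) * \<omega>3
    \<or> x = of_int (2*a-1) * \<omega>1 + of_int (2*b-1) * \<omega>3 \<or> x = of_int (2*a) * \<omega>1 + of_int (2*b+1) * \<omega>3"
    by (auto simp: x half_period_def algebra_simps)
  then show "x \<in> {of_int a * \<omega>1 + of_int b * \<omega>3 | a b. True}" by blast
next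
  fix x assume "x \<in> {of_int a * \<omega>1 + of_int b * \<omega>3 | a b. True}"
  then obtain a b :: int where x: "x = of_int a * \<omega>1 + of_int b * \<omega>3" by auto
  have mk: "x \<in> S" if "i \<in> {0..3}" "x = hp i + (of_int p * (2 * \<omega>1) + of_int q * (2 * \<omega>3))" for i p q
    using that by (force simp: singular_points_def period_lattice_def)
  consider (ee) p q where "a = 2*p" "b = 2*q" | (oe) p q where "a = 2*p+1" "b = 2*q"
    | (oo) p q where "a = 2*p+1" "b = 2*q+1" | (eo) p q where "a = 2*p" "b = 2*q+1"
    by (metis evenE oddE)
  then show "x \<in> S"
  proof cases
    case ee then show ?thesis by (intro mk[of 0 p q]) (simp_all add: x half_period_def)
  next
    case oe then show ?thesis by (intro mk[of 1 p q]) (simp_all add: x half_period_def algebra_simps)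
  next
    \<comment> \<open>\<open>hp 2\<close> is \<open>- \<omega>1 - \<omega>3\<close>, with negative
      signs, so one more full period is added in each direction.\<close>
    case oo then show ?thesis by (intro mk[of 2 "p+1" "q+1"]) (simp_all add: x half_period_def algebra_simps)
  next
    case eo then show ?thesis by (intro mk[of 3 p q]) (simp_all add: x half_period_def algebra_simps)
  qed
qed

lemma lattice_subset_singular: "\<Lambda> \<subseteq> S"
  unfolding singular_points_def by (force simp: half_period_def)

lemma half_period_in_singular: "i \<in> {0..3} \<Longrightarrow> hp i \<in> S"
  unfolding singular_points_def period_lattice_def by (force intro: exI[of _ "0::int"])

lemma zero_in_lattice [simp]: "0 \<in> \<Lambda>"
  unfolding period_lattice_def by (force intro: exI[of _ "0::int"])

lemma lattice_add: "x \<in> \<Lambda> \<Longrightarrow> y \<in> \<Lambda> \<Longrightarrow> x + y \<in> \<Lambda>"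
  unfolding period_lattice_def
proof clarify
  fix a b a' b' :: int
  have "of_int a * (2 * \<omega>1) + of_int b * (2 * \<omega>3) + (of_int a' * (2 * \<omega>1) + of_int b' * (2 * \<omega>3))
    = of_int (a+a') * (2 * \<omega>1) + of_int (b+b') * (2 * \<omega>3)" by (simp add: algebra_simps)
  then show "\<exists>p q. of_int a * (2 * \<omega>1) + of_int b * (2 * \<omega>3) + (of_int a' * (2 * \<omega>1) + of_int b' * (2 * \<omega>3))
    = of_int p * (2 * \<omega>1) + of_int q * (2 * \<omega>3) \<and> True" by blast
qed

lemma lattice_uminus: "x \<in> \<Lambda> \<Longrightarrow> - x \<in> \<Lambda>"
  unfolding period_lattice_def
proof clarify
  fix a b :: int
  have "- (of_int a * (2 * \<omega>1) + of_int b * (2 * \<omega>3))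
    = of_int (-a) * (2 * \<omega>1) + of_int (-b) * (2 * \<omega>3)" by (simp add: algebra_simps)
  then show "\<exists>p q. - (of_int a * (2 * \<omega>1) + of_int b * (2 * \<omega>3))
    = of_int p * (2 * \<omega>1) + of_int q * (2 * \<omega>3) \<and> True" by blast
qed

lemma lattice_diff: "x \<in> \<Lambda> \<Longrightarrow> y \<in> \<Lambda> \<Longrightarrow> x - y \<in> \<Lambda>"
  using lattice_add[of x "-y"] lattice_uminus[of y] by simp

lemma singular_add_lattice: "x \<in> S \<Longrightarrow> w \<in> \<Lambda> \<Longrightarrow> x + w \<in> S"
  unfolding singular_points_def using lattice_add by (force simp: add.assoc)

lemma singular_add_lattice_iff: "w \<in> \<Lambda> \<Longrightarrow> x + w \<in> S \<longleftrightarrow> x \<in> S"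
  using singular_add_lattice[of x w] singular_add_lattice[of "x+w" "-w"] lattice_uminus by force

lemma countable_singular: "countable S"
proof -
  have "S = (\<lambda>(a,b). of_int a * \<omega>1 + of_int b * \<omega>3) ` (UNIV :: (int \<times> int) set)"
    unfolding singular_points_eq by auto
  then show ?thesis by simp
qed

lemma finite_singular_cball: "finite {w \<in> S. norm w \<le> R}"
proof -
  obtain c where c: "c > 0" "\<And>s t :: real. c * \<bar>s\<bar> \<le> norm (of_real s * \<omega>1 + of_real t * \<omega>3)"
    "\<And>s t :: real. c * \<bar>t\<bar> \<le> norm (of_real s * \<omega>1 + of_real t * \<omega>3)"
    using lattice_coord_bound by blast
  define N where "N = \<lceil>R / c\<rceil>"
  have "{w \<in> S. norm w \<le> R} \<subseteq> (\<lambda>(a,b). of_int a * \<omega>1 + of_int b * \<omega>3) ` ({-N..N} \<times> {-N..N})"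
  proof
    fix w assume "w \<in> {w \<in> S. norm w \<le> R}"
    then obtain a b :: int where w: "w = of_int a * \<omega>1 + of_int b * \<omega>3" "norm w \<le> R"
      unfolding singular_points_eq by auto
    have "c * \<bar>real_of_int a\<bar> \<le> R" "c * \<bar>real_of_int b\<bar> \<le> R"
      using c(2)[of "of_int a" "of_int b"] c(3)[of "of_int b" "of_int a"] w by auto
    then have "\<bar>real_of_int a\<bar> \<le> R / c" "\<bar>real_of_int b\<bar> \<le> R / c"
      using c(1) by (simp_all add: field_simps)
    then have "\<bar>a\<bar> \<le> N" "\<bar>b\<bar> \<le> N" unfolding N_def by linarith+
    then show "w \<in> (\<lambda>(a,b). of_int a * \<omega>1 + of_int b * \<omega>3) ` ({-N..N} \<times> {-N..N})"
      using w by force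
  qed
  then show ?thesis by (rule finite_subset) auto
qed

lemma singular_discrete:
  assumes "A \<subseteq> S" "x \<notin> A"
  obtains r where "r > 0" "ball x r \<inter> A = {}"
proof -
  have "finite {w \<in> S. norm w \<le> norm x + 1}" by (rule finite_singular_cball)
  then have "finite {w \<in> A. norm w \<le> norm x + 1}"
    by (rule finite_subset[rotated]) (use assms in auto)
  then obtain d where d: "d > 0" "\<forall>y\<in>{w \<in> A. norm w \<le> norm x + 1}. y \<noteq> x \<longrightarrow> d \<le> dist x y"
    using finite_set_avoid by blast
  have "y \<notin> ball x (min d 1)" if "y \<in> A" for y
  proof
    assume y: "y \<in> ball x (min d 1)"
    have "norm y \<le> norm x + 1"
      using norm_triangle_ineq2[of y x] y by (auto simp: dist_norm norm_minus_commute)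
    with d that assms y show False by force
  qed
  then show ?thesis using d(1) by (intro that[of "min d 1"]) auto
qed

lemma open_Compl_singular_subset: "A \<subseteq> S \<Longrightarrow> open (- A)"
  unfolding open_contains_ball using singular_discrete by (metis ComplD disjoint_eq_subset_Compl inf_commute)

section \<open>Convergence, holomorphy and periodicity of the Weierstrass function\<close>

text \<open>The double sum is compared with a product of two single sums: the exponent 3 is split as
  \<open>3/2 + 3/2\<close>, and each half still exceeds 1.\<close>

lemma lattice_cube_summable: "(\<lambda>w. 1 / norm w ^ 3) summable_on \<Lambda> - {0}"
proof -
  obtain c where c: "c > 0" "\<And>s t :: real. c * \<bar>s\<bar> \<le> norm (of_real s * \<omega>1 + of_real t * \<omega>3)"
    "\<And>s t :: real. c * \<bar>t\<bar> \<le> norm (of_real s * \<omega>1 + of_real t * \<omega>3)"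
    using lattice_coord_bound by blast
  define g :: "int \<Rightarrow> real" where "g = (\<lambda>n. (1 + \<bar>of_int n\<bar>) powr (-3/2))"
  have gpos: "g n \<ge> 0" for n by (simp add: g_def)
  have "summable (\<lambda>n. real n powr (-3/2))" by (subst summable_real_powr_iff) auto
  then have "summable (\<lambda>n. (1 + real n) powr (-3/2))"
    by (subst (asm) summable_Suc_iff[symmetric]) (simp add: add.commute)
  then have s0: "(\<lambda>n::nat. g (int n)) summable_on UNIV" 
    by (subst summable_on_UNIV_nonneg_real_iff) (auto simp: g_def)
  have "g summable_on (range int)"
    using s0 by (subst summable_on_reindex) (auto simp: o_def)
  moreover have "g summable_on (range (\<lambda>n. - int n))"
    using s0 by (subst summable_on_reindex) (auto simp: o_def g_def inj_on_def)
  ultimately have "g summable_on (range int \<union> range (\<lambda>n. - int n))"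
    by (rule summable_on_union)
  moreover have "range int \<union> range (\<lambda>n. - int n) = UNIV"
    by (auto simp: image_iff) (metis int_cases2)
  ultimately have g: "g summable_on UNIV" by simp
  have "(\<lambda>(a,b). g a * g b) summable_on (UNIV \<times> UNIV)"
  proof (rule summable_on_SigmaI)
    show "((\<lambda>b. case (a, b) of (a, b) \<Rightarrow> g a * g b) has_sum (g a * infsum g UNIV)) UNIV" for a
      using has_sum_cmult_right[OF has_sum_infsum[OF g]] by simp
    show "(\<lambda>a. g a * infsum g UNIV) summable_on UNIV"
      by (rule summable_on_cmult_left[OF g])
  qed (auto simp: gpos)
  then have "(\<lambda>p. (1/c^3) * (g (fst p) * g (snd p))) summable_on (UNIV \<times> UNIV)"
    by (intro summable_on_cmult_right) (simp add: case_prod_unfold)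
  then have "(\<lambda>p. (1/c^3) * (g (fst p) * g (snd p))) summable_on (UNIV - {(0,0)})"
    by (rule summable_on_subset_banach) auto
  then have "(\<lambda>p. 1 / norm (of_int (fst p) * (2 * \<omega>1) + of_int (snd p) * (2 * \<omega>3)) ^ 3)
      summable_on (UNIV - {(0::int,0::int)})"
  proof (rule summable_on_comparison_test)
    fix p :: "int \<times> int" assume p: "p \<in> UNIV - {(0,0)}"
    obtain a b where ab: "p = (a,b)" by fastforce
    define M where "M = max \<bar>real_of_int a\<bar> \<bar>real_of_int b\<bar>"
    define W where "W = norm (of_int a * (2 * \<omega>1) + of_int b * (2 * \<omega>3))"
    have M1: "M \<ge> 1" using p ab by (auto simp: M_def)
    have W: "2 * (c * M) \<le> W"
      using c(2)[of "2 * of_int a" "2 * of_int b"] c(3)[of "2 * of_int b" "2 * of_int a"] c(1)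
      by (auto simp: M_def W_def max_def abs_mult mult_ac)
    have pos: "c * (2 * M) > 0" using c M1 by auto
    \<comment> \<open>Since \<open>M \<ge> 1\<close>, both \<open>1 + |a|\<close> and
      \<open>1 + |b|\<close> are at most \<open>2 * M\<close>; this replaces the maximum by a
      product.\<close>
    have "(2 * M) powr (-3) = (2 * M) powr (-3/2) * (2 * M) powr (-3/2)"
      by (simp flip: powr_add)
    also have "\<dots> \<le> g a * g b"
      unfolding g_def using M1 by (intro mult_mono powr_mono2') (auto simp: M_def)
    finally have g: "(2 * M) powr (-3) \<le> g a * g b" .
    have "1 / W ^ 3 \<le> 1 / (c * (2 * M)) ^ 3"
      using W pos by (intro frac_le power_mono zero_less_power) auto
    also have "\<dots> = (1/c^3) * (2 * M) powr (-3)"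
      using M1 by (simp add: powr_minus divide_simps power_mult_distrib)
    also have "\<dots> \<le> (1/c^3) * (g a * g b)"
      using g c(1) by (intro mult_left_mono) auto
    finally show "1 / norm (of_int (fst p) * (2 * \<omega>1) + of_int (snd p) * (2 * \<omega>3)) ^ 3 \<le> 1 / c ^ 3 * (g (fst p) * g (snd p))"
      by (simp add: ab W_def)
  qed auto
  also have "?this \<longleftrightarrow> (\<lambda>w. 1 / norm w ^ 3) summable_on ((\<lambda>p. of_int (fst p) * (2 * \<omega>1) + of_int (snd p) * (2 * \<omega>3)) ` (UNIV - {(0::int,0::int)}))"
  proof (subst summable_on_reindex)
    show "inj_on (\<lambda>p. of_int (fst p) * (2 * \<omega>1) + of_int (snd p) * (2 * \<omega>3)) (UNIV - {(0::int,0::int)})"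
    proof (rule inj_onI)
      fix p q :: "int \<times> int"
      assume "of_int (fst p) * (2 * \<omega>1) + of_int (snd p) * (2 * \<omega>3) = of_int (fst q) * (2 * \<omega>1) + of_int (snd q) * (2 * \<omega>3)"
      then show "p = q"
        using real_comb_eq_iff[of "2 * of_int (fst p)" "2 * of_int (snd p)" "2 * of_int (fst q)" "2 * of_int (snd q)"]
        by (auto simp: prod_eq_iff mult_ac)
    qed
  qed (simp add: o_def)
  also have "(\<lambda>p. of_int (fst p) * (2 * \<omega>1) + of_int (snd p) * (2 * \<omega>3)) ` (UNIV - {(0::int,0::int)}) = \<Lambda> - {0}"
  proof (intro equalityI subsetI)
    fix w assume "w \<in> (\<lambda>p. of_int (fst p) * (2 * \<omega>1) + of_int (snd p) * (2 * \<omega>3)) ` (UNIV - {(0::int,0::int)})"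
    then obtain p :: "int \<times> int" where "w = of_int (fst p) * (2 * \<omega>1) + of_int (snd p) * (2 * \<omega>3)" "p \<in> UNIV - {(0,0)}"
      by (rule imageE)
    then obtain a b :: int where ab: "w = of_int a * (2 * \<omega>1) + of_int b * (2 * \<omega>3)" "(a,b) \<noteq> (0,0)"
      by (cases p) simp
    then show "w \<in> \<Lambda> - {0}"
      using real_comb_eq_0_iff[of "2 * of_int a" "2 * of_int b"] by (auto simp: period_lattice_def mult_ac)
  next
    fix w assume "w \<in> \<Lambda> - {0}"
    then obtain a b :: int where ab: "w = of_int a * (2 * \<omega>1) + of_int b * (2 * \<omega>3)" "w \<noteq> 0" by (auto simp: period_lattice_def)
    then have "(a,b) \<noteq> (0,0)" by auto
    with ab show "w \<in> (\<lambda>p. of_int (fst p) * (2 * \<omega>1) + of_int (snd p) * (2 * \<omega>3)) ` (UNIV - {(0::int,0::int)})" 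
      by (auto intro!: image_eqI[of _ _ "(a,b)"])
  qed
  finally show ?thesis .
qed


text \<open>The constant 10 is \<open>5/2\<close>, from \<open>|2 w - x| \<le> 5/2 |w|\<close>,
  times 4, from \<open>|x - w| \<ge> |w| / 2\<close>. The bound is uniform in \<open>x\<close>, as
  the Weierstrass M-test requires.\<close>

lemma p_term_bound:
  fixes x w :: complex
  assumes "norm x \<le> R" "2 * R \<le> norm w" "w \<noteq> 0"
  shows "norm (1 / (x - w)^2 - 1 / w^2) \<le> 10 * R * (1 / norm w ^ 3)"
proof -
  have R: "R \<ge> 0" using assms(1) norm_ge_zero[of x] by linarith
  have xw: "norm (x - w) \<ge> norm w / 2"
    using norm_triangle_ineq2[of w x] assms by (simp add: norm_minus_commute)
  then have xw0: "x \<noteq> w" using assms(3) by force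
  have "1 / (x - w)^2 - 1 / w^2 = x * (2 * w - x) / (w^2 * (x - w)^2)"
    using xw0 assms(3) by (simp add: divide_simps) (simp add: power2_eq_square algebra_simps)
  then have "norm (1 / (x - w)^2 - 1 / w^2) = norm x * norm (2 * w - x) / (norm w ^ 2 * norm (x - w) ^ 2)"
    by (simp add: norm_mult norm_divide norm_power)
  also have "\<dots> \<le> R * (5/2 * norm w) / (norm w ^ 2 * (norm w / 2) ^ 2)"
  proof (rule frac_le)
    have "norm (2 * w - x) \<le> 2 * norm w + norm x"
      using norm_triangle_ineq4[of "2 * w" x] by (simp add: norm_mult)
    then have "norm (2 * w - x) \<le> 5/2 * norm w" using assms by linarith
    then show "norm x * norm (2 * w - x) \<le> R * (5/2 * norm w)"
      using assms(1) R by (intro mult_mono) auto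
    show "(norm w)\<^sup>2 * (norm w / 2)\<^sup>2 \<le> (norm w)\<^sup>2 * (norm (x - w))\<^sup>2"
      using xw by (intro mult_left_mono power_mono) auto
  qed (use R assms(3) in auto)
  also have "\<dots> = 10 * R * (1 / norm w ^ 3)"
    using assms(3) by (simp add: divide_simps power2_eq_square power3_eq_cube)
  finally show ?thesis .
qed

definition p_term :: "complex \<Rightarrow> complex \<Rightarrow> complex" where
  "p_term x w = 1 / (x - w)^2 - 1 / w^2"

definition wp_regular :: "complex \<Rightarrow> complex" where
  "wp_regular x = (\<Sum>\<^sub>\<infinity>w\<in>\<Lambda> - {0}. p_term x w)"

lemma wp_eq: "wp x = 1 / x^2 + wp_regular x"
  by (simp add: weierstrass_p_def wp_regular_def p_term_def)

lemma finite_lattice_ball: "finite {w \<in> \<Lambda> - {0}. norm w < 2 * R}"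
  by (rule finite_subset[OF _ finite_singular_cball[of "2*R"]]) (use lattice_subset_singular in auto)

lemma p_term_tail_summable:
  assumes "norm x \<le> R"
  shows "p_term x summable_on {w \<in> \<Lambda> - {0}. 2 * R \<le> norm w}"
proof (rule abs_summable_summable, rule Infinite_Sum.abs_summable_on_comparison_test')
  show "(\<lambda>w. 10 * R * (1 / norm w ^ 3)) summable_on {w \<in> \<Lambda> - {0}. 2 * R \<le> norm w}"
    by (intro summable_on_cmult_right summable_on_subset_banach[OF lattice_cube_summable]) auto
qed (use assms p_term_bound in \<open>auto simp: p_term_def\<close>)

lemma p_term_summable: "p_term x summable_on (\<Lambda> - {0})"
proof -
  have "p_term x summable_on ({w \<in> \<Lambda> - {0}. norm w < 2 * norm x} \<union> {w \<in> \<Lambda> - {0}. 2 * norm x \<le> norm w})"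
    by (intro summable_on_union p_term_tail_summable summable_on_finite finite_lattice_ball) auto
  also have "{w \<in> \<Lambda> - {0}. norm w < 2 * norm x} \<union> {w \<in> \<Lambda> - {0}. 2 * norm x \<le> norm w} = \<Lambda> - {0}" by auto
  finally show ?thesis .
qed

text \<open>Lattice points of norm below \<open>2 * R\<close> form a finite sum with explicit poles.
  The others stay at distance at least \<open>R\<close> from the disc of radius \<open>R\<close>,
  and their sum converges uniformly there.\<close>

lemma wp_regular_holomorphic: "wp_regular holomorphic_on - (\<Lambda> - {0})"
proof -
  have op: "open (- (\<Lambda> - {0}))"
    using lattice_subset_singular by (intro open_Compl_singular_subset) auto
  have "wp_regular field_differentiable (at x)" if x: "x \<in> - (\<Lambda> - {0})" for x
  proof -
    define R where "R = norm x + 1"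
    define A where "A = {w \<in> \<Lambda> - {0}. norm w < 2 * R}"
    define B where "B = {w \<in> \<Lambda> - {0}. 2 * R \<le> norm w}"
    have fin: "finite A" unfolding A_def by (rule finite_lattice_ball)
    have ul: "uniform_limit (cball 0 R) (\<lambda>X y. \<Sum>w\<in>X. p_term y w) (\<lambda>y. \<Sum>\<^sub>\<infinity>w\<in>B. p_term y w) (finite_subsets_at_top B)"
    proof (rule Weierstrass_m_test_general)
      show "(\<lambda>w. 10 * R * (1 / norm w ^ 3)) summable_on B" unfolding B_def
        by (intro summable_on_cmult_right summable_on_subset_banach[OF lattice_cube_summable]) auto
    qed (use p_term_bound in \<open>auto simp: B_def p_term_def\<close>)
    have hol: "(\<lambda>y. \<Sum>w\<in>X. p_term y w) holomorphic_on cball 0 R" if "X \<subseteq> B" for X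
    proof -
      have "y \<noteq> w" if "y \<in> cball 0 R" "w \<in> X" for y w
      proof
        assume "y = w"
        then have "2 * R \<le> R" using that \<open>X \<subseteq> B\<close> by (auto simp: B_def)
        then show False using norm_ge_zero[of x] by (simp add: R_def)
      qed
      then show ?thesis unfolding p_term_def by (intro holomorphic_intros) force
    qed
    have tail: "(\<lambda>y. \<Sum>\<^sub>\<infinity>w\<in>B. p_term y w) holomorphic_on ball 0 R"
    proof (rule holomorphic_uniform_limit[OF _ ul])
      show "\<forall>\<^sub>F X in finite_subsets_at_top B. continuous_on (cball 0 R) (\<lambda>y. \<Sum>w\<in>X. p_term y w)
          \<and> (\<lambda>y. \<Sum>w\<in>X. p_term y w) holomorphic_on ball 0 R"
        unfolding eventually_finite_subsets_at_top
      proof (intro exI[of _ "{}"] conjI allI impI; clarify?)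
        fix X assume "X \<subseteq> B"
        from hol[OF this] show "continuous_on (cball 0 R) (\<lambda>y. \<Sum>w\<in>X. p_term y w)"
          and "(\<lambda>y. \<Sum>w\<in>X. p_term y w) holomorphic_on ball 0 R"
          using holomorphic_on_imp_continuous_on holomorphic_on_subset ball_subset_cball by blast+
      qed
    qed auto
    have head: "(\<lambda>y. \<Sum>w\<in>A. p_term y w) holomorphic_on - (\<Lambda> - {0})"
      unfolding p_term_def by (intro holomorphic_intros) (auto simp: A_def)
    have eq: "wp_regular y = (\<Sum>w\<in>A. p_term y w) + (\<Sum>\<^sub>\<infinity>w\<in>B. p_term y w)" if "y \<in> ball 0 R" for y
    proof -
      have "wp_regular y = infsum (p_term y) (A \<union> B)"
        unfolding wp_regular_def A_def B_def by (rule arg_cong2[of _ _ _ _ infsum]) auto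
      also have "\<dots> = infsum (p_term y) A + infsum (p_term y) B"
      proof (rule infsum_Un_disjoint)
        show "p_term y summable_on B"
          using that unfolding B_def by (intro p_term_tail_summable) auto
      qed (use fin in \<open>auto simp: A_def B_def\<close>)
      finally show ?thesis using fin by simp
    qed
    have "(\<lambda>y. (\<Sum>w\<in>A. p_term y w) + (\<Sum>\<^sub>\<infinity>w\<in>B. p_term y w)) holomorphic_on (ball 0 R \<inter> - (\<Lambda> - {0}))"
      by (intro holomorphic_on_add holomorphic_on_subset[OF head] holomorphic_on_subset[OF tail]) auto
    then have "wp_regular holomorphic_on (ball 0 R \<inter> - (\<Lambda> - {0}))"
      by (rule holomorphic_transform) (use eq in auto)
    moreover have "open (ball 0 R \<inter> - (\<Lambda> - {0}))" using op by auto
    moreover have "x \<in> ball 0 R \<inter> - (\<Lambda> - {0})" using x by (auto simp: R_def)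
    ultimately show ?thesis using holomorphic_on_imp_differentiable_at by blast
  qed
  then show ?thesis using op by (simp add: holomorphic_on_def field_differentiable_at_within)
qed

lemma wp_holomorphic: "wp holomorphic_on - \<Lambda>"
  unfolding wp_eq
  by (intro holomorphic_intros holomorphic_on_subset[OF wp_regular_holomorphic]) auto

lemma wp_regular_uminus: "wp_regular (- x) = wp_regular x"
proof -
  have "(\<Sum>\<^sub>\<infinity>w\<in>\<Lambda> - {0}. p_term (- x) w) = (\<Sum>\<^sub>\<infinity>w\<in>\<Lambda> - {0}. p_term x w)"
    by (rule infsum_reindex_bij_witness[of _ uminus uminus])
       (auto simp: lattice_uminus p_term_def power2_eq_square algebra_simps)
  then show ?thesis by (simp add: wp_regular_def)
qed

lemma wp_regular_0: "wp_regular 0 = 0"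
  by (simp add: wp_regular_def p_term_def)

lemma wp_uminus [simp]: "wp (- x) = wp x"
  by (simp add: wp_eq wp_regular_uminus)

text \<open>The convention \<open>1 / 0 = 0\<close> makes \<open>p_term x 0\<close> the principal
  part \<open>1 / x^2\<close>. A sum over the whole lattice can be reindexed by a
  translation.\<close>

lemma wp_eq_full_sum: "(p_term x has_sum wp x) \<Lambda>"
proof -
  have "(p_term x has_sum (wp_regular x + p_term x 0)) ((\<Lambda> - {0}) \<union> {0})"
    unfolding wp_regular_def
    by (intro has_sum_Un_disjoint has_sum_infsum p_term_summable has_sum_finiteI) auto
  then show ?thesis by (simp add: wp_eq p_term_def insert_absorb add.commute)
qed

text \<open>After translating the index, the termwise difference of the two sums no longer contains
  \<open>x\<close>, so \<open>wp (x + v) - wp x\<close> is a constant \<open>K\<close>. Evenness at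
  \<open>x = - v / 2\<close> gives \<open>K = 0\<close>; the totalised sums make this valid even
  when \<open>v / 2\<close> is a pole.\<close>

lemma wp_periodic:
  assumes "v \<in> \<Lambda>"
  shows "wp (x + v) = wp x"
proof -
  define K where "K = (\<Sum>\<^sub>\<infinity>w\<in>\<Lambda>. 1 / w^2 - 1 / (w + v)^2)"
  have K: "wp (x + v) - wp x = K" for x
  proof -
    have "(p_term (x + v) has_sum wp (x + v)) \<Lambda>" by (rule wp_eq_full_sum)
    also have "?this \<longleftrightarrow> ((\<lambda>w. p_term (x + v) (w + v)) has_sum wp (x + v)) \<Lambda>"
      using assms lattice_diff lattice_add
      by (intro has_sum_reindex_bij_witness[of _ "\<lambda>w. w + v" "\<lambda>w. w - v"]) auto
    finally have "((\<lambda>w. p_term (x + v) (w + v) - p_term x w) has_sum (wp (x + v) - wp x)) \<Lambda>"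
      using has_sum_add[OF _ has_sum_uminusI[OF wp_eq_full_sum[of x]]] by fastforce
    then show ?thesis unfolding K_def p_term_def by (simp add: infsumI)
  qed
  have "- (v / 2) + v = v / 2" by simp
  then have "K = wp (v / 2) - wp (- (v / 2))" using K[of "- (v/2)"] by metis
  then have "K = 0" using wp_uminus[of "v/2"] by simp
  with K show ?thesis by (metis eq_iff_diff_eq_0)
qed

end

section \<open>Double zeros and Liouville's theorem for elliptic functions\<close>

lemma even_deriv_eq_0:
  fixes f :: "complex \<Rightarrow> complex"
  assumes "f holomorphic_on ball z r" "r > 0" "\<And>y. norm y < r \<Longrightarrow> f (z - y) = f (z + y)"
  shows "deriv f z = 0"
proof -
  have d: "(f has_field_derivative deriv f z) (at z)"
    using assms by (intro holomorphic_derivI[of f "ball z r"]) auto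
  have p: "((\<lambda>y. f (z + y)) has_field_derivative deriv f z) (at 0)"
    using d DERIV_shift[of f "deriv f z" 0 z] by (simp add: add.commute)
  have "((\<lambda>y. f (z - y)) has_field_derivative (- deriv f z)) (at 0)"
  proof -
    have "((\<lambda>y. z - y) has_field_derivative -1) (at 0)" by (auto intro!: derivative_eq_intros)
    then show ?thesis using DERIV_chain2[of f "deriv f z" "\<lambda>y. z - y" 0 "-1" UNIV] d by simp
  qed
  then have "((\<lambda>y. f (z + y)) has_field_derivative (- deriv f z)) (at 0)"
    by (rule has_field_derivative_transform_within_open[of _ _ _ "ball 0 r"])
       (use assms in auto)
  with p have "deriv f z = - deriv f z" by (rule DERIV_unique)
  then show ?thesis by simp
qed

text \<open>Two successive difference quotients at \<open>z\<close>, each with its singularity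
  removed.\<close>

lemma holomorphic_double_zero_factor:
  assumes "f holomorphic_on ball z r" "f z = 0" "deriv f z = 0"
  obtains h where "h holomorphic_on ball z r" "\<And>x. x \<in> ball z r \<Longrightarrow> f x = (x - z)\<^sup>2 * h x"
proof -
  define g where "g = (\<lambda>x. if x = z then deriv f z else (f x - f z) / (x - z))"
  define h where "h = (\<lambda>x. if x = z then deriv g z else (g x - g z) / (x - z))"
  have "g holomorphic_on ball z r" "h holomorphic_on ball z r"
    unfolding g_def h_def using assms by (intro pole_lemma_open; simp)+
  moreover have "f x = (x - z)\<^sup>2 * h x" if "x \<in> ball z r" for x
    using assms by (auto simp: h_def g_def power2_eq_square)
  ultimately show ?thesis using that by blast
qed

context lattice begin

lemma lattice_twice: "i \<in> {0..3} \<Longrightarrow> 2 * hp i \<in> \<Lambda>"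
proof -
  assume "i \<in> {0..3}"
  then have "i = 0 \<or> i = 1 \<or> i = 2 \<or> i = 3" by auto
  moreover have "2 * \<omega>1 \<in> \<Lambda>" unfolding period_lattice_def
    by (rule CollectI, rule exI[of _ 1], rule exI[of _ 0]) simp
  moreover have "2 * \<omega>3 \<in> \<Lambda>" unfolding period_lattice_def
    by (rule CollectI, rule exI[of _ 0], rule exI[of _ 1]) simp
  ultimately show ?thesis
    using lattice_diff[of "- (2 * \<omega>1)" "2 * \<omega>3"] lattice_uminus[of "2 * \<omega>1"]
    by (auto simp: half_period_def algebra_simps)
qed

lemma half_period_not_lattice: "i \<in> {1..3} \<Longrightarrow> hp i \<notin> \<Lambda>"
proof
  assume i: "i \<in> {1..3}" and "hp i \<in> \<Lambda>"
  then obtain a b :: int where "hp i = of_int a * (2 * \<omega>1) + of_int b * (2 * \<omega>3)"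
    by (auto simp: period_lattice_def)
  moreover have "i = 1 \<or> i = 2 \<or> i = 3" using i by auto
  ultimately have "of_real 1 * \<omega>1 + of_real 0 * \<omega>3 = of_real (2 * of_int a) * \<omega>1 + of_real (2 * of_int b) * \<omega>3
    \<or> of_real (-1) * \<omega>1 + of_real (-1) * \<omega>3 = of_real (2 * of_int a) * \<omega>1 + of_real (2 * of_int b) * \<omega>3
    \<or> of_real 0 * \<omega>1 + of_real 1 * \<omega>3 = of_real (2 * of_int a) * \<omega>1 + of_real (2 * of_int b) * \<omega>3"
    by (auto simp: half_period_def mult_ac)
  then have "1 = 2 * real_of_int a \<or> - 1 = 2 * real_of_int a \<or> 1 = 2 * real_of_int b"
    unfolding real_comb_eq_iff by blast
  then have "1 = 2 * a \<or> - 1 = 2 * a \<or> 1 = 2 * b" by linarith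
  then show False by presburger
qed

lemma lattice_index_cases:
  assumes "s \<in> S"
  obtains i w where "i \<in> {0..3}" "w \<in> \<Lambda>" "s = hp i + w"
  using assms by (auto simp: singular_points_def)

lemma Compl_singular_open: "open (- S)"
  by (rule open_Compl_singular_subset) auto

lemma Compl_lattice_open: "open (- \<Lambda>)"
  by (rule open_Compl_singular_subset[OF lattice_subset_singular])

lemma Compl_lattice_connected: "connected (- \<Lambda>)"
  by (rule path_connected_imp_connected, rule path_connected_complement_countable)
     (auto intro: countable_subset[OF lattice_subset_singular countable_singular])

lemma eventually_not_singular: "eventually (\<lambda>x. x \<notin> S) (at z)"
proof -
  obtain r where "r > 0" "ball z r \<inter> (S - {z}) = {}"
    using singular_discrete[of "S - {z}" z] by auto
  then show ?thesis unfolding eventually_at by (force simp: dist_commute intro!: exI[of _ r])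
qed

lemma fundamental_compact:
  obtains K where "compact K" "\<And>x. \<exists>w\<in>\<Lambda>. x + w \<in> K"
proof -
  define K where "K = (\<lambda>(s, t). of_real s * \<omega>1 + of_real t * \<omega>3) ` ({0..2::real} \<times> {0..2::real})"
  have "compact K" unfolding K_def
    by (intro compact_continuous_image compact_Times) (auto simp: case_prod_unfold intro!: continuous_intros)
  moreover have "\<exists>w\<in>\<Lambda>. x + w \<in> K" for x
  proof -
    define \<tau> where "\<tau> = \<omega>3 / \<omega>1"
    define t where "t = Im (x / \<omega>1) / Im \<tau>"
    define s where "s = Re (x / \<omega>1) - t * Re \<tau>"
    have "Im \<tau> \<noteq> 0" using indep by (simp add: \<tau>_def)
    then have "u = of_real (Re u - Im u / Im \<tau> * Re \<tau>) + of_real (Im u / Im \<tau>) * \<tau>" for u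
      by (simp add: complex_eq_iff)
    then have "x / \<omega>1 = of_real s + of_real t * \<tau>" unfolding s_def t_def .
    then have x: "x = of_real s * \<omega>1 + of_real t * \<omega>3"
      using nonzero by (simp add: \<tau>_def field_simps)
    define a b where "a = - \<lfloor>s / 2\<rfloor>" and "b = - \<lfloor>t / 2\<rfloor>"
    have "s + 2 * of_int a \<in> {0..2}" "t + 2 * of_int b \<in> {0..2}"
      unfolding a_def b_def by (simp; linarith)+
    then have "of_real (s + 2 * of_int a) * \<omega>1 + of_real (t + 2 * of_int b) * \<omega>3 \<in> K"
      unfolding K_def by (intro image_eqI[of _ _ "(s + 2 * of_int a, t + 2 * of_int b)"]) auto
    also have "of_real (s + 2 * of_int a) * \<omega>1 + of_real (t + 2 * of_int b) * \<omega>3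
      = x + (of_int a * (2 * \<omega>1) + of_int b * (2 * \<omega>3))"
      by (simp add: x algebra_simps)
    finally show ?thesis by (auto simp: period_lattice_def)
  qed
  ultimately show ?thesis using that by blast
qed

text \<open>The values of \<open>f\<close> at singular points are arbitrary, so the hypothesis
  speaks of limits. Periodicity carries the four limits to all of \<open>S\<close>; the function
  with these values filled in is entire and bounded.\<close>

lemma elliptic_Liouville:
  assumes hol: "f holomorphic_on - S"
    and per: "\<And>x w. x \<notin> S \<Longrightarrow> w \<in> \<Lambda> \<Longrightarrow> f (x + w) = f x"
    and lim: "\<And>i. i \<in> {0..3} \<Longrightarrow> \<exists>c. f \<midarrow>hp i\<rightarrow> c"
  obtains C where "\<And>x. x \<notin> S \<Longrightarrow> f x = C"
proof -
  have lims: "\<exists>c. f \<midarrow>s\<rightarrow> c" if s: "s \<in> S" for s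
  proof -
    obtain i w where iw: "i \<in> {0..3}" "w \<in> \<Lambda>" "s = hp i + w" using lattice_index_cases[OF s] .
    obtain c where "f \<midarrow>hp i\<rightarrow> c" using lim iw by blast
    then have "(\<lambda>x. f (x + - w)) \<midarrow>s\<rightarrow> c" using LIM_offset[of f c "hp i" "- w"] iw by simp
    moreover have "eventually (\<lambda>x. f (x + - w) = f x) (at s)"
      using eventually_not_singular[of s] by eventually_elim (use per iw lattice_uminus in blast)
    ultimately have "f \<midarrow>s\<rightarrow> c" by (rule Lim_transform_eventually)
    then show ?thesis by blast
  qed
  then obtain c where c: "\<And>s. s \<in> S \<Longrightarrow> f \<midarrow>s\<rightarrow> c s" by metis
  define g where "g = (\<lambda>x. if x \<in> S then c x else f x)"
  have "g field_differentiable (at x)" for x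
  proof (cases "x \<in> S")
    case False
    have "g holomorphic_on - S" by (rule holomorphic_transform[OF hol]) (auto simp: g_def)
    then show ?thesis using False Compl_singular_open holomorphic_on_imp_differentiable_at by auto
  next
    case True
    have op: "open (- (S - {x}))" by (rule open_Compl_singular_subset) auto
    have "(\<lambda>y. if y = x then c x else f y) holomorphic_on - (S - {x})"
      by (rule removable_singularity) (use op c True hol in \<open>auto elim!: holomorphic_on_subset\<close>)
    then have "g holomorphic_on - (S - {x})"
      by (rule holomorphic_transform) (use True in \<open>auto simp: g_def\<close>)
    then show ?thesis using op holomorphic_on_imp_differentiable_at by blast
  qed
  then have g: "g holomorphic_on UNIV" by (simp add: holomorphic_on_def field_differentiable_at_within)
  obtain K where K: "compact K" "\<And>x. \<exists>w\<in>\<Lambda>. x + w \<in> K" using fundamental_compact by blast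
  have "compact (g ` K)"
    using K(1) g by (intro compact_continuous_image holomorphic_on_imp_continuous_on) (auto elim: holomorphic_on_subset)
  then obtain B where B: "\<And>x. x \<in> K \<Longrightarrow> norm (g x) \<le> B"
    by (meson bounded_iff compact_imp_bounded image_eqI)
  have Bf: "norm (f x) \<le> B" if x: "x \<notin> S" for x
  proof -
    obtain w where w: "w \<in> \<Lambda>" "x + w \<in> K" using K(2) by blast
    then have "g (x + w) = f x" using x singular_add_lattice_iff per by (simp add: g_def)
    with B w show ?thesis by metis
  qed
  have "norm (g x) \<le> B" for x
  proof (cases "x \<in> S")
    case False
    then show ?thesis using Bf by (simp add: g_def)
  next
    case True
    \<comment> \<open>Periodicity is known only off \<open>S\<close>, so the bound reaches the
      filled-in values through the limit.\<close>
    have "norm (c x) \<le> B"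
      by (rule Lim_norm_ubound[OF _ c[OF True]])
         (use eventually_not_singular[of x] in \<open>auto elim!: eventually_mono simp: Bf\<close>)
    then show ?thesis using True by (simp add: g_def)
  qed
  then have "bounded (range g)" by (auto simp: bounded_iff)
  then obtain C where "\<And>x. g x = C" using Liouville_theorem[OF g] by (auto simp: constant_on_def)
  then have "f x = C" if "x \<notin> S" for x using that by (metis g_def)
  then show ?thesis by (rule that)
qed

lemma eq_off_singular_imp_eq:
  assumes "f holomorphic_on A" "open A" "\<And>x. x \<in> A \<Longrightarrow> x \<notin> S \<Longrightarrow> f x = C" "x \<in> A"
  shows "f x = C"
proof -
  have "f \<midarrow>x\<rightarrow> f x"
    using assms holomorphic_on_imp_continuous_on continuous_on_eq_continuous_at isCont_def by blast
  moreover have "f \<midarrow>x\<rightarrow> C"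
  proof (rule tendsto_eventually)
    have "eventually (\<lambda>y. y \<in> A) (at x)"
      using assms(2,4) eventually_at_in_open' by blast
    with eventually_not_singular[of x] show "eventually (\<lambda>y. f y = C) (at x)"
      by eventually_elim (use assms in auto)
  qed
  ultimately show ?thesis by (rule LIM_unique)
qed

end

section \<open>Differential equation and half-period shifts of the Weierstrass function\<close>

context lattice begin

lemma punctured_lattice_ball:
  obtains r where "r > 0" "ball 0 r \<inter> (\<Lambda> - {0}) = {}"
  using singular_discrete[of "\<Lambda> - {0}" 0] lattice_subset_singular by blast

text \<open>\<open>wp_regular\<close> is even and vanishes at 0, so its expansion starts at order
  two. This keeps the cross term \<open>12 * wp_regular x / x^2\<close> of
  \<open>6 * (wp x)^2\<close> bounded.\<close>

lemma wp_regular_factor: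
  obtains r \<psi> where "r > 0" "ball 0 r \<inter> (\<Lambda> - {0}) = {}" "wp_regular holomorphic_on ball 0 r"
    "\<psi> holomorphic_on ball 0 r" "\<And>x. x \<in> ball 0 r \<Longrightarrow> wp_regular x = x\<^sup>2 * \<psi> x"
proof -
  obtain r where r: "r > 0" "ball 0 r \<inter> (\<Lambda> - {0}) = {}" by (rule punctured_lattice_ball)
  have hol: "wp_regular holomorphic_on ball 0 r"
    by (rule holomorphic_on_subset[OF wp_regular_holomorphic]) (use r in auto)
  have "deriv wp_regular 0 = 0"
    by (rule even_deriv_eq_0[OF hol r(1)]) (simp add: wp_regular_uminus)
  then obtain h where "h holomorphic_on ball 0 r" "\<And>x. x \<in> ball 0 r \<Longrightarrow> wp_regular x = (x - 0)\<^sup>2 * h x"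
    using holomorphic_double_zero_factor[OF hol wp_regular_0] by blast
  with r hol show ?thesis using that by simp
qed

lemma holomorphic_on_lim: "f holomorphic_on A \<Longrightarrow> open A \<Longrightarrow> x \<in> A \<Longrightarrow> f \<midarrow>x\<rightarrow> f x"
  using holomorphic_on_imp_continuous_on continuous_on_eq_continuous_at isCont_def by blast

lemma half_period_index_cases: "i \<in> {0..3} \<Longrightarrow> i = 0 \<or> i \<in> {1..3::nat}"
  by auto

text \<open>The poles of order four of \<open>wp''\<close> and \<open>6 * wp^2\<close> cancel at 0,
  and the factorisation of \<open>wp_regular\<close> leaves no lower pole. Liouville's theorem then
  makes the difference constant.\<close>

lemma wp_second_deriv:
  obtains C where "\<And>x. x \<notin> \<Lambda> \<Longrightarrow> deriv (deriv wp) x = 6 * (wp x)\<^sup>2 + C"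
proof -
  define f where "f = (\<lambda>x. deriv (deriv wp) x - 6 * (wp x)\<^sup>2)"
  have f: "f holomorphic_on - \<Lambda>"
    unfolding f_def by (intro holomorphic_intros wp_holomorphic Compl_lattice_open)
  have d2: "deriv (deriv wp) (x + w) = deriv (deriv wp) x" if "x \<notin> \<Lambda>" "w \<in> \<Lambda>" for x w
  proof -
    \<comment> \<open>\<open>deriv\<close> chooses among the possible derivatives. Translation gives
      the same candidates at \<open>y\<close> and \<open>y + w\<close>, hence the same choice,
      singular points included.\<close>
    have shift: "deriv g (y + w) = deriv g y" if "\<And>x. g (x + w) = g x" for g :: "complex \<Rightarrow> complex" and y
    proof -
      have "(g has_field_derivative D) (at (y + w)) \<longleftrightarrow> (g has_field_derivative D) (at y)" for D
        using DERIV_shift[of g D y w] that by simp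
      then show ?thesis by (simp add: deriv_def)
    qed
    have "deriv wp (x + w) = deriv wp x" for x by (rule shift) (simp add: wp_periodic that)
    then show ?thesis by (rule shift)
  qed
  obtain r \<psi> where r: "r > 0" "ball 0 r \<inter> (\<Lambda> - {0}) = {}" "wp_regular holomorphic_on ball 0 r"
    "\<psi> holomorphic_on ball 0 r" "\<And>x. x \<in> ball 0 r \<Longrightarrow> wp_regular x = x\<^sup>2 * \<psi> x"
    using wp_regular_factor by blast
  have "\<exists>C. \<forall>x. x \<notin> S \<longrightarrow> f x = C"
  proof (rule elliptic_Liouville)
    show "f holomorphic_on - S" using f lattice_subset_singular by (auto elim: holomorphic_on_subset)
    show "f (x + w) = f x" if "x \<notin> S" "w \<in> \<Lambda>" for x w
      using that d2 lattice_subset_singular by (auto simp: f_def wp_periodic)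
    fix i :: nat assume "i \<in> {0..3}"
    then consider "i = 0" | "i \<in> {1..3}" using half_period_index_cases by blast
    then show "\<exists>c. f \<midarrow>hp i\<rightarrow> c"
    proof cases
      case 2
      then show ?thesis using holomorphic_on_lim[OF f Compl_lattice_open] half_period_not_lattice by blast
    next
      case 1
      \<comment> \<open>This is \<open>f\<close> after \<open>6 / x^4\<close> has cancelled;
        \<open>12 * \<psi> x\<close> is what remains of the cross term.\<close>
      define h where "h = (\<lambda>x. deriv (deriv wp_regular) x - 12 * \<psi> x - 6 * (wp_regular x)\<^sup>2)"
      have "h holomorphic_on ball 0 r" unfolding h_def using r by (intro holomorphic_intros) auto
      then have "h \<midarrow>0\<rightarrow> h 0" using r(1) by (intro holomorphic_on_lim[of _ "ball 0 r"]) auto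
      moreover have "f x = h x" if x: "x \<in> ball 0 r - {0}" for x
      proof -
        define U :: "complex set" where "U = ball 0 r - {0}"
        have U: "open U" by (auto simp: U_def)
        have reg: "(wp_regular has_field_derivative deriv wp_regular y) (at y)"
          "(deriv wp_regular has_field_derivative deriv (deriv wp_regular) y) (at y)" if "y \<in> U" for y
          using that r(3) by (auto intro!: holomorphic_derivI[of _ "ball 0 r"] holomorphic_deriv simp: U_def)
        have d1: "deriv wp y = - 2 / y ^ 3 + deriv wp_regular y" if y: "y \<in> U" for y
        proof -
          have "y \<noteq> 0" using y by (auto simp: U_def)
          then have "((\<lambda>x. 1 / x^2) has_field_derivative - 2 / y ^ 3) (at y)"
            by (auto intro!: derivative_eq_intros simp: divide_simps power2_eq_square power3_eq_cube)
          then have "((\<lambda>x. 1 / x^2 + wp_regular x) has_field_derivative (- 2 / y ^ 3 + deriv wp_regular y)) (at y)"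
            by (rule DERIV_add) (rule reg[OF y])
          then show ?thesis unfolding wp_eq[symmetric] by (rule DERIV_imp_deriv)
        qed
        have "x \<in> U" "x \<noteq> 0" using x by (auto simp: U_def)
        have "((\<lambda>y. - 2 / y ^ 3) has_field_derivative 6 / x ^ 4) (at x)"
          using \<open>x \<noteq> 0\<close> by (auto intro!: derivative_eq_intros simp: divide_simps power_numeral_reduce)
        then have "((\<lambda>y. - 2 / y ^ 3 + deriv wp_regular y) has_field_derivative (6 / x ^ 4 + deriv (deriv wp_regular) x)) (at x)"
          by (rule DERIV_add) (rule reg[OF \<open>x \<in> U\<close>])
        then have "(deriv wp has_field_derivative (6 / x ^ 4 + deriv (deriv wp_regular) x)) (at x)"
          by (rule has_field_derivative_transform_within_open[OF _ U \<open>x \<in> U\<close>]) (simp add: d1)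
        then have "deriv (deriv wp) x = 6 / x ^ 4 + deriv (deriv wp_regular) x" by (rule DERIV_imp_deriv)
        moreover have "6 * (1 / x\<^sup>2 + x\<^sup>2 * p)\<^sup>2 = 6 / x ^ 4 + 12 * p + 6 * (x\<^sup>2 * p)\<^sup>2" for p
          using \<open>x \<noteq> 0\<close> by (simp add: field_simps power_numeral_reduce)
        ultimately show ?thesis
          using x r(5)[of x] by (simp add: f_def h_def wp_eq)
      qed
      then have "eventually (\<lambda>x. h x = f x) (at 0)"
        using r(1) unfolding eventually_at by (intro exI[of _ r]) (auto simp: dist_norm)
      ultimately have "f \<midarrow>0\<rightarrow> h 0" by (rule Lim_transform_eventually)
      then show ?thesis using 1 by (auto simp: half_period_def)
    qed
  qed blast
  then obtain C where C: "\<And>x. x \<notin> S \<Longrightarrow> f x = C" by blast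
  have "f x = C" if "x \<notin> \<Lambda>" for x
    using eq_off_singular_imp_eq[OF f Compl_lattice_open C] that by simp
  then have "deriv (deriv wp) x = 6 * (wp x)\<^sup>2 + C" if "x \<notin> \<Lambda>" for x
    using that by (simp add: f_def diff_eq_eq add_ac)
  then show ?thesis by (rule that)
qed

lemma wp_derivs:
  assumes "x \<notin> \<Lambda>"
  shows "(wp has_field_derivative deriv wp x) (at x)"
    "(deriv wp has_field_derivative deriv (deriv wp) x) (at x)"
  using assms Compl_lattice_open wp_holomorphic
  by (auto intro!: holomorphic_derivI[of _ "- \<Lambda>"] holomorphic_deriv)

lemma wp_reflect: "i \<in> {0..3} \<Longrightarrow> wp (hp i - y) = wp (hp i + y)"
proof -
  assume "i \<in> {0..3}"
  then have "wp (- (hp i + y) + 2 * hp i) = wp (- (hp i + y))" by (intro wp_periodic lattice_twice)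
  moreover have "- (hp i + y) + 2 * hp i = hp i - y" by simp
  ultimately show ?thesis by (simp only: wp_uminus)
qed

lemma lattice_ball_avoid:
  assumes "x \<notin> \<Lambda>"
  obtains r where "r > 0" "ball x r \<inter> \<Lambda> = {}"
  using singular_discrete[OF lattice_subset_singular assms] by blast

lemma deriv_wp_half_period: "i \<in> {1..3} \<Longrightarrow> deriv wp (hp i) = 0"
proof -
  assume i: "i \<in> {1..3}"
  obtain r where r: "r > 0" "ball (hp i) r \<inter> \<Lambda> = {}"
    using lattice_ball_avoid[OF half_period_not_lattice[OF i]] .
  show ?thesis
  proof (rule even_deriv_eq_0[OF _ r(1)])
    show "wp holomorphic_on ball (hp i) r" using r by (auto intro: holomorphic_on_subset[OF wp_holomorphic])
  qed (use i wp_reflect in auto)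
qed

abbreviation "ev \<equiv> e_val \<omega>1 \<omega>3"

lemma wp_filterlim_0: "filterlim wp at_infinity (at 0)"
proof -
  obtain r where r: "r > 0" "ball 0 r \<inter> (\<Lambda> - {0}) = {}" by (rule punctured_lattice_ball)
  have "wp_regular holomorphic_on ball 0 r"
    by (rule holomorphic_on_subset[OF wp_regular_holomorphic]) (use r in auto)
  then have lim: "wp_regular \<midarrow>0\<rightarrow> wp_regular 0"
    using r(1) by (intro holomorphic_on_lim[of _ "ball 0 r"]) auto
  have "filterlim (\<lambda>x::complex. 1 / x^2) at_infinity (at 0)"
  proof (rule filterlim_divide_at_infinity)
    show "filterlim (\<lambda>x::complex. x^2) (at 0) (at 0)"
      unfolding filterlim_at by (auto intro!: tendsto_eq_intros simp: eventually_at_filter)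
  qed auto
  from tendsto_add_filterlim_at_infinity'[OF this lim] show ?thesis
    by (simp add: wp_eq[abs_def])
qed

lemma half_period_sum:
  assumes "i \<in> {1..3}" "j \<in> {1..3}" "k \<in> {1..3}" "distinct [i, j, k]"
  shows "hp i + hp j = - hp k"
proof -
  have "i = 1 \<or> i = 2 \<or> i = 3" "j = 1 \<or> j = 2 \<or> j = 3" "k = 1 \<or> k = 2 \<or> k = 3" using assms by auto
  then show ?thesis using assms(4) by (auto simp: half_period_def)
qed

lemma shift_half_period_singular_iff: "i \<in> {0..3} \<Longrightarrow> x + hp i \<in> S \<longleftrightarrow> x \<in> S"
proof -
  have add: "y + z \<in> S" if y: "y \<in> S" and z: "z \<in> S" for y z
  proof -
    from y z obtain a b c d :: int where "y = of_int a * \<omega>1 + of_int b * \<omega>3" "z = of_int c * \<omega>1 + of_int d * \<omega>3"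
      unfolding singular_points_eq by auto
    then have "y + z = of_int (a+c) * \<omega>1 + of_int (b+d) * \<omega>3" by (simp add: algebra_simps)
    then show ?thesis unfolding singular_points_eq by blast
  qed
  have um: "- y \<in> S" if "y \<in> S" for y
  proof -
    from that obtain a b :: int where "y = of_int a * \<omega>1 + of_int b * \<omega>3"
      unfolding singular_points_eq by auto
    then have "- y = of_int (-a) * \<omega>1 + of_int (-b) * \<omega>3" by simp
    then show ?thesis unfolding singular_points_eq by blast
  qed
  assume "i \<in> {0..3}"
  then have "hp i \<in> S" by (rule half_period_in_singular)
  then show ?thesis using add[of x "hp i"] add[of "x + hp i" "- hp i"] um by auto
qed

text \<open>At 0 and at \<open>hp i\<close> one factor has a double pole and the other a zero of
  order at least two, so the product is bounded and hence constant. Its value is read off at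
  \<open>hp j\<close>, where the shift by \<open>hp i\<close> leads to
  \<open>- hp k\<close>.\<close>

lemma wp_shift_product:
  assumes "i \<in> {1..3}" "j \<in> {1..3}" "k \<in> {1..3}" "distinct [i, j, k]" "x \<notin> S"
  shows "(wp (x + hp i) - ev i) * (wp x - ev i) = (ev j - ev i) * (ev k - ev i)"
proof -
  have i03: "i \<in> {0..3}" using assms by auto
  define f where "f = (\<lambda>x. (wp (x + hp i) - ev i) * (wp x - ev i))"
  define A where "A = - \<Lambda> \<inter> (\<lambda>x. x + hp i) -` (- \<Lambda>)"
  have A: "open A" unfolding A_def
    by (intro open_Int open_vimage Compl_lattice_open) (auto intro!: continuous_intros)
  have "(wp \<circ> (\<lambda>x. x + hp i)) holomorphic_on A"
    by (intro holomorphic_on_compose_gen[OF _ wp_holomorphic] holomorphic_intros) (auto simp: A_def)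
  then have f: "f holomorphic_on A" unfolding f_def
    by (intro holomorphic_intros holomorphic_on_subset[OF wp_holomorphic]) (auto simp: o_def A_def)
  have SA: "x \<in> A" if "x \<notin> S" for x
    using that lattice_subset_singular shift_half_period_singular_iff[OF i03, of x] by (auto simp: A_def)
  obtain r where r: "r > 0" "ball 0 r \<inter> (\<Lambda> - {0}) = {}" by (rule punctured_lattice_ball)
  obtain r' where r': "r' > 0" "ball (hp i) r' \<inter> \<Lambda> = {}"
    using lattice_ball_avoid[OF half_period_not_lattice] assms by blast
  have lim0: "\<exists>c. f \<midarrow>0\<rightarrow> c"
  proof -
    define g where "g = (\<lambda>x. wp (x + hp i) - ev i)"
    have g: "g holomorphic_on ball 0 r'"
    proof -
      have "(wp \<circ> (\<lambda>x. x + hp i)) holomorphic_on ball 0 r'"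
        using r' by (intro holomorphic_on_compose_gen[OF _ wp_holomorphic] holomorphic_intros)
          (auto simp: dist_norm disjoint_iff algebra_simps)
      then show ?thesis unfolding g_def by (intro holomorphic_intros) (simp add: o_def)
    qed
    have "deriv g 0 = 0"
    proof (rule even_deriv_eq_0[OF g r'(1)])
      show "g (0 - y) = g (0 + y)" for y
        using wp_reflect[OF i03, of y] by (simp add: g_def add.commute)
    qed
    moreover have "g 0 = 0" by (simp add: g_def e_val_def)
    ultimately obtain h where h: "h holomorphic_on ball 0 r'" "\<And>x. x \<in> ball 0 r' \<Longrightarrow> g x = (x - 0)\<^sup>2 * h x"
      using holomorphic_double_zero_factor[OF g] by blast
    define s where "s = min r r'"
    have "(\<lambda>x. h x * (1 + x^2 * (wp_regular x - ev i))) holomorphic_on ball 0 s"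
      using r by (intro holomorphic_intros holomorphic_on_subset[OF h(1)] holomorphic_on_subset[OF wp_regular_holomorphic])
        (auto simp: s_def)
    then have "(\<lambda>x. h x * (1 + x^2 * (wp_regular x - ev i))) \<midarrow>0\<rightarrow> h 0 * (1 + 0^2 * (wp_regular 0 - ev i))"
      by (rule holomorphic_on_lim) (use r r' in \<open>auto simp: s_def\<close>)
    moreover have "h x * (1 + x^2 * (wp_regular x - ev i)) = f x" if "x \<in> ball 0 s - {0}" for x
    proof -
      have "g x = x\<^sup>2 * h x" "x \<noteq> 0" using that h(2)[of x] by (auto simp: s_def)
      moreover have "f x = g x * (1 / x^2 + (wp_regular x - ev i))" by (simp add: f_def g_def wp_eq[of x])
      ultimately show ?thesis by (simp add: divide_simps)
    qed
    then have "eventually (\<lambda>x. h x * (1 + x^2 * (wp_regular x - ev i)) = f x) (at 0)"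
      using r(1) r'(1) unfolding eventually_at by (intro exI[of _ s]) (auto simp: dist_norm s_def)
    ultimately have "f \<midarrow>0\<rightarrow> h 0 * (1 + 0^2 * (wp_regular 0 - ev i))" by (rule Lim_transform_eventually)
    then show ?thesis by blast
  qed
  \<comment> \<open>\<open>2 * hp i\<close> is a period, so the shift exchanges the two factors; the
    limit at \<open>hp i\<close> is then the one at 0.\<close>
  have refl: "f (x + hp i) = f x" for x
  proof -
    have "wp (x + hp i + hp i) = wp x"
      using wp_periodic[OF lattice_twice[OF i03], of x] by (simp only: mult_2 add.assoc)
    then show ?thesis by (simp add: f_def)
  qed
  have "\<exists>C. \<forall>x. x \<notin> S \<longrightarrow> f x = C"
  proof (rule elliptic_Liouville)
    show "f holomorphic_on - S" by (rule holomorphic_on_subset[OF f]) (use SA in auto)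
    show "f (x + w) = f x" if "x \<notin> S" "w \<in> \<Lambda>" for x w
      using wp_periodic[OF that(2), of x] wp_periodic[OF that(2), of "x + hp i"] by (simp add: f_def add_ac)
    fix m :: nat assume m: "m \<in> {0..3}"
    consider "m = 0" | "m = i" | "m \<noteq> 0" "m \<noteq> i" by blast
    then show "\<exists>c. f \<midarrow>hp m\<rightarrow> c"
    proof cases
      case 1 then show ?thesis using lim0 by (simp add: half_period_def)
    next
      case 2
      obtain c where "f \<midarrow>0\<rightarrow> c" using lim0 by blast
      then have "(\<lambda>x. f (x + hp i)) \<midarrow>0\<rightarrow> c" by (simp add: refl)
      then have "f \<midarrow>hp i\<rightarrow> c" using LIM_offset_zero_cancel[of f "hp i" c] by (simp add: add.commute)
      then show ?thesis using 2 by blast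
    next
      case 3
      have m13: "m \<in> {1..3}" using 3 m by auto
      have "\<exists>n\<in>{1..3}. distinct [m, i, n]"
        using assms 3 by (cases "m = j") (auto intro: bexI[of _ k] bexI[of _ j])
      then obtain n where n: "n \<in> {1..3}" "distinct [m, i, n]" "m \<in> {1..3}" using m13 by blast
      then have "hp m + hp i = - hp n" using half_period_sum assms(1) by blast
      then have "hp m + hp i \<notin> \<Lambda>" using half_period_not_lattice[OF n(1)] lattice_uminus by fastforce
      then have "hp m \<in> A" using half_period_not_lattice[OF n(3)] by (simp add: A_def)
      then show ?thesis using holomorphic_on_lim[OF f A] by blast
    qed
  qed blast
  then obtain C where C: "\<And>x. x \<notin> S \<Longrightarrow> f x = C" by blast
  have sum: "hp j + hp i = - hp k" using half_period_sum[of j i k] assms by auto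
  then have "hp j + hp i \<notin> \<Lambda>" using half_period_not_lattice[OF assms(3)] lattice_uminus by fastforce
  then have "hp j \<in> A" using half_period_not_lattice[OF assms(2)] by (simp add: A_def)
  then have "f (hp j) = C" using eq_off_singular_imp_eq[OF f A C] by blast
  then have "C = (ev k - ev i) * (ev j - ev i)" by (simp add: f_def sum e_val_def)
  then show ?thesis using C[OF assms(5)] by (simp add: f_def)
qed

text \<open>If \<open>ev i = ev j\<close>, the shift product vanishes identically. Near the pole at
  0 the factor \<open>wp x - ev i\<close> is nonzero, so \<open>wp\<close> is constant near
  \<open>hp i\<close>, and then on the whole connected complement of the lattice, against the
  pole.\<close>

lemma e_val_distinct:
  assumes "i \<in> {1..3}" "j \<in> {1..3}" "i \<noteq> j"
  shows "ev i \<noteq> ev j"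
proof
  assume eq: "ev i = ev j"
  \<comment> \<open>The three indices add up to 6.\<close>
  have "\<exists>k\<in>{1..3}. k \<noteq> i \<and> k \<noteq> j" using assms by (intro bexI[of _ "6 - i - j"]) (auto, presburger+)
  then obtain k where k: "k \<in> {1..3}" "distinct [i, j, k]" using assms by auto
  have i03: "i \<in> {0..3}" using assms by auto
  have 0: "(wp (x + hp i) - ev i) * (wp x - ev i) = 0" if "x \<notin> S" for x
    using wp_shift_product[OF assms(1,2) k that] eq by simp
  have "eventually (\<lambda>x. wp x \<noteq> ev i) (at 0)"
    using filterlim_at_infinity_imp_eventually_ne[OF wp_filterlim_0] .
  with eventually_not_singular[of 0]
  have "eventually (\<lambda>x. wp (x + hp i) = ev i) (at 0)" 
    by eventually_elim (use 0 in auto)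
  then obtain r where r: "r > 0" "\<And>x. x \<noteq> 0 \<Longrightarrow> norm x < r \<Longrightarrow> wp (x + hp i) = ev i"
    by (auto simp: eventually_at dist_norm)
  obtain r' where r': "r' > 0" "ball (hp i) r' \<inter> \<Lambda> = {}"
    using lattice_ball_avoid[OF half_period_not_lattice] assms by blast
  have "wp x - ev i = 0" if "x \<in> - \<Lambda>" for x
  proof (rule analytic_continuation_open[of "ball (hp i) (min r r')" "- \<Lambda>" "\<lambda>x. wp x - ev i" "\<lambda>_. 0"])
    show "wp x - ev i = 0" if "x \<in> ball (hp i) (min r r')" for x
      using r(2)[of "x - hp i"] that by (cases "x = hp i") (auto simp: e_val_def dist_norm norm_minus_commute)
    show "(\<lambda>x. wp x - ev i) holomorphic_on - \<Lambda>" by (intro holomorphic_intros wp_holomorphic)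
    show "ball (hp i) (min r r') \<noteq> {}" using r(1) r'(1) by simp
    show "ball (hp i) (min r r') \<subseteq> - \<Lambda>" using r'(2) by auto
  qed (use that Compl_lattice_open Compl_lattice_connected in auto)
  moreover obtain x where "x \<notin> \<Lambda>" "wp x \<noteq> ev i"
  proof -
    have "eventually (\<lambda>x. wp x \<noteq> ev i \<and> x \<notin> S) (at 0)"
      by (intro eventually_conj filterlim_at_infinity_imp_eventually_ne[OF wp_filterlim_0] eventually_not_singular)
    then have "\<exists>x. wp x \<noteq> ev i \<and> x \<notin> S" by (rule eventually_happens'[OF at_neq_bot])
    then show ?thesis using that lattice_subset_singular by auto
  qed
  ultimately show False by simp
qed

text \<open>Takes the place of counting zeros of an elliptic function: the shift product is a
  nonzero constant, so neither factor can vanish.\<close>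

lemma wp_ne_e_val:
  assumes "i \<in> {1..3}" "x \<notin> S"
  shows "wp x \<noteq> ev i"
proof -
  obtain j k where jk: "j \<in> {1..3}" "k \<in> {1..3}" "distinct [i, j, k]"
  proof -
    have "i = 1 \<or> i = 2 \<or> i = 3" using assms by auto
    then show ?thesis using that[of 1 2] that[of 1 3] that[of 2 3] by auto
  qed
  have "(ev j - ev i) * (ev k - ev i) \<noteq> 0"
    using e_val_distinct[OF assms(1) jk(1)] e_val_distinct[OF assms(1) jk(2)] jk(3) by simp
  then show ?thesis using wp_shift_product[OF assms(1) jk assms(2)] by auto
qed

text \<open>Multiplying the second-order equation by \<open>2 * deriv wp\<close> and integrating
  gives a cubic in \<open>wp\<close> with leading coefficient 4 and no quadratic term. Its roots are
  the three distinct \<open>ev i\<close>, because \<open>deriv wp\<close> vanishes at the half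
  periods.\<close>

lemma wp_ode:
  assumes "x \<notin> \<Lambda>"
  shows "(deriv wp x)\<^sup>2 = 4 * (wp x - ev 1) * (wp x - ev 2) * (wp x - ev 3)"
proof -
  obtain C where C: "\<And>x. x \<notin> \<Lambda> \<Longrightarrow> deriv (deriv wp) x = 6 * (wp x)\<^sup>2 + C" using wp_second_deriv by blast
  define f where "f = (\<lambda>x. (deriv wp x)\<^sup>2 - 4 * (wp x)^3 - 2 * C * wp x)"
  have "(f has_field_derivative 0) (at x)" if "x \<in> - \<Lambda>" for x
  proof -
    have "x \<notin> \<Lambda>" using that by simp
    then show ?thesis unfolding f_def
      by (auto intro!: derivative_eq_intros wp_derivs[OF \<open>x \<notin> \<Lambda>\<close>] simp: C power2_eq_square algebra_simps)
  qed
  then have "\<exists>K. \<forall>x\<in>-\<Lambda>. f x = K"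
    using has_field_derivative_0_imp_constant_on[of "- \<Lambda>" f] Compl_lattice_connected Compl_lattice_open
    unfolding constant_on_def by blast
  then obtain K where "\<And>x. x \<notin> \<Lambda> \<Longrightarrow> f x = K" by auto
  then have K: "(deriv wp x)\<^sup>2 = 4 * (wp x)^3 + 2 * C * wp x + K" if "x \<notin> \<Lambda>" for x
    using that by (simp add: f_def diff_eq_eq add_ac)
  have root: "4 * (ev i)^3 + 2 * C * ev i + K = 0" if "i \<in> {1..3}" for i
    using K[OF half_period_not_lattice[OF that]] deriv_wp_half_period[OF that] by (simp add: e_val_def)
  define a b c where "a = ev 1" and "b = ev 2" and "c = ev 3"
  have ne: "a \<noteq> b" "a \<noteq> c" "b \<noteq> c" using e_val_distinct[of 1 2] e_val_distinct[of 1 3] e_val_distinct[of 2 3]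
    by (simp_all add: a_def b_def c_def)
  have r: "4 * a^3 + 2 * C * a + K = 0" "4 * b^3 + 2 * C * b + K = 0" "4 * c^3 + 2 * C * c + K = 0"
    using root[of 1] root[of 2] root[of 3] by (auto simp: a_def b_def c_def)
  \<comment> \<open>Dividing differences of the root equations by differences of the roots recovers
    Vieta's relations, in particular \<open>a + b + c = 0\<close>.\<close>
  have "(a - b) * (4 * (a^2 + a*b + b^2) + 2 * C) = 0" using r(1,2) by algebra
  then have ab: "4 * (a^2 + a*b + b^2) + 2 * C = 0" using ne by simp
  have "(a - c) * (4 * (a^2 + a*c + c^2) + 2 * C) = 0" using r(1,3) by algebra
  then have ac: "4 * (a^2 + a*c + c^2) + 2 * C = 0" using ne by simp
  have "(b - c) * (a + b + c) = 0" using ab ac by algebra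
  then have s: "a + b + c = 0" using ne by simp
  have c: "c = - a - b" using s by algebra
  have C': "C = - 2 * (a^2 + a*b + b^2)" using ab by algebra
  have K': "K = - 4 * a^3 - 2 * C * a" using r(1) by algebra
  have "4 * z^3 + 2 * C * z + K = 4 * (z - a) * (z - b) * (z - c)" for z
    unfolding K' C' c by (simp add: power2_eq_square power3_eq_cube algebra_simps)
  then show ?thesis using K[OF assms] by (simp add: a_def b_def c_def)
qed

end

subsection \<open>Heun's equation\<close>

text \<open>The equation \<open>f'' = pot f\<close>, where derivatives are taken along a coordinate \<open>v\<close> with
  \<open>v'\<^sup>2 = 4 v (v - a) (v - b)\<close>, and exponents \<open>g0, gA, gB\<close> are chosen at \<open>0, a, b\<close>. Dividing \<open>f\<close> by
  \<open>v^g0 (v - a)^gA (v - b)^gB\<close> turns \<open>f'' - pot f\<close> into \<open>heun_op\<close>, which maps \<open>v^n\<close> to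
  \<open>coeffX n * v^(n + 1) + coeffY n * v^n + coeffZ n * v^(n - 1)\<close>.\<close>

locale heun =
  fixes a b g0 gA gB \<mu> e :: complex
  assumes ab: "a \<noteq> 0" "b \<noteq> 0"
begin

definition cubic :: "complex \<Rightarrow> complex" where "cubic v = v * (v - a) * (v - b)"

definition dcubic :: "complex \<Rightarrow> complex" where
  "dcubic v = (v - a) * (v - b) + v * (v - b) + v * (v - a)"

text \<open>The logarithmic derivative of \<open>v^g0 (v - a)^gA (v - b)^gB\<close> with respect to
  \<open>v\<close>.\<close>

definition gauge :: "complex \<Rightarrow> complex" where
  "gauge v = g0 / v + gA / (v - a) + gB / (v - b)"

text \<open>When \<open>v\<close> has a double zero in \<open>x\<close>, the exponent in
  \<open>x\<close> is \<open>2 * g0\<close>, so \<open>2 * g0 * (2 * g0 - 1)\<close> is a coupling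
  constant \<open>m (m + 1)\<close>. The rational functions of \<open>v\<close> are half-period
  translates of \<open>wp\<close> up to a common constant, which is absorbed into \<open>e\<close>;
  \<open>\<mu>\<close> is the coupling at the pole of \<open>v\<close>.\<close>

definition pot :: "complex \<Rightarrow> complex" where
  "pot v = \<mu> * v + 2 * g0 * (2 * g0 - 1) * (a * b / v)
     + 2 * gA * (2 * gA - 1) * (a + a * (a - b) / (v - a))
     + 2 * gB * (2 * gB - 1) * (b + b * (b - a) / (v - b)) - e"

text \<open>\<open>coeffX\<close> and \<open>coeffZ\<close> are the indicial polynomials at infinity
  and at 0. The nonzero root \<open>1/2 - 2 * g0\<close> of \<open>coeffZ\<close> is the gap between
  the two exponents at 0, measured in powers of \<open>v\<close>.\<close>

definition coeffX :: "nat \<Rightarrow> complex" where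
  "coeffX n = 4 * (of_nat n + (g0 + gA + gB))\<^sup>2 + 2 * (of_nat n + (g0 + gA + gB)) - \<mu>"

definition coeffY :: "nat \<Rightarrow> complex" where
  "coeffY n = e - 4 * b * (of_nat n + g0 + gA)\<^sup>2 - 4 * a * (of_nat n + g0 + gB)\<^sup>2"

definition coeffZ :: "nat \<Rightarrow> complex" where
  "coeffZ n = 2 * a * b * of_nat n * (2 * of_nat n - 1 + 4 * g0)"

text \<open>The coefficient of \<open>v^n\<close> in \<open>heun_op\<close> applied to the power
  series with coefficients \<open>c\<close>.\<close>

definition row :: "(nat \<Rightarrow> complex) \<Rightarrow> nat \<Rightarrow> complex" where
  "row c n = (case n of 0 \<Rightarrow> 0 | Suc m \<Rightarrow> coeffX m * c m) + coeffY n * c n + coeffZ (Suc n) * c (Suc n)"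

definition heun_op :: "complex \<Rightarrow> complex \<Rightarrow> complex \<Rightarrow> complex \<Rightarrow> complex" where
  "heun_op v y y1 y2 = 4 * cubic v * y2
     + (2 * dcubic v + 8 * (g0 * (v - a) * (v - b) + gA * v * (v - b) + gB * v * (v - a))) * y1
     + ((4 * (g0 + gA + gB)\<^sup>2 + 2 * (g0 + gA + gB) - \<mu>) * v + coeffY 0) * y"

text \<open>Treating the reciprocals as variables \<open>p, q, r\<close> subject to
  \<open>v * p = 1\<close> and its analogues splits the square of the gauge into three pure and
  three mixed terms, each of which reduces to a polynomial identity. What remains of
  \<open>p\<close>, \<open>q\<close>, \<open>r\<close> in the pure terms is the polar part of
  \<open>pot\<close>.\<close>

lemma gauge_identity:
  assumes "v \<noteq> 0" "v \<noteq> a" "v \<noteq> b"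
  shows "4 * cubic v * (y2 + 2 * gauge v * y1 + ((gauge v)\<^sup>2 - g0 / v\<^sup>2 - gA / (v - a)\<^sup>2 - gB / (v - b)\<^sup>2) * y)
     + 2 * dcubic v * (y1 + gauge v * y) = pot v * y + heun_op v y y1 y2"
proof -
  define p q r where "p = 1 / v" and "q = 1 / (v - a)" and "r = 1 / (v - b)"
  have pqr: "v * p = 1" "(v - a) * q = 1" "(v - b) * r = 1"
    using assms by (auto simp: p_def q_def r_def)
  have "g0 / v = g0 * p" "gA / (v - a) = gA * q" "gB / (v - b) = gB * r"
    "g0 / v\<^sup>2 = g0 * p\<^sup>2" "gA / (v - a)\<^sup>2 = gA * q\<^sup>2" "gB / (v - b)\<^sup>2 = gB * r\<^sup>2"
    "a * b / v = a * b * p" "a * (a - b) / (v - a) = a * (a - b) * q" "b * (b - a) / (v - b) = b * (b - a) * r"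
    by (simp_all add: p_def q_def r_def power2_eq_square)
  note eqs = this
  have t0: "4 * cubic v * (g0\<^sup>2 * p\<^sup>2 - g0 * p\<^sup>2) + 2 * dcubic v * (g0 * p) - 2 * g0 * (2 * g0 - 1) * (a * b * p)
    = 2 * g0 * (2 * g0 - 1) * (v - a - b) + 2 * g0 * (2 * v - a - b)"
    using pqr(1) unfolding cubic_def dcubic_def by algebra
  have tA: "4 * cubic v * (gA\<^sup>2 * q\<^sup>2 - gA * q\<^sup>2) + 2 * dcubic v * (gA * q) - 2 * gA * (2 * gA - 1) * (a * (a - b) * q)
    = 2 * gA * (2 * gA - 1) * (v + a - b) + 2 * gA * (2 * v - b)"
    using pqr(2) unfolding cubic_def dcubic_def by algebra
  have tB: "4 * cubic v * (gB\<^sup>2 * r\<^sup>2 - gB * r\<^sup>2) + 2 * dcubic v * (gB * r) - 2 * gB * (2 * gB - 1) * (b * (b - a) * r)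
    = 2 * gB * (2 * gB - 1) * (v + b - a) + 2 * gB * (2 * v - a)"
    using pqr(3) unfolding cubic_def dcubic_def by algebra
  have t0A: "4 * cubic v * (2 * g0 * gA * p * q) = 8 * g0 * gA * (v - b)"
    using pqr(1,2) unfolding cubic_def by algebra
  have t0B: "4 * cubic v * (2 * g0 * gB * p * r) = 8 * g0 * gB * (v - a)"
    using pqr(1,3) unfolding cubic_def by algebra
  have tAB: "4 * cubic v * (2 * gA * gB * q * r) = 8 * gA * gB * v"
    using pqr(2,3) unfolding cubic_def by algebra
  have y1: "8 * cubic v * (g0 * p + gA * q + gB * r)
    = 8 * (g0 * (v - a) * (v - b) + gA * v * (v - b) + gB * v * (v - a))"
    using pqr unfolding cubic_def by algebra
  define G where "G = g0 * p + gA * q + gB * r"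
  have sq: "G\<^sup>2 = g0\<^sup>2 * p\<^sup>2 + gA\<^sup>2 * q\<^sup>2 + gB\<^sup>2 * r\<^sup>2 + 2 * g0 * gA * p * q + 2 * g0 * gB * p * r + 2 * gA * gB * q * r"
    unfolding G_def by (simp add: power2_eq_square algebra_simps)
  define R where "R = 4 * cubic v * (G\<^sup>2 - g0 * p\<^sup>2 - gA * q\<^sup>2 - gB * r\<^sup>2) + 2 * dcubic v * G"
  have "R = (4 * cubic v * (g0\<^sup>2 * p\<^sup>2 - g0 * p\<^sup>2) + 2 * dcubic v * (g0 * p))
     + (4 * cubic v * (gA\<^sup>2 * q\<^sup>2 - gA * q\<^sup>2) + 2 * dcubic v * (gA * q))
     + (4 * cubic v * (gB\<^sup>2 * r\<^sup>2 - gB * r\<^sup>2) + 2 * dcubic v * (gB * r))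
     + 4 * cubic v * (2 * g0 * gA * p * q) + 4 * cubic v * (2 * g0 * gB * p * r) + 4 * cubic v * (2 * gA * gB * q * r)"
    unfolding R_def sq unfolding G_def by (simp add: algebra_simps)
  also have "\<dots> = (2 * g0 * (2 * g0 - 1) * (a * b * p) + 2 * g0 * (2 * g0 - 1) * (v - a - b) + 2 * g0 * (2 * v - a - b))
     + (2 * gA * (2 * gA - 1) * (a * (a - b) * q) + 2 * gA * (2 * gA - 1) * (v + a - b) + 2 * gA * (2 * v - b))
     + (2 * gB * (2 * gB - 1) * (b * (b - a) * r) + 2 * gB * (2 * gB - 1) * (v + b - a) + 2 * gB * (2 * v - a))
     + 8 * g0 * gA * (v - b) + 8 * g0 * gB * (v - a) + 8 * gA * gB * v"
    unfolding t0A t0B tAB using t0 tA tB by (simp only: diff_eq_eq add_ac)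
  also have "\<dots> = pot v + ((4 * (g0 + gA + gB)\<^sup>2 + 2 * (g0 + gA + gB) - \<mu>) * v + coeffY 0)"
    unfolding pot_def coeffY_def eqs by (simp add: power2_eq_square algebra_simps)
  finally have R: "R = pot v + ((4 * (g0 + gA + gB)\<^sup>2 + 2 * (g0 + gA + gB) - \<mu>) * v + coeffY 0)" .
  have "4 * cubic v * (y2 + 2 * gauge v * y1 + ((gauge v)\<^sup>2 - g0 / v\<^sup>2 - gA / (v - a)\<^sup>2 - gB / (v - b)\<^sup>2) * y)
     + 2 * dcubic v * (y1 + gauge v * y) = 4 * cubic v * y2 + (2 * dcubic v + 8 * cubic v * G) * y1 + R * y"
    unfolding gauge_def eqs G_def[symmetric] R_def by (simp add: algebra_simps)
  also have "\<dots> = pot v * y + heun_op v y y1 y2"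
    unfolding R heun_op_def G_def y1 by (simp add: algebra_simps)
  finally show ?thesis .
qed

lemma gauge_derivative:
  assumes "v \<noteq> 0" "v \<noteq> a" "v \<noteq> b"
  shows "(gauge has_field_derivative - g0 / v\<^sup>2 - gA / (v - a)\<^sup>2 - gB / (v - b)\<^sup>2) (at v)"
proof -
  have d: "((\<lambda>v. c / (v - k)) has_field_derivative - c / (v - k)\<^sup>2) (at v)" if "v \<noteq> k" for c k :: complex
    using that by (auto intro!: derivative_eq_intros simp: power2_eq_square)
  have "((\<lambda>v. g0 / (v - 0) + gA / (v - a) + gB / (v - b)) has_field_derivative
      - g0 / (v - 0)\<^sup>2 + - gA / (v - a)\<^sup>2 + - gB / (v - b)\<^sup>2) (at v)"
    using assms by (intro DERIV_add d)
  then show ?thesis by (simp add: gauge_def[abs_def])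
qed

text \<open>Differentiate \<open>v'^2 = 4 * cubic v\<close> and cancel \<open>v'\<close>, which is
  nonzero as long as \<open>v\<close> avoids 0, \<open>a\<close> and \<open>b\<close>.\<close>

lemma chart_second_derivative:
  assumes "open U" "x \<in> U"
    and v: "\<And>x. x \<in> U \<Longrightarrow> (v has_field_derivative dv x) (at x)"
    and ode: "\<And>x. x \<in> U \<Longrightarrow> (dv x)\<^sup>2 = 4 * cubic (v x)"
    and ne: "\<And>x. x \<in> U \<Longrightarrow> v x \<noteq> 0 \<and> v x \<noteq> a \<and> v x \<noteq> b"
  shows "(dv has_field_derivative 2 * dcubic (v x)) (at x)"
proof -
  have "v holomorphic_on U" using assms(1) v holomorphic_on_open by blast
  moreover have "deriv v y = dv y" if "y \<in> U" for y using v[OF that] by (rule DERIV_imp_deriv)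
  ultimately have "dv holomorphic_on U"
    using assms(1) by (auto intro: holomorphic_transform[OF holomorphic_deriv])
  then have d: "(dv has_field_derivative deriv dv x) (at x)"
    using assms by (auto intro: holomorphic_derivI)
  have "((\<lambda>x. (dv x)\<^sup>2) has_field_derivative 2 * dv x * deriv dv x) (at x)"
    by (rule derivative_eq_intros d refl | simp add: mult_ac)+
  moreover have "((\<lambda>x. (dv x)\<^sup>2) has_field_derivative 4 * dcubic (v x) * dv x) (at x)"
  proof (rule has_field_derivative_transform_within_open[OF _ assms(1,2)])
    show "((\<lambda>x. 4 * cubic (v x)) has_field_derivative 4 * dcubic (v x) * dv x) (at x)"
      unfolding cubic_def by (auto intro!: derivative_eq_intros v assms(2) simp: dcubic_def algebra_simps)
  qed (simp add: ode)
  ultimately have "2 * dv x * deriv dv x = 4 * dcubic (v x) * dv x" by (rule DERIV_unique)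
  moreover have "dv x \<noteq> 0" using ode[OF assms(2)] ne[OF assms(2)] by (auto simp: cubic_def)
  ultimately have "deriv dv x = 2 * dcubic (v x)" by simp
  with d show ?thesis by simp
qed

text \<open>Only the logarithmic derivative of \<open>\<Phi>\<close> is prescribed, so the lemma
  serves both for the Frobenius factor near a half period and for the factor of \<open>V\<close> on
  any branch domain.\<close>

lemma gauged_second_derivative:
  assumes "open U" "x \<in> U"
    and v: "\<And>x. x \<in> U \<Longrightarrow> (v has_field_derivative dv x) (at x)"
    and ode: "\<And>x. x \<in> U \<Longrightarrow> (dv x)\<^sup>2 = 4 * cubic (v x)"
    and ne: "\<And>x. x \<in> U \<Longrightarrow> v x \<noteq> 0 \<and> v x \<noteq> a \<and> v x \<noteq> b"
    and \<Phi>: "\<And>x. x \<in> U \<Longrightarrow> (\<Phi> has_field_derivative \<Phi> x * gauge (v x) * dv x) (at x)"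
    and y: "\<And>x. x \<in> U \<Longrightarrow> (y has_field_derivative y1 (v x)) (at (v x))"
    and y1: "\<And>x. x \<in> U \<Longrightarrow> (y1 has_field_derivative y2 (v x)) (at (v x))"
  shows "deriv (deriv (\<lambda>x. \<Phi> x * y (v x))) x
    = pot (v x) * (\<Phi> x * y (v x)) + \<Phi> x * heun_op (v x) (y (v x)) (y1 (v x)) (y2 (v x))"
proof -
  have dv: "(dv has_field_derivative 2 * dcubic (v x)) (at x)" if "x \<in> U" for x
    using chart_second_derivative[OF assms(1) that v ode ne] by blast
  have yv: "((\<lambda>x. y (v x)) has_field_derivative y1 (v x) * dv x) (at x)" if "x \<in> U" for x
    using DERIV_chain2[OF y[OF that] v[OF that]] .
  have y1v: "((\<lambda>x. y1 (v x)) has_field_derivative y2 (v x) * dv x) (at x)" if "x \<in> U" for x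
    using DERIV_chain2[OF y1[OF that] v[OF that]] .
  have gv: "((\<lambda>x. gauge (v x)) has_field_derivative
     (- g0 / (v x)\<^sup>2 - gA / (v x - a)\<^sup>2 - gB / (v x - b)\<^sup>2) * dv x) (at x)" if "x \<in> U" for x
    using DERIV_chain2[OF gauge_derivative v[OF that]] ne[OF that] by blast
  have "((\<lambda>x. \<Phi> x * y (v x)) has_field_derivative \<Phi> x * (dv x * (y1 (v x) + gauge (v x) * y (v x)))) (at x)"
    if "x \<in> U" for x
    by (rule derivative_eq_intros \<Phi> yv that refl)+ (simp add: algebra_simps)
  then have d1: "deriv (\<lambda>x. \<Phi> x * y (v x)) x = \<Phi> x * (dv x * (y1 (v x) + gauge (v x) * y (v x)))" if "x \<in> U" for x
    using that DERIV_imp_deriv by blast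
  have d2: "((\<lambda>x. \<Phi> x * (dv x * (y1 (v x) + gauge (v x) * y (v x)))) has_field_derivative
     \<Phi> x * ((dv x)\<^sup>2 * (y2 (v x) + 2 * gauge (v x) * y1 (v x)
       + ((gauge (v x))\<^sup>2 - g0 / (v x)\<^sup>2 - gA / (v x - a)\<^sup>2 - gB / (v x - b)\<^sup>2) * y (v x))
       + 2 * dcubic (v x) * (y1 (v x) + gauge (v x) * y (v x)))) (at x)"
    by (rule derivative_eq_intros \<Phi> yv y1v gv dv assms(2) refl)+ (simp add: algebra_simps power2_eq_square)
  have "deriv (deriv (\<lambda>x. \<Phi> x * y (v x))) x = \<Phi> x * ((dv x)\<^sup>2 * (y2 (v x) + 2 * gauge (v x) * y1 (v x)
       + ((gauge (v x))\<^sup>2 - g0 / (v x)\<^sup>2 - gA / (v x - a)\<^sup>2 - gB / (v x - b)\<^sup>2) * y (v x))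
       + 2 * dcubic (v x) * (y1 (v x) + gauge (v x) * y (v x)))"
    by (rule DERIV_imp_deriv, rule has_field_derivative_transform_within_open[OF d2 assms(1,2)]) (simp add: d1)
  also have "\<dots> = \<Phi> x * (pot (v x) * y (v x) + heun_op (v x) (y (v x)) (y1 (v x)) (y2 (v x)))"
    unfolding ode[OF assms(2)] using gauge_identity[of "v x"] ne[OF assms(2)] by simp
  finally show ?thesis by (simp add: algebra_simps)
qed

section \<open>The three-term recurrence and its convergence\<close>

lemma sums_shift:
  fixes c :: "nat \<Rightarrow> complex"
  assumes "(\<lambda>n. c n * z ^ n) sums s"
  shows "(\<lambda>n. (case n of 0 \<Rightarrow> 0 | Suc m \<Rightarrow> c m) * z ^ n) sums (z * s)"
proof -
  have "(\<lambda>n. z * (c n * z ^ n)) sums (z * s)" using assms by (rule sums_mult)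
  then show ?thesis
    by (subst sums_Suc_iff[symmetric, where f = "\<lambda>n. (case n of 0 \<Rightarrow> 0 | Suc m \<Rightarrow> c m) * z ^ n", simplified])
       (simp_all add: mult_ac)
qed

lemma heun_op_sums:
  fixes F :: "complex fps"
  assumes z: "ereal (norm z) < fps_conv_radius F"
  shows "(\<lambda>n. row (fps_nth F) n * z ^ n) sums
    heun_op z (eval_fps F z) (eval_fps (fps_deriv F) z) (eval_fps (fps_deriv (fps_deriv F)) z)"
proof -
  define c where "c = fps_nth F"
  define y y1 y2 where "y = eval_fps F z" and "y1 = eval_fps (fps_deriv F) z" and "y2 = eval_fps (fps_deriv (fps_deriv F)) z"
  have z1: "ereal (norm z) < fps_conv_radius (fps_deriv F)"
    using z fps_conv_radius_deriv[of F] by (rule less_le_trans)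
  then have z2: "ereal (norm z) < fps_conv_radius (fps_deriv (fps_deriv F))"
    using fps_conv_radius_deriv[of "fps_deriv F"] by (rule less_le_trans)
  have s0: "(\<lambda>n. c n * z ^ n) sums y"
    using sums_eval_fps[OF z] by (simp add: y_def c_def)
  have s1: "(\<lambda>n. (of_nat (Suc n) * c (Suc n)) * z ^ n) sums y1"
    using sums_eval_fps[OF z1] by (simp add: y1_def c_def)
  have s2: "(\<lambda>n. (of_nat (Suc n) * of_nat (Suc (Suc n)) * c (Suc (Suc n))) * z ^ n) sums y2"
    using sums_eval_fps[OF z2] by (simp add: y2_def c_def mult_ac)
  \<comment> \<open>Coefficients of \<open>z y'\<close>, \<open>y'\<close> and \<open>z y\<close>
    once \<open>heun_op\<close> is expanded in powers of \<open>z\<close>; each power of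
    \<open>z\<close> shifts a series by one place.\<close>
  define k1 k0 A where "k1 = - 4 * (a + b) - 8 * (g0 * (a + b) + gA * b + gB * a)"
    and "k0 = 2 * a * b + 8 * g0 * a * b" and "A = 4 * (g0 + gA + gB)\<^sup>2 + 2 * (g0 + gA + gB) - \<mu>"
  have op: "heun_op z y y1 y2 = 4 * (z * (z * (z * y2))) + (- 4 * (a + b)) * (z * (z * y2)) + 4 * a * b * (z * y2)
     + (6 + 8 * (g0 + gA + gB)) * (z * (z * y1)) + k1 * (z * y1) + k0 * y1 + A * (z * y) + coeffY 0 * y"
    unfolding heun_op_def cubic_def dcubic_def k1_def k0_def A_def
    by (simp add: algebra_simps power2_eq_square)
  let ?s = "\<lambda>c n. case n of 0 \<Rightarrow> 0 | Suc m \<Rightarrow> c m"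
  let ?c1 = "\<lambda>n. of_nat (Suc n) * c (Suc n)"
  let ?c2 = "\<lambda>n. of_nat (Suc n) * of_nat (Suc (Suc n)) * c (Suc (Suc n))"
  note t1 = sums_shift[OF s2] and u1 = sums_shift[OF s1]
  note t2 = sums_shift[OF t1] and u2 = sums_shift[OF u1]
  note t3 = sums_shift[OF t2]
  have "(\<lambda>n. 4 * (?s (?s (?s ?c2)) n * z ^ n) + (- 4 * (a + b)) * (?s (?s ?c2) n * z ^ n) + 4 * a * b * (?s ?c2 n * z ^ n)
     + (6 + 8 * (g0 + gA + gB)) * (?s (?s ?c1) n * z ^ n) + k1 * (?s ?c1 n * z ^ n) + k0 * (?c1 n * z ^ n)
     + A * (?s c n * z ^ n) + coeffY 0 * (c n * z ^ n)) sums heun_op z y y1 y2"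
    unfolding op by (intro sums_add sums_mult t1 t2 t3 u1 u2 s0 s1 sums_shift[OF s0])
  also have "(\<lambda>n. 4 * (?s (?s (?s ?c2)) n * z ^ n) + (- 4 * (a + b)) * (?s (?s ?c2) n * z ^ n) + 4 * a * b * (?s ?c2 n * z ^ n)
     + (6 + 8 * (g0 + gA + gB)) * (?s (?s ?c1) n * z ^ n) + k1 * (?s ?c1 n * z ^ n) + k0 * (?c1 n * z ^ n)
     + A * (?s c n * z ^ n) + coeffY 0 * (c n * z ^ n)) = (\<lambda>n. row c n * z ^ n)"
  proof
    fix n
    have "4 * ?s (?s (?s ?c2)) n + (- 4 * (a + b)) * ?s (?s ?c2) n + 4 * a * b * ?s ?c2 n
     + (6 + 8 * (g0 + gA + gB)) * ?s (?s ?c1) n + k1 * ?s ?c1 n + k0 * ?c1 n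
     + A * ?s c n + coeffY 0 * c n = row c n"
    proof (cases n)
      case 0
      then show ?thesis by (simp add: row_def coeffZ_def k0_def algebra_simps)
    next
      case (Suc m)
      define N where "N = (of_nat m :: complex)"
      have e3: "?s (?s (?s ?c2)) n = N * (N - 1) * c m"
        unfolding Suc N_def by (cases m; cases "m - 1") (auto simp: algebra_simps)
      have e2: "?s (?s ?c2) n = (N + 1) * N * c n"
        unfolding Suc N_def by (cases m) (auto simp: algebra_simps)
      have e1: "?s ?c2 n = (N + 1) * (N + 2) * c (Suc n)"
        unfolding Suc N_def by (simp add: algebra_simps)
      have f2: "?s (?s ?c1) n = N * c m"
        unfolding Suc N_def by (cases m) (auto simp: algebra_simps)
      have f1: "?s ?c1 n = (N + 1) * c n" "?c1 n = (N + 2) * c (Suc n)" "?s c n = c m"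
        unfolding Suc N_def by (simp_all add: algebra_simps)
      have r: "row c n = (4 * (N + (g0 + gA + gB))\<^sup>2 + 2 * (N + (g0 + gA + gB)) - \<mu>) * c m
        + (e - 4 * b * (N + 1 + g0 + gA)\<^sup>2 - 4 * a * (N + 1 + g0 + gB)\<^sup>2) * c n
        + 2 * a * b * (N + 2) * (2 * (N + 2) - 1 + 4 * g0) * c (Suc n)"
        unfolding row_def coeffX_def coeffY_def coeffZ_def Suc N_def by (simp add: add_ac)
      show ?thesis
        unfolding e1 e2 e3 f1 f2 r k1_def k0_def A_def coeffY_def
        by (simp add: power2_eq_square algebra_simps)
    qed
    from arg_cong[OF this, of "\<lambda>t. t * z ^ n"]
    show "4 * (?s (?s (?s ?c2)) n * z ^ n) + (- 4 * (a + b)) * (?s (?s ?c2) n * z ^ n) + 4 * a * b * (?s ?c2 n * z ^ n)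
     + (6 + 8 * (g0 + gA + gB)) * (?s (?s ?c1) n * z ^ n) + k1 * (?s ?c1 n * z ^ n) + k0 * (?c1 n * z ^ n)
     + A * (?s c n * z ^ n) + coeffY 0 * (c n * z ^ n) = row c n * z ^ n"
      by (simp only: distrib_right mult.assoc)
  qed
  finally show ?thesis by (simp add: y_def y1_def y2_def c_def)
qed

text \<open>At a resonance \<open>coeffZ (Suc n) = 0\<close>, division by zero makes the next coefficient \<open>0\<close>; only the
  equation \<open>row frobenius n = 0\<close> may then fail.\<close>

fun frobenius :: "nat \<Rightarrow> complex" where
  "frobenius 0 = 1"
| "frobenius (Suc 0) = - (coeffY 0) / coeffZ (Suc 0)"
| "frobenius (Suc (Suc n)) = - (coeffX n * frobenius n + coeffY (Suc n) * frobenius (Suc n)) / coeffZ (Suc (Suc n))"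

lemma row_frobenius: "coeffZ (Suc n) \<noteq> 0 \<Longrightarrow> row frobenius n = 0"
  by (cases n) (auto simp: row_def)

lemma coeffZ_bound:
  "eventually (\<lambda>n. norm (a * b) * (of_nat n)\<^sup>2 \<le> norm (coeffZ n)) sequentially"
proof -
  obtain N :: nat where N: "norm (4 * g0 - 1) \<le> real N" using real_arch_simple by blast
  have "norm (a * b) * (of_nat n)\<^sup>2 \<le> norm (coeffZ n)" if "n \<ge> N" for n
  proof -
    have "norm (2 * of_nat n :: complex) - norm (4 * g0 - 1) \<le> norm (2 * of_nat n + (4 * g0 - 1))"
      using norm_diff_ineq by blast
    moreover have "norm (2 * of_nat n :: complex) = 2 * real n" by (simp add: norm_mult)
    ultimately have "real n \<le> norm (2 * of_nat n - 1 + 4 * g0)"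
      using N that by (simp add: algebra_simps)
    then have "norm (a * b) * (real n * real n) \<le> norm (a * b) * (2 * real n * norm (2 * of_nat n - 1 + 4 * g0))"
      by (intro mult_left_mono mult_mono) auto
    moreover have "norm (coeffZ n) = norm (a * b) * (2 * real n * norm (2 * of_nat n - 1 + 4 * g0))"
      unfolding coeffZ_def norm_mult by simp
    ultimately show ?thesis by (simp add: power2_eq_square)
  qed
  then show ?thesis by (auto simp: eventually_sequentially)
qed

lemma quadratic_growth:
  fixes p q r :: complex
  shows "\<exists>K\<ge>0. \<forall>n::nat. norm (p * (of_nat n)\<^sup>2 + q * of_nat n + r) \<le> K * (of_nat (Suc n))\<^sup>2"
proof (intro exI[of _ "norm p + norm q + norm r"] conjI allI)
  fix n :: nat
  have "norm (p * (of_nat n)\<^sup>2 + q * of_nat n + r) \<le> norm (p * (of_nat n)\<^sup>2) + norm (q * of_nat n) + norm r"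
    by (intro norm_triangle_mono norm_triangle_ineq) simp
  also have "\<dots> = norm p * (real n)\<^sup>2 + norm q * real n + norm r * 1"
    by (simp add: norm_mult norm_power)
  also have "\<dots> \<le> norm p * (of_nat (Suc n))\<^sup>2 + norm q * (of_nat (Suc n))\<^sup>2 + norm r * (of_nat (Suc n))\<^sup>2"
  proof (intro add_mono mult_left_mono)
    show "(real n)\<^sup>2 \<le> (real (Suc n))\<^sup>2" by (intro power_mono) auto
    show "real n \<le> (real (Suc n))\<^sup>2" "1 \<le> (real (Suc n))\<^sup>2" by (simp_all add: power2_eq_square algebra_simps)
  qed auto
  finally show "norm (p * (of_nat n)\<^sup>2 + q * of_nat n + r) \<le> (norm p + norm q + norm r) * (of_nat (Suc n))\<^sup>2"
    by (simp add: algebra_simps)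
qed auto

text \<open>The numerator grows at most quadratically and \<open>coeffZ\<close> at least
  quadratically, so the quotient is eventually bounded; a finite initial segment does not change
  this, and at a resonance the quotient is 0 by convention.\<close>

lemma bounded_ratio:
  fixes f :: "nat \<Rightarrow> complex"
  assumes f: "\<And>n. norm (f n) \<le> K * (of_nat (Suc n))\<^sup>2" and "K \<ge> 0" and k: "k > 0"
  shows "\<exists>M. \<forall>n. norm (f n / coeffZ (n + k)) \<le> M"
proof -
  have "eventually (\<lambda>n. norm (a * b) * (of_nat (n + k))\<^sup>2 \<le> norm (coeffZ (n + k))) sequentially"
    using coeffZ_bound by (rule sequentially_offset)
  then have "eventually (\<lambda>n. norm (f n / coeffZ (n + k)) \<le> K / norm (a * b)) sequentially"
  proof eventually_elim
    fix n assume "norm (a * b) * (of_nat (n + k))\<^sup>2 \<le> norm (coeffZ (n + k))"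
    moreover have "norm (f n) \<le> K * (of_nat (n + k))\<^sup>2"
      by (rule order_trans[OF f]) (use k assms in \<open>intro mult_left_mono power_mono, auto\<close>)
    ultimately have "norm (f n) / norm (coeffZ (n + k)) \<le> (K * (of_nat (n + k))\<^sup>2) / (norm (a * b) * (of_nat (n + k))\<^sup>2)"
      using ab k assms(2) by (intro frac_le) auto
    then show "norm (f n / coeffZ (n + k)) \<le> K / norm (a * b)"
      using k by (simp add: norm_divide)
  qed
  then have "Bseq (\<lambda>n. f n / coeffZ (n + k))" by (rule BfunI)
  then show ?thesis by (auto simp: Bseq_def)
qed

text \<open>With both quotients of the recurrence bounded by \<open>K \<ge> 1\<close>, the
  coefficients are at most \<open>(2 * K)^n\<close>, because
  \<open>K + 2 * K^2 \<le> (2 * K)^2\<close>. At \<open>1 / (4 * K)\<close> the series is then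
  dominated by a geometric one of ratio \<open>1/2\<close>.\<close>

lemma frobenius_radius: "fps_conv_radius (Abs_fps frobenius) > 0"
proof -
  obtain K1 where "\<And>n. norm (coeffX n / coeffZ (n + 2)) \<le> K1"
  proof -
    have eq: "coeffX n = 4 * (of_nat n)\<^sup>2 + (8 * (g0 + gA + gB) + 2) * of_nat n
      + (4 * (g0 + gA + gB)\<^sup>2 + 2 * (g0 + gA + gB) - \<mu>)" for n
      by (simp add: coeffX_def power2_eq_square algebra_simps)
    have "\<exists>L\<ge>0. \<forall>n. norm (coeffX n) \<le> L * (of_nat (Suc n))\<^sup>2"
      unfolding eq by (rule quadratic_growth)
    then obtain L where "L \<ge> 0" "\<And>n. norm (coeffX n) \<le> L * (of_nat (Suc n))\<^sup>2" by blast
    then show ?thesis using bounded_ratio[of coeffX L 2] that by auto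
  qed
  note K1 = this
  obtain K2 where "\<And>n. norm (coeffY n / coeffZ (n + 1)) \<le> K2"
  proof -
    have eq: "coeffY n = (- 4 * a - 4 * b) * (of_nat n)\<^sup>2 + (- 8 * b * (g0 + gA) - 8 * a * (g0 + gB)) * of_nat n
      + (e - 4 * b * (g0 + gA)\<^sup>2 - 4 * a * (g0 + gB)\<^sup>2)" for n
      by (simp add: coeffY_def power2_eq_square algebra_simps)
    have "\<exists>L\<ge>0. \<forall>n. norm (coeffY n) \<le> L * (of_nat (Suc n))\<^sup>2"
      unfolding eq by (rule quadratic_growth)
    then obtain L where "L \<ge> 0" "\<And>n. norm (coeffY n) \<le> L * (of_nat (Suc n))\<^sup>2" by blast
    then show ?thesis using bounded_ratio[of coeffY L 1] that by auto
  qed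
  note K2 = this
  define K where "K = max 1 (max K1 K2)"
  have K: "K \<ge> 1" "K1 \<le> K" "K2 \<le> K" by (auto simp: K_def)
  have bound: "norm (frobenius n) \<le> (2 * K) ^ n" for n
  proof (induction n rule: frobenius.induct)
    case 1 show ?case by simp
  next
    case 2
    have "norm (frobenius (Suc 0)) = norm (coeffY 0 / coeffZ (0 + 1))" by simp
    with K2[of 0] K show ?case by (simp del: frobenius.simps)
  next
    case (3 n)
    have x: "norm (coeffX n / coeffZ (Suc (Suc n))) \<le> K" "norm (coeffY (Suc n) / coeffZ (Suc (Suc n))) \<le> K"
      using K1[of n] K2[of "Suc n"] K by simp_all
    have "frobenius (Suc (Suc n)) = - (coeffX n / coeffZ (Suc (Suc n)) * frobenius n + coeffY (Suc n) / coeffZ (Suc (Suc n)) * frobenius (Suc n))"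
      unfolding frobenius.simps(3) minus_divide_left[symmetric] add_divide_distrib times_divide_eq_left ..
    then have "norm (frobenius (Suc (Suc n))) \<le> norm (coeffX n / coeffZ (Suc (Suc n))) * norm (frobenius n)
      + norm (coeffY (Suc n) / coeffZ (Suc (Suc n))) * norm (frobenius (Suc n))"
      unfolding norm_mult[symmetric] by (simp only: norm_minus_cancel norm_triangle_ineq)
    also have "\<dots> \<le> K * (2 * K) ^ n + K * (2 * K) ^ Suc n"
      using K by (intro add_mono mult_mono x 3) auto
    also have "\<dots> = (2 * K) ^ n * (K * 1 + 2 * K * K)" unfolding power_Suc by algebra
    also have "\<dots> \<le> (2 * K) ^ n * (K * (2 * K) + 2 * K * K)"
      using K by (intro mult_left_mono add_mono) auto
    also have "\<dots> = (2 * K) ^ Suc (Suc n)" unfolding power_Suc by algebra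
    finally show ?case .
  qed
  define z :: complex where "z = of_real (1 / (4 * K))"
  have z: "norm z = 1 / (4 * K)" using K unfolding z_def norm_of_real by simp
  have "summable (\<lambda>n. frobenius n * z ^ n)"
  proof (rule summable_comparison_test')
    show "summable (\<lambda>n. (1/2::real) ^ n)" by (rule summable_geometric) simp
    fix n
    have "norm (frobenius n * z ^ n) \<le> (2 * K) ^ n * (1 / (4 * K)) ^ n"
      unfolding norm_mult norm_power z using bound K by (intro mult_right_mono) auto
    also have "\<dots> = (1/2) ^ n" unfolding power_mult_distrib[symmetric] using K by simp
    finally show "norm (frobenius n * z ^ n) \<le> (1/2) ^ n" .
  qed
  then have "ereal (norm z) \<le> fps_conv_radius (Abs_fps frobenius)"
    unfolding fps_conv_radius_def by (intro conv_radius_geI) simp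
  moreover have "0 < ereal (norm z)" using K z by simp
  ultimately show ?thesis by (rule less_le_trans[rotated])
qed

end

subsection \<open>Resonance in the logarithmic coordinate\<close>

abbreviation half_plane :: "real \<Rightarrow> complex set" where
  "half_plane \<rho> \<equiv> {t. Re t < ln \<rho>}"

lemma half_plane_open: "open (half_plane \<rho>)"
  by (rule open_halfspace_Re_lt)

lemma half_plane_convex: "convex (half_plane \<rho>)"
  by (rule convex_halfspace_Re_lt)

lemma exp_half_plane: "\<rho> > 0 \<Longrightarrow> t \<in> half_plane \<rho> \<Longrightarrow> exp t \<in> ball 0 \<rho> - {0}"
  using exp_less_cancel_iff[of "Re t" "ln \<rho>"] by simp

lemma exp_shift: "exp (t + 2 * of_real pi * \<i>) = exp t"
  by (simp add: exp_add)

lemma exp_nat_shift: "exp (of_nat n * (t + 2 * of_real pi * \<i>)) = exp (of_nat n * t)"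
  by (simp add: exp_of_nat_mult exp_shift)

lemma exp_minus_nat_shift: "exp (- of_nat n * (t + 2 * of_real pi * \<i>)) = exp (- of_nat n * t)"
  using exp_nat_shift[of n t] by (simp add: exp_minus)

lemma compose_exp_derivative:
  assumes "u holomorphic_on ball 0 \<rho>" "\<rho> > 0" "t \<in> half_plane \<rho>"
  shows "((\<lambda>t. u (exp t)) has_field_derivative deriv u (exp t) * exp t) (at t)"
proof -
  have "(u has_field_derivative deriv u (exp t)) (at (exp t))"
    using assms exp_half_plane by (intro holomorphic_derivI[of _ "ball 0 \<rho>"]) auto
  then show ?thesis by (rule DERIV_chain2) (rule DERIV_exp)
qed

lemma compose_exp_holomorphic:
  assumes "u holomorphic_on ball 0 \<rho>" "\<rho> > 0"
  shows "(\<lambda>t. u (exp t)) holomorphic_on half_plane \<rho>"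
  using compose_exp_derivative[OF assms] half_plane_open holomorphic_on_open by blast

lemma half_plane_constant:
  assumes "\<And>t. t \<in> half_plane \<rho> \<Longrightarrow> (f has_field_derivative 0) (at t)"
  obtains c where "\<And>t. t \<in> half_plane \<rho> \<Longrightarrow> f t = c"
proof -
  have "f constant_on half_plane \<rho>"
    using assms convex_connected[OF half_plane_convex] half_plane_open has_field_derivative_0_imp_constant_on
    by blast
  then show ?thesis using that by (auto simp: constant_on_def)
qed

lemma half_plane_nonempty: "of_real (ln \<rho> - 1) \<in> half_plane \<rho>"
  by simp

text \<open>\<open>u 0\<close> is the residue of \<open>u z / z\<close> at 0. Integrating the
  remaining part shows that \<open>G t\<close> is \<open>u 0 * t\<close> plus a periodic function,
  and periodicity of \<open>G\<close> forbids the linear term.\<close>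

lemma periodic_derivative_residue:
  assumes u: "u holomorphic_on ball 0 \<rho>" and \<rho>: "\<rho> > 0"
    and G: "\<And>t. t \<in> half_plane \<rho> \<Longrightarrow> (G has_field_derivative u (exp t)) (at t)"
    and per: "\<And>t. t \<in> half_plane \<rho> \<Longrightarrow> G (t + 2 * of_real pi * \<i>) = G t"
  shows "u 0 = 0"
proof -
  define u1 where "u1 = (\<lambda>z. if z = 0 then deriv u 0 else (u z - u 0) / (z - 0))"
  have u1: "u1 holomorphic_on ball 0 \<rho>" unfolding u1_def using u by (intro pole_lemma_open) auto
  obtain U1 where U1: "\<And>x. x \<in> ball 0 \<rho> \<Longrightarrow> (U1 has_field_derivative u1 x) (at x within ball 0 \<rho>)"
    using holomorphic_convex_primitive'[OF _ _ u1] by auto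
  have U1': "(U1 has_field_derivative u1 x) (at x)" if "x \<in> ball 0 \<rho>" for x
    using U1[OF that] at_within_open[OF that open_ball] by simp
  define F where "F = (\<lambda>t. G t - u 0 * t - U1 (exp t))"
  have "(F has_field_derivative 0) (at t)" if t: "t \<in> half_plane \<rho>" for t
  proof -
    have e: "exp t \<in> ball 0 \<rho> - {0}" using exp_half_plane[OF \<rho> t] .
    have "((\<lambda>t. U1 (exp t)) has_field_derivative u1 (exp t) * exp t) (at t)"
      by (rule DERIV_chain2[OF U1']) (use e in \<open>auto intro: DERIV_exp\<close>)
    moreover have "u1 (exp t) * exp t = u (exp t) - u 0" by (simp add: u1_def)
    ultimately show ?thesis unfolding F_def
      by (auto intro!: derivative_eq_intros G[OF t])
  qed
  from half_plane_constant[OF this] obtain c where c: "\<And>t. t \<in> half_plane \<rho> \<Longrightarrow> F t = c" by metis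
  define t0 :: complex where "t0 = of_real (ln \<rho> - 1)"
  have t0: "t0 \<in> half_plane \<rho>" "t0 + 2 * of_real pi * \<i> \<in> half_plane \<rho>"
    by (simp_all add: t0_def)
  have "F (t0 + 2 * of_real pi * \<i>) = F t0" using c[OF t0(1)] c[OF t0(2)] by simp
  then have "u 0 * (2 * of_real pi * \<i>) = 0"
    using per[OF t0(1)] unfolding F_def exp_shift by (simp add: algebra_simps)
  then show ?thesis by simp
qed

text \<open>The coefficient of \<open>z^k\<close> is divided by \<open>k + n > 0\<close>, which does
  not reduce the radius of convergence. In the coordinate \<open>t\<close>, the function
  \<open>exp (n t) w (exp t)\<close> becomes a primitive of \<open>exp (n t) u (exp t)\<close>
  without a term linear in \<open>t\<close>.\<close>

lemma euler_primitive:
  assumes u: "u holomorphic_on ball 0 \<rho>" and n: "n > 0"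
  obtains w where "w holomorphic_on ball 0 \<rho>"
    "\<And>z. z \<in> ball 0 \<rho> \<Longrightarrow> z * deriv w z + of_nat n * w z = u z"
proof -
  define c where "c = (\<lambda>k. (deriv ^^ k) u 0 / fact k)"
  have s: "(\<lambda>k. c k * z ^ k) sums u z" if "z \<in> ball 0 \<rho>" for z
    using holomorphic_power_series[OF u that] by (simp add: c_def)
  define W where "W = Abs_fps (\<lambda>k. c k / of_nat (k + n))"
  have rad: "ereal \<rho> \<le> fps_conv_radius W"
    unfolding fps_conv_radius_def
  proof (rule conv_radius_geI_ex')
    fix r :: real assume r: "0 < r" "ereal r < ereal \<rho>"
    obtain r' where r': "r < r'" "r' < \<rho>" using dense[of r \<rho>] r(2) by auto
    have "summable (\<lambda>k. c k * (of_real r') ^ k)"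
      using s[of "of_real r'"] r r' by (auto simp: sums_iff)
    then have "summable (\<lambda>k. norm (c k * (of_real r) ^ k))"
      by (rule powser_insidea) (use r r' in auto)
    then show "summable (\<lambda>k. fps_nth W k * of_real r ^ k)"
    proof (rule summable_comparison_test'[where N = 0])
      fix k
      have "norm (c k) / real (k + n) \<le> norm (c k) / 1" using n by (intro divide_left_mono) auto
      then have "norm (c k) / real (k + n) * norm (of_real r ^ k :: complex) \<le> norm (c k) / 1 * norm (of_real r ^ k :: complex)"
        by (rule mult_right_mono) simp
      then show "norm (fps_nth W k * of_real r ^ k) \<le> norm (c k * of_real r ^ k)"
        by (simp add: W_def norm_mult norm_divide del: of_nat_add)
    qed
  qed
  have zr: "ereal (norm z) < fps_conv_radius W" if "z \<in> ball 0 \<rho>" for z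
    using that less_le_trans[OF _ rad] by simp
  have "eval_fps W holomorphic_on ball 0 \<rho>"
    by (intro holomorphic_on_eval_fps) (use zr in \<open>auto simp: in_eball_iff\<close>)
  moreover have "z * deriv (eval_fps W) z + of_nat n * eval_fps W z = u z" if z: "z \<in> ball 0 \<rho>" for z
  proof -
    have zd: "ereal (norm z) < fps_conv_radius (fps_deriv W)"
      using zr[OF z] fps_conv_radius_deriv[of W] by (rule less_le_trans)
    have 1: "(\<lambda>k. of_nat (Suc k) * fps_nth W (Suc k) * z ^ k) sums deriv (eval_fps W) z"
      using sums_eval_fps[OF zd] by (simp add: eval_fps_deriv[OF zr[OF z]])
    then have "(\<lambda>k. z * (of_nat (Suc k) * fps_nth W (Suc k) * z ^ k)) sums (z * deriv (eval_fps W) z)"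
      by (rule sums_mult)
    then have "(\<lambda>k. of_nat (Suc k) * fps_nth W (Suc k) * z ^ Suc k) sums (z * deriv (eval_fps W) z)"
      by (simp only: power_Suc mult_ac)
    then have "(\<lambda>k. of_nat k * fps_nth W k * z ^ k) sums (z * deriv (eval_fps W) z)"
      by (subst (asm) sums_Suc_iff[where f = "\<lambda>k. of_nat k * fps_nth W k * z ^ k"]) simp
    moreover have "(\<lambda>k. of_nat n * (fps_nth W k * z ^ k)) sums (of_nat n * eval_fps W z)"
      by (intro sums_mult sums_eval_fps zr z)
    ultimately have "(\<lambda>k. of_nat k * fps_nth W k * z ^ k + of_nat n * (fps_nth W k * z ^ k)) sums
       (z * deriv (eval_fps W) z + of_nat n * eval_fps W z)" by (rule sums_add)
    moreover have "of_nat k * fps_nth W k * z ^ k + of_nat n * (fps_nth W k * z ^ k) = c k * z ^ k" for k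
    proof -
      have "(of_nat (k + n) :: complex) \<noteq> 0" using n by (simp del: of_nat_add)
      then have "of_nat (k + n) * fps_nth W k = c k" by (simp add: W_def del: of_nat_add)
      then have "(of_nat k + of_nat n) * fps_nth W k * z ^ k = c k * z ^ k" by simp
      then show ?thesis by (simp only: distrib_right mult.assoc)
    qed
    ultimately show ?thesis using s[OF z] sums_unique2 by simp
  qed
  ultimately show ?thesis using that by blast
qed

text \<open>In the logarithmic coordinate the equation is \<open>Y'' = q Y\<close>. The solution \<open>y1\<close> with the larger
  exponent \<open>p\<close> always exists; for a second, periodic solution \<open>Y = \<kappa> y1\<close> the Wronskian is a nonzero
  constant, and pairing \<open>Y\<close> with an approximate solution \<open>h\<close> of exponent \<open>- p\<close> shows that the
  error term of \<open>h\<close> has no resonant part.\<close>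

lemma resonance_vanishes:
  fixes Y :: "complex \<Rightarrow> complex ^ 2"
  assumes \<rho>: "\<rho> > 0" and p: "p > 0"
    and u1: "u1 holomorphic_on ball 0 \<rho>" "\<And>z. z \<in> ball 0 \<rho> \<Longrightarrow> u1 z \<noteq> 0"
    and u2: "u2 holomorphic_on ball 0 \<rho>"
    and u3: "u3 holomorphic_on ball 0 \<rho>"
    and y1_def: "y1 = (\<lambda>t. exp (of_nat p * t) * u1 (exp t))"
    and h_def: "h = (\<lambda>t. exp (- of_nat p * t) * u2 (exp t))"
    and y1: "\<And>t. t \<in> half_plane \<rho> \<Longrightarrow> deriv (deriv y1) t = q t * y1 t"
    and h: "\<And>t. t \<in> half_plane \<rho> \<Longrightarrow> deriv (deriv h) t = q t * h t + exp (of_nat p * t) * u3 (exp t)"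
    and Yhol: "\<And>j. (\<lambda>t. Y t $ j) holomorphic_on half_plane \<rho>"
    and Y: "\<And>j t. t \<in> half_plane \<rho> \<Longrightarrow> deriv (deriv (\<lambda>t. Y t $ j)) t = q t * Y t $ j"
    and mono: "\<And>j t. t \<in> half_plane \<rho> \<Longrightarrow> Y (t + 2 * of_real pi * \<i>) $ j = s * Y t $ j"
    and indep: "\<And>c :: complex ^ 2. (\<And>t. t \<in> half_plane \<rho> \<Longrightarrow> (\<Sum>j\<in>UNIV. c $ j * Y t $ j) = 0) \<Longrightarrow> c = 0"
  shows "u3 0 = 0"
proof -
  have hp2: "t + 2 * of_real pi * \<i> \<in> half_plane \<rho>" if "t \<in> half_plane \<rho>" for t
    using that by simp
  have y1hol: "y1 holomorphic_on half_plane \<rho>" unfolding y1_def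
    by (intro holomorphic_intros compose_exp_holomorphic u1 \<rho>)
  have hhol: "h holomorphic_on half_plane \<rho>" unfolding h_def
    by (intro holomorphic_intros compose_exp_holomorphic u2 \<rho>)
  have y1ne: "y1 t \<noteq> 0" if "t \<in> half_plane \<rho>" for t
    using exp_half_plane[OF \<rho> that] u1(2)[of "exp t"] by (simp add: y1_def)
  have y1per: "y1 (t + 2 * of_real pi * \<i>) = y1 t" for t
    unfolding y1_def exp_nat_shift exp_shift ..
  have hper: "h (t + 2 * of_real pi * \<i>) = h t" for t
    unfolding h_def exp_minus_nat_shift exp_shift ..
  have D: "(f has_field_derivative deriv f t) (at t)" "(deriv f has_field_derivative deriv (deriv f) t) (at t)"
    if "f holomorphic_on half_plane \<rho>" "t \<in> half_plane \<rho>" for f t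
    using that half_plane_open by (auto intro!: holomorphic_derivI[of _ "half_plane \<rho>"] holomorphic_deriv)
  have deriv_per: "deriv f (t + 2 * of_real pi * \<i>) = k * deriv f t"
    if f: "f holomorphic_on half_plane \<rho>" "\<And>t. t \<in> half_plane \<rho> \<Longrightarrow> f (t + 2 * of_real pi * \<i>) = k * f t"
      and t: "t \<in> half_plane \<rho>" for f t k
  proof -
    have "((\<lambda>t. f (t + 2 * of_real pi * \<i>)) has_field_derivative deriv f (t + 2 * of_real pi * \<i>)) (at t)"
      using D(1)[OF f(1) hp2[OF t]] unfolding DERIV_shift .
    moreover have "((\<lambda>t. f (t + 2 * of_real pi * \<i>)) has_field_derivative k * deriv f t) (at t)"
      by (rule has_field_derivative_transform_within_open[OF DERIV_cmult[OF D(1)[OF f(1) t]] half_plane_open t])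
         (simp add: f(2))
    ultimately show ?thesis by (rule DERIV_unique)
  qed
  have wronskian: "\<exists>c. \<forall>t\<in>half_plane \<rho>. y1 t * deriv f t - deriv y1 t * f t = c"
    if f: "f holomorphic_on half_plane \<rho>" "\<And>t. t \<in> half_plane \<rho> \<Longrightarrow> deriv (deriv f) t = q t * f t" for f
  proof -
    have "((\<lambda>t. y1 t * deriv f t - deriv y1 t * f t) has_field_derivative 0) (at t)" if t: "t \<in> half_plane \<rho>" for t
      by (rule derivative_eq_intros D[OF f(1) t] D[OF y1hol t] refl)+ (simp add: f(2)[OF t] y1[OF t])
    from half_plane_constant[OF this]
    obtain c where "\<And>t. t \<in> half_plane \<rho> \<Longrightarrow> y1 t * deriv f t - deriv y1 t * f t = c" by metis
    then show ?thesis by blast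
  qed
  have quot: "((\<lambda>t. f t / y1 t) has_field_derivative (y1 t * deriv f t - deriv y1 t * f t) / (y1 t)\<^sup>2) (at t)"
    if f: "f holomorphic_on half_plane \<rho>" and t: "t \<in> half_plane \<rho>" for f t
    using DERIV_divide[OF D(1)[OF f t] D(1)[OF y1hol t] y1ne[OF t]]
    by (simp add: power2_eq_square mult.commute)
  \<comment> \<open>If all Wronskians with \<open>y1\<close> vanished, both components of
    \<open>Y\<close> would be multiples of \<open>y1\<close>, hence linearly dependent.\<close>
  have "\<exists>j c. c \<noteq> 0 \<and> (\<forall>t\<in>half_plane \<rho>. y1 t * deriv (\<lambda>t. Y t $ j) t - deriv y1 t * Y t $ j = c)"
  proof (rule ccontr)
    assume "\<not> ?thesis"
    then have no: "c = 0" if "\<forall>t\<in>half_plane \<rho>. y1 t * deriv (\<lambda>t. Y t $ j) t - deriv y1 t * Y t $ j = c" for j c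
      using that by blast
    have W0: "y1 t * deriv (\<lambda>t. Y t $ j) t - deriv y1 t * Y t $ j = 0" if "t \<in> half_plane \<rho>" for j t
    proof -
      obtain c where c: "\<forall>t\<in>half_plane \<rho>. y1 t * deriv (\<lambda>t. Y t $ j) t - deriv y1 t * Y t $ j = c"
        using wronskian[OF Yhol[of j] Y[of _ j]] by metis
      with no[OF c] that show ?thesis by metis
    qed
    have "\<exists>k. \<forall>t\<in>half_plane \<rho>. Y t $ j = k * y1 t" for j
    proof -
      have "((\<lambda>t. Y t $ j / y1 t) has_field_derivative 0) (at t)" if "t \<in> half_plane \<rho>" for t
        using quot[OF Yhol[of j] that] W0[OF that, of j] by simp
      from half_plane_constant[OF this]
      obtain k where "\<And>t. t \<in> half_plane \<rho> \<Longrightarrow> Y t $ j / y1 t = k" by metis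
      then show ?thesis using y1ne by (intro exI[of _ k]) (auto simp: divide_eq_eq)
    qed
    then obtain k where k: "\<And>j t. t \<in> half_plane \<rho> \<Longrightarrow> Y t $ j = k j * y1 t" by metis
    \<comment> \<open>The obvious relation between two multiples of \<open>y1\<close>. It forces
      both multipliers to be 0; then \<open>Y\<close> vanishes and any nonzero vector contradicts
      independence.\<close>
    define c :: "complex ^ 2" where "c = (\<chi> j. if j = 1 then k 2 else - k 1)"
    have "c = 0" by (rule indep) (simp add: sum_2 c_def k algebra_simps)
    then have "c $ 1 = 0" "c $ 2 = 0" by simp_all
    then have "k 1 = 0" "k 2 = 0" by (simp_all add: c_def)
    then have "Y t $ j = 0" if "t \<in> half_plane \<rho>" for t j
      using k[OF that, of j] exhaust_2[of j] by auto
    then have "axis 1 1 = (0 :: complex ^ 2)" by (intro indep) simp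
    then show False by simp
  qed
  then obtain j c where c: "c \<noteq> 0"
    "\<And>t. t \<in> half_plane \<rho> \<Longrightarrow> y1 t * deriv (\<lambda>t. Y t $ j) t - deriv y1 t * Y t $ j = c" by blast
  define f where "f = (\<lambda>t. Y t $ j)"
  have fhol: "f holomorphic_on half_plane \<rho>" unfolding f_def by (rule Yhol)
  define \<kappa> where "\<kappa> = (\<lambda>t. f t / y1 t)"
  have \<kappa>: "(\<kappa> has_field_derivative c / (y1 t)\<^sup>2) (at t)" if "t \<in> half_plane \<rho>" for t
    using quot[OF fhol that] c(2)[OF that] by (simp add: \<kappa>_def f_def)
  have \<kappa>hol: "\<kappa> holomorphic_on half_plane \<rho>"
    unfolding \<kappa>_def using y1ne by (intro holomorphic_intros fhol y1hol) auto
  have \<kappa>s: "\<kappa> (t + 2 * of_real pi * \<i>) = s * \<kappa> t" if "t \<in> half_plane \<rho>" for t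
    unfolding \<kappa>_def f_def y1per using mono[OF that] by simp
  \<comment> \<open>The derivative \<open>c / y1^2\<close> of \<open>\<kappa>\<close> is nonzero and
    periodic, while the shift must also multiply it by \<open>s\<close>.\<close>
  have s1: "s = 1"
  proof -
    define t0 :: complex where "t0 = of_real (ln \<rho> - 1)"
    have t0: "t0 \<in> half_plane \<rho>" unfolding t0_def by (rule half_plane_nonempty)
    have "deriv \<kappa> (t0 + 2 * of_real pi * \<i>) = s * deriv \<kappa> t0"
      by (rule deriv_per[OF \<kappa>hol \<kappa>s t0])
    then have "c / (y1 t0)\<^sup>2 = s * (c / (y1 t0)\<^sup>2)"
      using DERIV_imp_deriv[OF \<kappa>[OF t0]] DERIV_imp_deriv[OF \<kappa>[OF hp2[OF t0]]] by (simp add: y1per)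
    then show ?thesis using c(1) y1ne[OF t0] by simp
  qed
  have fper: "f (t + 2 * of_real pi * \<i>) = 1 * f t" if "t \<in> half_plane \<rho>" for t
    using mono[OF that] s1 by (simp add: f_def)
  obtain w where w: "w holomorphic_on ball 0 \<rho>"
    "\<And>z. z \<in> ball 0 \<rho> \<Longrightarrow> z * deriv w z + of_nat (2 * p) * w z = u1 z * u3 z"
    using euler_primitive[of "\<lambda>z. u1 z * u3 z" \<rho> "2 * p"] p u1(1) u3 by (auto intro: holomorphic_on_mult)
  \<comment> \<open>A primitive of \<open>y1\<close> times the error term of \<open>h\<close>; the
    exponent \<open>2 * p\<close> is positive, so no logarithm appears.\<close>
  define R where "R = (\<lambda>t. exp (of_nat (2 * p) * t) * w (exp t))"
  have R: "(R has_field_derivative y1 t * (exp (of_nat p * t) * u3 (exp t))) (at t)" if t: "t \<in> half_plane \<rho>" for t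
  proof -
    have e: "exp t \<in> ball 0 \<rho>" using exp_half_plane[OF \<rho> t] by simp
    have "(R has_field_derivative exp (of_nat (2 * p) * t) * (exp t * deriv w (exp t) + of_nat (2 * p) * w (exp t))) (at t)"
    proof -
      define K :: complex where "K = of_nat (2 * p)"
      have "((\<lambda>t. exp (K * t)) has_field_derivative exp (K * t) * K) (at t)"
        by (auto intro!: derivative_eq_intros)
      from DERIV_mult[OF this compose_exp_derivative[OF w(1) \<rho> t]] show ?thesis
        unfolding R_def K_def[symmetric] by (simp add: algebra_simps)
    qed
    also have "exp (of_nat (2 * p) * t) = exp (of_nat p * t) * exp (of_nat p * t)"
      unfolding exp_add[symmetric] by (rule arg_cong[where f = exp]) simp
    finally show ?thesis unfolding w(2)[OF e] y1_def by (simp add: mult_ac)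
  qed
  \<comment> \<open>The Wronskian of \<open>f\<close> and \<open>h\<close> has derivative
    \<open>f\<close> times the error term, which is \<open>R' \<kappa>\<close>. Subtracting
    \<open>R \<kappa>\<close> leaves the derivative \<open>- R \<kappa>'\<close>, a holomorphic
    function of \<open>exp t\<close> whose value at 0 is a nonzero multiple of
    \<open>w 0\<close>.\<close>
  define G where "G = (\<lambda>t. f t * deriv h t - deriv f t * h t - R t * \<kappa> t)"
  define u where "u = (\<lambda>z. - c * w z / (u1 z)\<^sup>2)"
  have "u 0 = 0"
  proof (rule periodic_derivative_residue[OF _ \<rho>, of u G])
    show "u holomorphic_on ball 0 \<rho>" unfolding u_def using u1 by (intro holomorphic_intros w) auto
    fix t assume t: "t \<in> half_plane \<rho>"
    have fk: "\<kappa> t * y1 t = f t" using y1ne[OF t] by (simp add: \<kappa>_def)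
    have "(G has_field_derivative (f t * (q t * h t + exp (of_nat p * t) * u3 (exp t)) - q t * f t * h t
        - (R t * (c / (y1 t)\<^sup>2) + y1 t * (exp (of_nat p * t) * u3 (exp t)) * \<kappa> t))) (at t)"
      unfolding G_def
      by (rule derivative_eq_intros D[OF fhol t] D[OF hhol t] R[OF t] \<kappa>[OF t] refl)+
         (simp add: h[OF t] Y[OF t] f_def algebra_simps)
    also have "f t * (q t * h t + exp (of_nat p * t) * u3 (exp t)) - q t * f t * h t
        - (R t * (c / (y1 t)\<^sup>2) + y1 t * (exp (of_nat p * t) * u3 (exp t)) * \<kappa> t) = - (R t * (c / (y1 t)\<^sup>2))"
      unfolding fk[symmetric] by (simp add: algebra_simps)
    also have "R t * (c / (y1 t)\<^sup>2) = - u (exp t)"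
    proof -
      have "(y1 t)\<^sup>2 = exp (of_nat (2 * p) * t) * (u1 (exp t))\<^sup>2"
        unfolding y1_def power_mult_distrib exp_double[symmetric] by (simp add: mult.assoc)
      then show ?thesis by (simp add: R_def u_def)
    qed
    finally show "(G has_field_derivative u (exp t)) (at t)" by simp
    have "R (t + 2 * of_real pi * \<i>) = R t" unfolding R_def exp_nat_shift exp_shift ..
    moreover have "deriv h (t + 2 * of_real pi * \<i>) = 1 * deriv h t"
      by (rule deriv_per[OF hhol _ t]) (simp add: hper)
    moreover have "deriv f (t + 2 * of_real pi * \<i>) = 1 * deriv f t"
      by (rule deriv_per[OF fhol fper t])
    ultimately show "G (t + 2 * of_real pi * \<i>) = G t"
      using fper[OF t] \<kappa>s[OF t] s1 unfolding G_def hper by simp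
  qed
  moreover have "u1 0 \<noteq> 0" using u1(2) \<rho> by simp
  ultimately have "w 0 = 0" using c(1) by (simp add: u_def)
  then have "u1 0 * u3 0 = 0" using w(2)[of 0] \<rho> by simp
  then show ?thesis using \<open>u1 0 \<noteq> 0\<close> by simp
qed

subsection \<open>Apparent singularities\<close>

lemma log_branch_derivative:
  assumes "open U" "log_branch U (\<lambda>x. x - z0) L" "x \<in> U"
  shows "(L has_field_derivative 1 / (x - z0)) (at x)"
proof -
  have L: "L holomorphic_on U" "\<And>x. x \<in> U \<Longrightarrow> exp (L x) = x - z0"
    using assms by (auto simp: log_branch_def)
  have d: "(L has_field_derivative deriv L x) (at x)"
    using L(1) assms by (auto intro: holomorphic_derivI)
  then have "((\<lambda>x. exp (L x)) has_field_derivative exp (L x) * deriv L x) (at x)"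
    by (auto intro!: derivative_eq_intros)
  moreover have "((\<lambda>x. exp (L x)) has_field_derivative 1) (at x)"
    by (rule has_field_derivative_transform_within_open[OF _ assms(1,3), of "\<lambda>x. x - z0"])
       (auto intro!: derivative_eq_intros simp: L)
  ultimately have eq: "exp (L x) * deriv L x = 1" by (rule DERIV_unique)
  then have "(x - z0) * deriv L x = 1" using L(2)[OF assms(3)] by simp
  moreover have "x - z0 \<noteq> 0" using L(2)[OF assms(3)] exp_not_eq_zero by metis
  ultimately have "deriv L x = 1 / (x - z0)" by (simp add: field_simps)
  with d show ?thesis by simp
qed

lemma log_branch_half_plane:
  assumes "log_branch U (\<lambda>x. x - z0) L" "U \<subseteq> ball z0 \<rho> - {z0}" "x \<in> U"
  shows "L x \<in> half_plane \<rho>"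
proof -
  have "exp (Re (L x)) = norm (x - z0)"
    using assms norm_exp_eq_Re[of "L x"] by (simp add: log_branch_def)
  also have "\<dots> < \<rho>" using assms by (auto simp: dist_norm norm_minus_commute)
  finally have 1: "exp (Re (L x)) < \<rho>" .
  then have "\<rho> > 0" using exp_gt_zero less_trans by blast
  then have "exp (Re (L x)) < exp (ln \<rho>)" using 1 by simp
  then show ?thesis unfolding exp_less_cancel_iff by simp
qed

lemma log_branch_compose_second_derivative:
  assumes g: "g holomorphic_on half_plane \<rho>" and U: "open U" "U \<subseteq> ball z0 \<rho> - {z0}"
    and L: "log_branch U (\<lambda>x. x - z0) L" and x: "x \<in> U"
  shows "deriv (deriv (\<lambda>x. g (L x))) x = (deriv (deriv g) (L x) - deriv g (L x)) / (x - z0)\<^sup>2"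
proof -
  have dL: "(L has_field_derivative 1 / (x - z0)) (at x)" if "x \<in> U" for x
    using log_branch_derivative[OF U(1) L that] .
  have D: "(g has_field_derivative deriv g (L x)) (at (L x))"
    "(deriv g has_field_derivative deriv (deriv g) (L x)) (at (L x))" if "x \<in> U" for x
    using log_branch_half_plane[OF L U(2) that] g half_plane_open
    by (auto intro!: holomorphic_derivI[of _ "half_plane \<rho>"] holomorphic_deriv)
  have d1: "deriv (\<lambda>x. g (L x)) x = deriv g (L x) * (1 / (x - z0))" if "x \<in> U" for x
    using DERIV_imp_deriv[OF DERIV_chain2[OF D(1)[OF that] dL[OF that]]] .
  have ne: "x \<noteq> z0" using x U by auto
  have inv: "((\<lambda>x. 1 / (x - z0)) has_field_derivative - (1 / (x - z0)\<^sup>2)) (at x)"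
    using ne by (auto intro!: derivative_eq_intros simp: power2_eq_square)
  have "((\<lambda>x. deriv g (L x) * (1 / (x - z0))) has_field_derivative
     deriv (deriv g) (L x) * (1 / (x - z0)) * (1 / (x - z0)) + - (1 / (x - z0)\<^sup>2) * deriv g (L x)) (at x)"
    by (rule DERIV_mult[OF DERIV_chain2[OF D(2)[OF x] dL[OF x]] inv])
  then have "(deriv (\<lambda>x. g (L x)) has_field_derivative
     deriv (deriv g) (L x) * (1 / (x - z0)) * (1 / (x - z0)) + - (1 / (x - z0)\<^sup>2) * deriv g (L x)) (at x)"
    by (rule has_field_derivative_transform_within_open[OF _ U(1) x]) (simp add: d1)
  then show ?thesis
    by (simp add: DERIV_imp_deriv power2_eq_square diff_divide_distrib)
qed

lemma second_deriv_cong: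
  assumes "open U" "x \<in> U" "\<And>y. y \<in> U \<Longrightarrow> f y = g y"
  shows "deriv (deriv f) x = deriv (deriv g) x"
proof -
  have "eventually (\<lambda>y. f y = g y) (nhds y)" if "y \<in> U" for y
    using assms that eventually_nhds by blast
  then have "deriv f y = deriv g y" if "y \<in> U" for y
    using deriv_cong_ev[OF _ refl] that by blast
  then have "eventually (\<lambda>y. deriv f y = deriv g y) (nhds x)"
    using assms(1,2) eventually_nhds by blast
  then show ?thesis using deriv_cong_ev[OF _ refl] by blast
qed

text \<open>Every point \<open>t\<close> of the half-plane is attained by some branch, so an
  equation known for all branches on the disc holds at every \<open>t\<close>.\<close>

lemma local_log_branch:
  assumes "\<rho> > 0" "t \<in> half_plane \<rho>"
  obtains U L where "open U" "U \<subseteq> ball z0 \<rho> - {z0}" "log_branch U (\<lambda>x. x - z0) L"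
    "z0 + exp t \<in> U" "L (z0 + exp t) = t"
proof -
  define w where "w = exp t"
  have w: "w \<noteq> 0" "norm w < \<rho>" using exp_half_plane[OF assms] by (auto simp: w_def)
  define U where "U = ball (z0 + w) (min (norm w) (\<rho> - norm w))"
  \<comment> \<open>The quotient stays within the unit disc around 1, away from the cut of
    \<open>Ln\<close>, and is 1 at the centre, which normalises the branch to the value
    \<open>t\<close>.\<close>
  define L where "L = (\<lambda>x. t + Ln ((x - z0) / w))"
  have near: "(x - z0) / w \<in> ball 1 1" if "x \<in> U" for x
  proof -
    have "norm (1 - (x - z0) / w) = norm (z0 + w - x) / norm w"
      using w by (simp flip: norm_divide) (simp add: field_simps)
    also have "\<dots> < 1" using that w by (simp add: U_def dist_norm)
    finally show ?thesis by (simp add: dist_norm)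
  qed
  have nonpos: "z \<notin> \<real>\<^sub>\<le>\<^sub>0" if "z \<in> ball 1 1" for z :: complex
  proof
    assume "z \<in> \<real>\<^sub>\<le>\<^sub>0"
    then have "Re z \<le> 0" by (auto simp: complex_nonpos_Reals_iff)
    moreover have "Re (1 - z) \<le> norm (1 - z)" by (rule complex_Re_le_cmod)
    ultimately show False using that by (simp add: dist_norm)
  qed
  have "U \<subseteq> ball z0 \<rho> - {z0}"
  proof
    fix x assume x: "x \<in> U"
    have "x \<noteq> z0" using near[OF x] by auto
    moreover have "dist z0 x < \<rho>"
      using x norm_triangle_ineq[of "x - (z0 + w)" w] 
      by (simp add: U_def dist_norm norm_minus_commute algebra_simps)
    ultimately show "x \<in> ball z0 \<rho> - {z0}" by simp
  qed
  moreover have "log_branch U (\<lambda>x. x - z0) L"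
    unfolding log_branch_def
  proof (intro conjI ballI)
    show "L holomorphic_on U" unfolding L_def
      by (intro holomorphic_intros) (use near nonpos w in auto)
    fix x assume "x \<in> U"
    then have "(x - z0) / w \<noteq> 0" using near by force
    then show "exp (L x) = x - z0" using w unfolding L_def exp_add by (simp add: w_def)
  qed
  ultimately show ?thesis
    using w by (intro that[of U L]) (auto simp: U_def L_def w_def)
qed

text \<open>In \<open>t = log (x - z0)\<close> the second derivative becomes
  \<open>exp (- 2 t) (g'' - g')\<close>. The factor \<open>exp (- t / 2)\<close> removes the
  first-order term, which makes Wronskians constant and moves exponents \<open>1/2 + p\<close> and
  \<open>1/2 - p\<close> to \<open>p\<close> and \<open>- p\<close>.\<close>

lemma reduced_second_derivative:
  assumes g: "g holomorphic_on half_plane \<rho>" and \<rho>: "\<rho> > 0"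
    and eq: "\<And>U L x. open U \<Longrightarrow> U \<subseteq> ball z0 \<rho> - {z0} \<Longrightarrow> log_branch U (\<lambda>x. x - z0) L \<Longrightarrow> x \<in> U \<Longrightarrow>
      deriv (deriv (\<lambda>x. g (L x))) x = F (L x)"
    and t: "t \<in> half_plane \<rho>"
  shows "deriv (deriv (\<lambda>t. exp (- t / 2) * g t)) t = exp (- t / 2) * (exp (2 * t) * F t + g t / 4)"
proof -
  obtain U L where UL: "open U" "U \<subseteq> ball z0 \<rho> - {z0}" "log_branch U (\<lambda>x. x - z0) L"
    "z0 + exp t \<in> U" "L (z0 + exp t) = t"
    using local_log_branch[OF \<rho> t] by blast
  have "(deriv (deriv g) t - deriv g t) / (exp t)\<^sup>2 = F t"
    using log_branch_compose_second_derivative[OF g UL(1-4)] eq[OF UL(1-4)] UL(5) by simp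
  then have *: "deriv (deriv g) t - deriv g t = exp (2 * t) * F t"
    by (simp add: divide_eq_eq mult.commute flip: exp_double)
  have D: "(g has_field_derivative deriv g t) (at t)" "(deriv g has_field_derivative deriv (deriv g) t) (at t)"
    if "t \<in> half_plane \<rho>" for t
    using that g half_plane_open by (auto intro!: holomorphic_derivI[of _ "half_plane \<rho>"] holomorphic_deriv)
  have ex: "((\<lambda>t. exp (- t / 2)) has_field_derivative - (exp (- t / 2) / 2)) (at t)" for t :: complex
    by (auto intro!: derivative_eq_intros)
  have d1: "deriv (\<lambda>t. exp (- t / 2) * g t) t = exp (- t / 2) * (deriv g t - g t / 2)" if "t \<in> half_plane \<rho>" for t
    using DERIV_imp_deriv[OF DERIV_mult[OF ex D(1)[OF that]]] by (simp add: algebra_simps)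
  have "((\<lambda>t. deriv g t - g t / 2) has_field_derivative deriv (deriv g) t - deriv g t / 2) (at t)"
    by (auto intro!: derivative_eq_intros D[OF t])
  from DERIV_mult[OF ex this]
  have "((\<lambda>t. exp (- t / 2) * (deriv g t - g t / 2)) has_field_derivative
     exp (- t / 2) * (deriv (deriv g) t - deriv g t + g t / 4)) (at t)"
    by (rule DERIV_cong) (simp add: field_simps)
  then have "(deriv (\<lambda>t. exp (- t / 2) * g t) has_field_derivative
     exp (- t / 2) * (deriv (deriv g) t - deriv g t + g t / 4)) (at t)"
    by (rule has_field_derivative_transform_within_open[OF _ half_plane_open t]) (rule d1[symmetric])
  then show ?thesis unfolding * by (rule DERIV_imp_deriv)
qed

lemma holomorphic_log_ball:
  assumes "f holomorphic_on ball z r" "\<And>x. x \<in> ball z r \<Longrightarrow> f x \<noteq> 0"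
  obtains l where "l holomorphic_on ball z r" "\<And>x. x \<in> ball z r \<Longrightarrow> f x = exp (l x)"
  using contractible_imp_holomorphic_log[OF assms(1) convex_imp_contractible[OF convex_ball]] assms(2) by blast

lemma vector_mult_scalar_mat: "(w v* mat s) $ j = s * w $ j" for w :: "complex ^ 'n"
  by (simp add: vector_matrix_mult_def mat_def if_distrib if_distribR cong: if_cong)

lemma log_derivative_mult:
  assumes "f holomorphic_on A" "l holomorphic_on A" "open A" "x \<in> A" "\<And>x. x \<in> A \<Longrightarrow> f x = exp (l x)"
  shows "deriv f x = f x * deriv l x"
proof -
  have "((\<lambda>x. exp (l x)) has_field_derivative exp (l x) * deriv l x) (at x)"
    using holomorphic_derivI[OF assms(2-4)] by (auto intro!: derivative_eq_intros)
  then have "(f has_field_derivative exp (l x) * deriv l x) (at x)"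
    by (rule has_field_derivative_transform_within_open[OF _ assms(3,4)]) (simp add: assms(5))
  then show ?thesis using assms(4,5) by (simp add: DERIV_imp_deriv)
qed

section \<open>Frobenius solutions at a double zero of the coordinate\<close>

context heun begin

text \<open>The differential equation gives \<open>v' = 0\<close> at the centre and, by continuity,
  \<open>v'' = 2 a b \<noteq> 0\<close>; the zero is therefore exactly double.\<close>

lemma chart_factor:
  assumes r0: "r0 > 0" and v: "v holomorphic_on ball z0 r0" "v z0 = 0"
    and ne: "\<And>x. x \<in> ball z0 r0 - {z0} \<Longrightarrow> v x \<noteq> 0 \<and> v x \<noteq> a \<and> v x \<noteq> b"
    and ode: "\<And>x. x \<in> ball z0 r0 \<Longrightarrow> (deriv v x)\<^sup>2 = 4 * cubic (v x)"
  obtains \<kappa> where "\<kappa> holomorphic_on ball z0 r0" "\<And>x. x \<in> ball z0 r0 \<Longrightarrow> \<kappa> x \<noteq> 0"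
    "\<And>x. x \<in> ball z0 r0 \<Longrightarrow> v x = (x - z0)\<^sup>2 * \<kappa> x"
proof -
  have "(deriv v z0)\<^sup>2 = 0" using ode[of z0] r0 v(2) by (simp add: cubic_def)
  then have "deriv v z0 = 0" by simp
  then obtain \<kappa> where \<kappa>: "\<kappa> holomorphic_on ball z0 r0" "\<And>x. x \<in> ball z0 r0 \<Longrightarrow> v x = (x - z0)\<^sup>2 * \<kappa> x"
    using holomorphic_double_zero_factor[OF v] by blast
  define dd where "dd = deriv (deriv v)"
  have dd: "dd holomorphic_on ball z0 r0" unfolding dd_def by (intro holomorphic_deriv v) auto
  have "dd x = 2 * dcubic (v x)" if "x \<in> ball z0 r0 - {z0}" for x
    unfolding dd_def
    by (rule DERIV_imp_deriv, rule chart_second_derivative[of "ball z0 r0 - {z0}"])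
       (use that ne ode v in \<open>auto intro: holomorphic_derivI[of v "ball z0 r0"]\<close>)
  \<comment> \<open>The formula for \<open>v''\<close> results from cancelling \<open>v'\<close> and
    holds only off the centre; a limit extends it.\<close>
  then have "eventually (\<lambda>x. 2 * dcubic (v x) = dd x) (at z0)"
    using r0 unfolding eventually_at by (intro exI[of _ r0]) (auto simp: dist_commute)
  moreover have "(\<lambda>x. 2 * dcubic (v x)) \<midarrow>z0\<rightarrow> 2 * dcubic (v z0)"
  proof -
    have "isCont v z0"
      using v(1) r0 holomorphic_on_imp_continuous_on continuous_on_eq_continuous_at by (metis centre_in_ball open_ball)
    then have "isCont (\<lambda>x. 2 * dcubic (v x)) z0" unfolding dcubic_def by (intro continuous_intros)
    then show ?thesis by (simp add: isCont_def)
  qed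
  ultimately have "dd \<midarrow>z0\<rightarrow> 2 * dcubic (v z0)" using Lim_transform_eventually by blast
  moreover have "dd \<midarrow>z0\<rightarrow> dd z0"
    using dd r0 holomorphic_on_imp_continuous_on continuous_on_eq_continuous_at isCont_def
    by (metis centre_in_ball open_ball)
  ultimately have "dd z0 = 2 * dcubic (v z0)" using LIM_unique by blast
  then have ddz: "dd z0 = 2 * (a * b)" using v(2) by (simp add: dcubic_def)
  have D\<kappa>: "(\<kappa> has_field_derivative deriv \<kappa> x) (at x)"
    "(deriv \<kappa> has_field_derivative deriv (deriv \<kappa>) x) (at x)" if "x \<in> ball z0 r0" for x
    using that \<kappa>(1) by (auto intro!: holomorphic_derivI[of _ "ball z0 r0"] holomorphic_deriv)
  have dv: "deriv v x = (x - z0) * (2 * \<kappa> x + (x - z0) * deriv \<kappa> x)" if x: "x \<in> ball z0 r0" for x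
  proof -
    have "((\<lambda>x. (x - z0)\<^sup>2 * \<kappa> x) has_field_derivative (x - z0) * (2 * \<kappa> x + (x - z0) * deriv \<kappa> x)) (at x)"
      by (rule derivative_eq_intros D\<kappa>[OF x] refl)+ (simp add: power2_eq_square algebra_simps)
    then have "(v has_field_derivative (x - z0) * (2 * \<kappa> x + (x - z0) * deriv \<kappa> x)) (at x)"
      by (rule has_field_derivative_transform_within_open[OF _ open_ball x]) (simp add: \<kappa>)
    then show ?thesis by (rule DERIV_imp_deriv)
  qed
  have z0: "z0 \<in> ball z0 r0" using r0 by simp
  have "((\<lambda>x. (x - z0) * (2 * \<kappa> x + (x - z0) * deriv \<kappa> x)) has_field_derivative 2 * \<kappa> z0) (at z0)"
    by (rule derivative_eq_intros D\<kappa>[OF z0] refl)+ simp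
  then have "(deriv v has_field_derivative 2 * \<kappa> z0) (at z0)"
    by (rule has_field_derivative_transform_within_open[OF _ open_ball z0]) (simp add: dv)
  then have "dd z0 = 2 * \<kappa> z0" unfolding dd_def by (rule DERIV_imp_deriv)
  then have "\<kappa> z0 \<noteq> 0" using ddz ab by auto
  then have "\<kappa> x \<noteq> 0" if "x \<in> ball z0 r0" for x
    using ne[of x] \<kappa>(2)[OF that] that by (cases "x = z0") auto
  with \<kappa> show ?thesis using that by blast
qed

text \<open>\<open>(x - z0)^(2 * g0) * M\<close> solves the equation up to an error of relative
  order \<open>2 * p\<close>, the order of \<open>v^p\<close> in \<open>x - z0\<close>. One
  predicate covers the exact solution (\<open>\<delta> = 0\<close>) and the obstructed one.\<close>

definition frobenius_solution where
  "frobenius_solution z0 v p \<delta> \<rho> M N \<longleftrightarrow>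
     \<rho> > 0 \<and> M holomorphic_on ball 0 \<rho> \<and> N holomorphic_on ball 0 \<rho> \<and> (\<forall>z\<in>ball 0 \<rho>. M z \<noteq> 0) \<and> N 0 \<noteq> 0 \<and>
     (\<forall>U L x. open U \<longrightarrow> U \<subseteq> ball z0 \<rho> - {z0} \<longrightarrow> log_branch U (\<lambda>x. x - z0) L \<longrightarrow> x \<in> U \<longrightarrow>
        deriv (deriv (\<lambda>x. exp (2 * g0 * L x) * M (x - z0))) x = pot (v x) * (exp (2 * g0 * L x) * M (x - z0))
          + \<delta> * (exp (2 * g0 * L x) * ((x - z0) ^ (2 * p) * N (x - z0))))"

text \<open>Only row \<open>p\<close> may be nonzero, so \<open>heun_op\<close> sends the series to
  \<open>\<delta> * v^p\<close>. Since \<open>v = (x - z0)^2 * \<kappa>\<close>, the multivalued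
  factor \<open>v^g0\<close> is \<open>exp (2 * g0 * L)\<close> times a holomorphic
  function.\<close>

lemma frobenius_local:
  assumes r0: "r0 > 0" and v: "v holomorphic_on ball z0 r0" "v z0 = 0"
    and ne: "\<And>x. x \<in> ball z0 r0 - {z0} \<Longrightarrow> v x \<noteq> 0 \<and> v x \<noteq> a \<and> v x \<noteq> b"
    and ode: "\<And>x. x \<in> ball z0 r0 \<Longrightarrow> (deriv v x)\<^sup>2 = 4 * cubic (v x)"
    and row: "\<And>n. row frobenius n = (if n = p then \<delta> else 0)"
  obtains \<rho> M N where "frobenius_solution z0 v p \<delta> \<rho> M N" "\<rho> \<le> r0"
proof -
  obtain \<kappa> where \<kappa>: "\<kappa> holomorphic_on ball z0 r0" "\<And>x. x \<in> ball z0 r0 \<Longrightarrow> \<kappa> x \<noteq> 0"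
    "\<And>x. x \<in> ball z0 r0 \<Longrightarrow> v x = (x - z0)\<^sup>2 * \<kappa> x"
    using chart_factor[OF r0 v ne ode] by blast
  obtain l where l: "l holomorphic_on ball z0 r0" "\<And>x. x \<in> ball z0 r0 \<Longrightarrow> \<kappa> x = exp (l x)"
    using holomorphic_log_ball[OF \<kappa>(1,2)] by blast
  have neab: "v x - a \<noteq> 0" "v x - b \<noteq> 0" if "x \<in> ball z0 r0" for x
    using ne[of x] that v(2) ab by (cases "x = z0"; auto)+
  have va: "(\<lambda>x. v x - a) holomorphic_on ball z0 r0" "(\<lambda>x. v x - b) holomorphic_on ball z0 r0"
    by (intro holomorphic_intros v)+
  obtain lA where lA: "lA holomorphic_on ball z0 r0" "\<And>x. x \<in> ball z0 r0 \<Longrightarrow> v x - a = exp (lA x)"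
    using holomorphic_log_ball[OF va(1) neab(1)] by blast
  obtain lB where lB: "lB holomorphic_on ball z0 r0" "\<And>x. x \<in> ball z0 r0 \<Longrightarrow> v x - b = exp (lB x)"
    using holomorphic_log_ball[OF va(2) neab(2)] by blast
  define F where "F = Abs_fps frobenius"
  define y y1 y2 where "y = eval_fps F" and "y1 = eval_fps (fps_deriv F)" and "y2 = eval_fps (fps_deriv (fps_deriv F))"
  have "0 < fps_conv_radius F" unfolding F_def by (rule frobenius_radius)
  then obtain R where R: "0 < R" "ereal R < fps_conv_radius F"
    using ereal_dense2[of 0 "fps_conv_radius F"] by auto
  have rad: "ereal (norm z) < fps_conv_radius F" if "z \<in> ball 0 R" for z
    using that by (intro less_trans[OF _ R(2)]) simp
  have yhol: "y holomorphic_on ball 0 R"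
    unfolding y_def by (intro holomorphic_on_eval_fps) (use rad in \<open>auto simp: in_eball_iff\<close>)
  have "y 0 = 1" unfolding y_def eval_fps_at_0 by (simp add: F_def)
  \<comment> \<open>The disc is shrunk until the series, which is 1 at the origin, has no zeros;
    this makes \<open>M\<close> zero-free.\<close>
  define A where "A = ball 0 R \<inter> y -` (- {0})"
  have "open A" unfolding A_def
    by (intro continuous_open_preimage holomorphic_on_imp_continuous_on yhol) auto
  then have "open (ball z0 r0 \<inter> v -` A)"
    by (intro continuous_open_preimage holomorphic_on_imp_continuous_on v) auto
  moreover have "z0 \<in> ball z0 r0 \<inter> v -` A"
    using R(1) r0 v(2) \<open>y 0 = 1\<close> by (simp add: A_def)
  ultimately obtain \<rho>' where \<rho>': "\<rho>' > 0" "ball z0 \<rho>' \<subseteq> ball z0 r0 \<inter> v -` A"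
    using openE by blast
  define \<rho> where "\<rho> = min \<rho>' r0"
  have \<rho>: "\<rho> > 0" "\<rho> \<le> r0" "ball z0 \<rho> \<subseteq> ball z0 r0" using \<rho>' r0 by (auto simp: \<rho>_def)
  have vA: "v x \<in> ball 0 R" "y (v x) \<noteq> 0" if "x \<in> ball z0 \<rho>" for x
  proof -
    have "x \<in> ball z0 \<rho>'" using that by (simp add: \<rho>_def)
    then have "v x \<in> A" using \<rho>'(2) by blast
    then show "v x \<in> ball 0 R" "y (v x) \<noteq> 0" by (auto simp: A_def)
  qed
  \<comment> \<open>A logarithm of \<open>\<kappa>^g0 (v - a)^gA (v - b)^gB\<close>, the
    single-valued part of the gauge factor.\<close>
  define \<Lambda> where "\<Lambda> = (\<lambda>x. g0 * l x + gA * lA x + gB * lB x)"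
  have \<Lambda>: "\<Lambda> holomorphic_on ball z0 r0" unfolding \<Lambda>_def by (intro holomorphic_intros l lA lB)
  define M where "M = (\<lambda>\<xi>. exp (\<Lambda> (z0 + \<xi>)) * y (v (z0 + \<xi>)))"
  define N where "N = (\<lambda>\<xi>. exp (\<Lambda> (z0 + \<xi>)) * \<kappa> (z0 + \<xi>) ^ p)"
  have shift: "(\<lambda>\<xi>. f (z0 + \<xi>)) holomorphic_on ball 0 \<rho>" if "f holomorphic_on ball z0 \<rho>" for f
  proof -
    have "(\<lambda>\<xi>. \<xi> + z0) holomorphic_on ball 0 \<rho>" by (intro holomorphic_intros)
    moreover have "(\<lambda>\<xi>. \<xi> + z0) ` ball 0 \<rho> \<subseteq> ball z0 \<rho>" by (auto simp: dist_norm)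
    ultimately have "(f \<circ> (\<lambda>\<xi>. \<xi> + z0)) holomorphic_on ball 0 \<rho>"
      using that holomorphic_on_compose_gen by blast
    then show ?thesis by (simp add: o_def add.commute)
  qed
  have \<Lambda>\<rho>: "\<Lambda> holomorphic_on ball z0 \<rho>" using \<Lambda> \<rho>(3) by (rule holomorphic_on_subset)
  have yv: "(\<lambda>x. y (v x)) holomorphic_on ball z0 \<rho>"
  proof -
    have "v ` ball z0 \<rho> \<subseteq> ball 0 R" using vA(1) by blast
    from holomorphic_on_compose_gen[OF holomorphic_on_subset[OF v(1) \<rho>(3)] yhol this]
    show ?thesis by (simp add: o_def)
  qed
  show ?thesis
  proof (rule that[of \<rho> M N])
    show "frobenius_solution z0 v p \<delta> \<rho> M N"
      unfolding frobenius_solution_def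
    proof (intro conjI ballI allI impI)
      show "M holomorphic_on ball 0 \<rho>" "N holomorphic_on ball 0 \<rho>"
        unfolding M_def N_def by (intro holomorphic_intros shift \<Lambda>\<rho> yv holomorphic_on_subset[OF \<kappa>(1) \<rho>(3)])+
      show "M z \<noteq> 0" if "z \<in> ball 0 \<rho>" for z
        using vA(2)[of "z0 + z"] that by (simp add: M_def dist_norm)
      show "N 0 \<noteq> 0" using \<kappa>(2)[of z0] r0 by (simp add: N_def)
      fix U L x assume U: "open U" "U \<subseteq> ball z0 \<rho> - {z0}" and L: "log_branch U (\<lambda>x. x - z0) L" and x: "x \<in> U"
      define \<Phi> where "\<Phi> = (\<lambda>x. exp (2 * g0 * L x) * exp (\<Lambda> x))"
      have Ur0: "x \<in> ball z0 r0" "x \<in> ball z0 \<rho>" "x \<noteq> z0" "x \<in> ball z0 r0 - {z0}" if "x \<in> U" for x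
        using that U(2) \<rho>(3) by auto
      have D: "(f has_field_derivative deriv f x) (at x)" if "f holomorphic_on ball z0 r0" "x \<in> U" for f x
        using that(1) open_ball Ur0(1)[OF that(2)] by (rule holomorphic_derivI)
      have main: "deriv (deriv (\<lambda>x. \<Phi> x * y (v x))) x
        = pot (v x) * (\<Phi> x * y (v x)) + \<Phi> x * heun_op (v x) (y (v x)) (y1 (v x)) (y2 (v x))"
      proof (rule gauged_second_derivative[OF U(1) x, of v "deriv v"])
        fix x assume x: "x \<in> U"
        note xr = Ur0[OF x]
        show "(v has_field_derivative deriv v x) (at x)" by (rule D[OF v(1) x])
        show "(deriv v x)\<^sup>2 = 4 * cubic (v x)" by (rule ode[OF xr(1)])
        show nv: "v x \<noteq> 0 \<and> v x \<noteq> a \<and> v x \<noteq> b" by (rule ne[OF xr(4)])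
        have "deriv v x = (x - z0)\<^sup>2 * \<kappa> x * (2 / (x - z0) + deriv l x)"
        proof -
          have "deriv \<kappa> x = \<kappa> x * deriv l x"
            by (rule log_derivative_mult[OF \<kappa>(1) l(1) open_ball xr(1) l(2)])
          then have "((\<lambda>x. (x - z0)\<^sup>2 * \<kappa> x) has_field_derivative (x - z0)\<^sup>2 * \<kappa> x * (2 / (x - z0) + deriv l x)) (at x)"
            using xr(3) by (auto intro!: derivative_eq_intros D[OF \<kappa>(1) x] simp: field_simps power2_eq_square)
          then have "(v has_field_derivative (x - z0)\<^sup>2 * \<kappa> x * (2 / (x - z0) + deriv l x)) (at x)"
            by (rule has_field_derivative_transform_within_open[OF _ open_ball xr(1)]) (simp add: \<kappa>)
          then show ?thesis by (rule DERIV_imp_deriv)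
        qed
        then have d0: "2 / (x - z0) + deriv l x = deriv v x / v x"
          using nv \<kappa>(3)[OF xr(1)] by simp
        have dAB: "deriv (\<lambda>x. v x - c) x = deriv v x" for c
          by (rule DERIV_imp_deriv) (auto intro!: derivative_eq_intros D[OF v(1) x])
        have dA: "deriv lA x = deriv v x / (v x - a)"
          using log_derivative_mult[OF va(1) lA(1) open_ball xr(1) lA(2)] nv unfolding dAB by (simp add: field_simps)
        have dB: "deriv lB x = deriv v x / (v x - b)"
          using log_derivative_mult[OF va(2) lB(1) open_ball xr(1) lB(2)] nv unfolding dAB by (simp add: field_simps)
        have "(\<Phi> has_field_derivative \<Phi> x * (2 * g0 * (1 / (x - z0)) + (g0 * deriv l x + gA * deriv lA x + gB * deriv lB x))) (at x)"
          unfolding \<Phi>_def \<Lambda>_def exp_add[symmetric]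
          by (auto intro!: derivative_eq_intros log_branch_derivative[OF U(1) L x] D[OF l(1) x] D[OF lA(1) x] D[OF lB(1) x])
        also have "2 * g0 * (1 / (x - z0)) + (g0 * deriv l x + gA * deriv lA x + gB * deriv lB x) = gauge (v x) * deriv v x"
        proof -
          have "2 * g0 * (1 / (x - z0)) + g0 * deriv l x = g0 * (deriv v x / v x)"
            unfolding d0[symmetric] by (simp add: algebra_simps)
          then show ?thesis unfolding dA dB gauge_def by (simp add: algebra_simps)
        qed
        finally show "(\<Phi> has_field_derivative \<Phi> x * gauge (v x) * deriv v x) (at x)" by (simp add: mult.assoc)
        have r: "ereal (norm (v x)) < fps_conv_radius F" by (rule rad[OF vA(1)[OF xr(2)]])
        then show "(y has_field_derivative y1 (v x)) (at (v x))"
          unfolding y_def y1_def by (rule has_field_derivative_eval_fps)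
        have "ereal (norm (v x)) < fps_conv_radius (fps_deriv F)"
          using r fps_conv_radius_deriv[of F] by (rule less_le_trans)
        then show "(y1 has_field_derivative y2 (v x)) (at (v x))"
          unfolding y1_def y2_def by (rule has_field_derivative_eval_fps)
      qed
      have "(\<lambda>n. row frobenius n * v x ^ n) sums heun_op (v x) (y (v x)) (y1 (v x)) (y2 (v x))"
      proof -
        have "fps_nth F = frobenius" by (auto simp: F_def)
        then show ?thesis
          using heun_op_sums[OF rad[OF vA(1)[OF Ur0(2)[OF x]]]] by (simp add: y_def y1_def y2_def)
      qed
      moreover have "(\<lambda>n. row frobenius n * v x ^ n) = (\<lambda>n. if n = p then \<delta> * v x ^ p else 0)"
        by (auto simp: row)
      ultimately have op: "heun_op (v x) (y (v x)) (y1 (v x)) (y2 (v x)) = \<delta> * v x ^ p"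
        using sums_unique2 sums_single[of p "\<lambda>_. \<delta> * v x ^ p"] by metis
      have "v x ^ p = (x - z0) ^ (2 * p) * \<kappa> x ^ p"
        using \<kappa>(3)[OF Ur0(1)[OF x]] by (simp add: power_mult_distrib power_mult)
      then show "deriv (deriv (\<lambda>x. exp (2 * g0 * L x) * M (x - z0))) x = pot (v x) * (exp (2 * g0 * L x) * M (x - z0))
          + \<delta> * (exp (2 * g0 * L x) * ((x - z0) ^ (2 * p) * N (x - z0)))"
        using main unfolding op by (simp add: M_def N_def \<Phi>_def mult_ac)
    qed (use \<rho> in auto)
  qed (use \<rho> in auto)
qed

end

section \<open>Scalar monodromy and the resonance condition\<close>

locale heun_chart = lattice \<omega>1 \<omega>3 + heun a b g0 gA gB \<mu> e
  for \<omega>1 \<omega>3 a b g0 gA gB \<mu> e :: complex +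
  fixes v :: "complex \<Rightarrow> complex" and k :: nat and m :: "nat \<Rightarrow> complex" and E :: complex and r0 :: real
  assumes k: "k \<in> {0..3}" and r0: "r0 > 0"
    and v_hol: "v holomorphic_on ball (hp k) r0" and v_centre: "v (hp k) = 0"
    and v_avoids: "\<And>x. x \<in> ball (hp k) r0 - {hp k} \<Longrightarrow> v x \<noteq> 0 \<and> v x \<noteq> a \<and> v x \<noteq> b"
    and v_ode: "\<And>x. x \<in> ball (hp k) r0 \<Longrightarrow> (deriv v x)\<^sup>2 = 4 * cubic (v x)"
    and regular: "(ball (hp k) r0 - {hp k}) \<inter> S = {}"
    and potential: "\<And>x. x \<in> ball (hp k) r0 - {hp k} \<Longrightarrow>
      (\<Sum>i=0..3. m i * (m i + 1) * wp (x + hp i)) - E = pot (v x)"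
begin

lemma solves_on_iff:
  assumes "U \<subseteq> ball (hp k) r0 - {hp k}"
  shows "solves_on \<omega>1 \<omega>3 m E U f \<longleftrightarrow> f holomorphic_on U \<and> (\<forall>x\<in>U. deriv (deriv f) x = pot (v x) * f x)"
proof -
  have "H_op \<omega>1 \<omega>3 m f x = E * f x \<longleftrightarrow> deriv (deriv f) x = pot (v x) * f x" if "x \<in> U" for x
  proof -
    have "x \<in> ball (hp k) r0 - {hp k}" using that assms by blast
    then have pf: "pot (v x) * f x = (\<Sum>i=0..3. m i * (m i + 1) * wp (x + hp i)) * f x - E * f x"
      by (simp only: potential[symmetric] left_diff_distrib)
    have "- D + A = B \<longleftrightarrow> D = A - B" for A B D :: complex by (auto simp: algebra_simps)
    then show ?thesis unfolding H_op_def pf .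
  qed
  then show ?thesis unfolding solves_on_def by auto
qed

lemma multivalued_solution_reduced:
  assumes g: "multivalued_solution \<omega>1 \<omega>3 m E (hp k) r g" and \<rho>: "0 < \<rho>" "\<rho> \<le> r" "\<rho> \<le> r0"
  shows "g holomorphic_on half_plane \<rho>"
    and "\<And>t. t \<in> half_plane \<rho> \<Longrightarrow> deriv (deriv (\<lambda>t. exp (- t / 2) * g t)) t
      = (exp (2 * t) * pot (v (hp k + exp t)) + 1 / 4) * (exp (- t / 2) * g t)"
proof -
  have "ln \<rho> \<le> ln r" using \<rho> by simp
  then have "half_plane \<rho> \<subseteq> half_plane r" by auto
  then show hol: "g holomorphic_on half_plane \<rho>"
    using g holomorphic_on_subset unfolding multivalued_solution_def by blast
  fix t assume t: "t \<in> half_plane \<rho>"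
  have "deriv (deriv (\<lambda>t. exp (- t / 2) * g t)) t = exp (- t / 2) * (exp (2 * t) * (pot (v (hp k + exp t)) * g t) + g t / 4)"
  proof (rule reduced_second_derivative[OF hol \<rho>(1) _ t, where ?z0.0 = "hp k" and F = "\<lambda>t. pot (v (hp k + exp t)) * g t"])
    fix U L x assume U: "open U" "U \<subseteq> ball (hp k) \<rho> - {hp k}" and L: "log_branch U (\<lambda>x. x - hp k) L" and x: "x \<in> U"
    have U': "U \<subseteq> ball (hp k) r - {hp k}" "U \<subseteq> ball (hp k) r0 - {hp k}" using U(2) \<rho> by auto
    have "solves_on \<omega>1 \<omega>3 m E U (g \<circ> L)"
      using g U(1) U'(1) L unfolding multivalued_solution_def by blast
    then have "deriv (deriv (g \<circ> L)) x = pot (v x) * (g \<circ> L) x"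
      using solves_on_iff[OF U'(2)] x by blast
    moreover have "hp k + exp (L x) = x" using L x by (simp add: log_branch_def)
    ultimately show "deriv (deriv (\<lambda>x. g (L x))) x = pot (v (hp k + exp (L x))) * g (L x)"
      by (simp add: o_def)
  qed
  then show "deriv (deriv (\<lambda>t. exp (- t / 2) * g t)) t
      = (exp (2 * t) * pot (v (hp k + exp t)) + 1 / 4) * (exp (- t / 2) * g t)"
    by (simp add: algebra_simps)
qed

text \<open>The exponents in \<open>x\<close> are \<open>1/2 - Suc p\<close> and
  \<open>1/2 + Suc p\<close>. The recurrence of the larger never divides by zero; that of the
  smaller can fail only in row \<open>p\<close>. If this row vanishes, the two series form a basis
  with scalar monodromy; conversely, scalar monodromy makes the error term vanish by
  \<open>resonance_vanishes\<close>.\<close>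

lemma apparent_iff:
  assumes p: "2 * g0 = 1 / 2 - of_nat (Suc p)" and m: "m k - 1 / 2 \<in> \<int>"
  shows "apparent_singularity \<omega>1 \<omega>3 m E k \<longleftrightarrow> row frobenius p = 0"
proof -
  define \<delta> where "\<delta> = row frobenius p"
  have "4 * g0 = 2 * (1 / 2 - of_nat (Suc p))" unfolding p[symmetric] by simp
  also have "\<dots> = - 1 - 2 * of_nat p" by (simp add: algebra_simps)
  finally have g4: "4 * g0 = - 1 - 2 * of_nat p" .
  have "g0 = (4 * g0) / 4" by simp
  then have g0_eq: "g0 = (- 1 - 2 * of_nat p) / 4" unfolding g4 .
  have Z: "coeffZ (Suc n) \<noteq> 0" if "n \<noteq> p" for n
  proof -
    have "2 * of_nat (Suc n) - 1 + 4 * g0 = 2 * (of_nat (Suc n) - of_nat (Suc p))"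
      unfolding g4 by (simp add: algebra_simps)
    also have "\<dots> \<noteq> 0" using that by simp
    finally show ?thesis using ab by (simp add: coeffZ_def del: of_nat_Suc)
  qed
  have rows: "row frobenius n = (if n = p then \<delta> else 0)" for n
    using row_frobenius[OF Z] by (simp add: \<delta>_def)
  \<comment> \<open>Replacing \<open>g0\<close> by \<open>1 / 2 - g0\<close> leaves
    \<open>pot\<close> unchanged, because \<open>2 * g0 * (2 * g0 - 1)\<close> is symmetric, and
    selects the other exponent.\<close>
  interpret large: heun a b "1 / 2 - g0" gA gB \<mu> e by unfold_locales (use ab in auto)
  have ZL: "large.coeffZ (Suc n) \<noteq> 0" for n
  proof -
    have "2 * of_nat (Suc n) - 1 + 4 * (1 / 2 - g0) = (of_nat (2 * Suc n + 2 * Suc p) :: complex)"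
    proof -
      have "4 * (1 / 2 - g0) = 2 - 4 * g0" by simp
      then show ?thesis unfolding g4 by (simp add: algebra_simps)
    qed
    also have "\<dots> \<noteq> 0" unfolding of_nat_eq_0_iff by simp
    finally show ?thesis using ab by (simp add: large.coeffZ_def del: of_nat_Suc)
  qed
  have rowsL: "large.row large.frobenius n = (if n = 0 then 0 else 0)" for n
    using large.row_frobenius[OF ZL] by simp
  have potL: "large.pot = pot" unfolding large.pot_def pot_def by (simp add: algebra_simps)
  have "\<exists>\<rho> M N. frobenius_solution (hp k) v p \<delta> \<rho> M N \<and> \<rho> \<le> r0"
    by (rule frobenius_local[OF r0 v_hol v_centre v_avoids v_ode rows]) blast+
  then obtain \<rho>1 M N where FS1: "frobenius_solution (hp k) v p \<delta> \<rho>1 M N" "\<rho>1 \<le> r0" by blast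
  have "\<exists>\<rho> M N. large.frobenius_solution (hp k) v 0 0 \<rho> M N \<and> \<rho> \<le> r0"
    by (rule large.frobenius_local[OF r0 v_hol v_centre v_avoids v_ode rowsL]) blast+
  then obtain \<rho>2 M' N' where FS2: "large.frobenius_solution (hp k) v 0 0 \<rho>2 M' N'" "\<rho>2 \<le> r0" by blast
  have F1: "0 < \<rho>1" "\<rho>1 \<le> r0" "M holomorphic_on ball 0 \<rho>1" "N holomorphic_on ball 0 \<rho>1"
    "\<And>z. z \<in> ball 0 \<rho>1 \<Longrightarrow> M z \<noteq> 0" "N 0 \<noteq> 0"
    using FS1 unfolding frobenius_solution_def by blast+
  have F2: "0 < \<rho>2" "\<rho>2 \<le> r0" "M' holomorphic_on ball 0 \<rho>2" "N' holomorphic_on ball 0 \<rho>2"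
    "\<And>z. z \<in> ball 0 \<rho>2 \<Longrightarrow> M' z \<noteq> 0" "N' 0 \<noteq> 0"
    using FS2 unfolding large.frobenius_solution_def by blast+
  have g1: "4 * (1 / 2 - g0) = 3 + 2 * of_nat p"
  proof -
    have "4 * (1 / 2 - g0) = 2 - 4 * g0" by simp
    then show ?thesis unfolding g4 by (simp add: algebra_simps)
  qed
  define G G' where "G = (\<lambda>t. exp (2 * g0 * t) * M (exp t))"
    and "G' = (\<lambda>t. exp (2 * (1 / 2 - g0) * t) * M' (exp t))"
  have eq1: "deriv (deriv (\<lambda>x. G (L x))) x = pot (v (hp k + exp (L x))) * G (L x)
      + \<delta> * (exp (2 * g0 * L x) * (exp (L x) ^ (2 * p) * N (exp (L x))))"
    if U: "open U" "U \<subseteq> ball (hp k) \<rho> - {hp k}" "log_branch U (\<lambda>x. x - hp k) L" "x \<in> U" and \<rho>: "\<rho> \<le> \<rho>1"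
    for U L x \<rho>
  proof -
    have e: "exp (L y) = y - hp k" if "y \<in> U" for y using U(3) that by (simp add: log_branch_def)
    have "deriv (deriv (\<lambda>x. G (L x))) x = deriv (deriv (\<lambda>x. exp (2 * g0 * L x) * M (x - hp k))) x"
      by (rule second_deriv_cong[OF U(1,4)]) (simp add: G_def e)
    also have "\<dots> = pot (v x) * (exp (2 * g0 * L x) * M (x - hp k))
        + \<delta> * (exp (2 * g0 * L x) * ((x - hp k) ^ (2 * p) * N (x - hp k)))"
    proof -
      have "U \<subseteq> ball (hp k) \<rho>1 - {hp k}" using U(2) \<rho> by auto
      with FS1(1) U(1,3,4) show ?thesis unfolding frobenius_solution_def by blast
    qed
    finally show ?thesis using e[OF U(4)] by (simp add: G_def)
  qed
  have eq2: "deriv (deriv (\<lambda>x. G' (L x))) x = pot (v (hp k + exp (L x))) * G' (L x)"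
    if U: "open U" "U \<subseteq> ball (hp k) \<rho> - {hp k}" "log_branch U (\<lambda>x. x - hp k) L" "x \<in> U" and \<rho>: "\<rho> \<le> \<rho>2"
    for U L x \<rho>
  proof -
    have e: "exp (L y) = y - hp k" if "y \<in> U" for y using U(3) that by (simp add: log_branch_def)
    have "deriv (deriv (\<lambda>x. G' (L x))) x = deriv (deriv (\<lambda>x. exp (2 * (1 / 2 - g0) * L x) * M' (x - hp k))) x"
      by (rule second_deriv_cong[OF U(1,4)]) (simp add: G'_def e)
    also have "\<dots> = pot (v x) * (exp (2 * (1 / 2 - g0) * L x) * M' (x - hp k))
        + 0 * (exp (2 * (1 / 2 - g0) * L x) * ((x - hp k) ^ (2 * 0) * N' (x - hp k)))"
    proof -
      have "U \<subseteq> ball (hp k) \<rho>2 - {hp k}" using U(2) \<rho> by auto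
      with FS2(1) U(1,3,4) show ?thesis unfolding large.frobenius_solution_def potL by blast
    qed
    finally show ?thesis using e[OF U(4)] by (simp add: G'_def)
  qed
  have Ghol: "G holomorphic_on half_plane \<rho>" "G' holomorphic_on half_plane \<rho>"
    if "0 < \<rho>" "\<rho> \<le> \<rho>1" "\<rho> \<le> \<rho>2" for \<rho>
  proof -
    have "M holomorphic_on ball 0 \<rho>" "M' holomorphic_on ball 0 \<rho>"
      using that by (auto intro: holomorphic_on_subset[OF F1(3)] holomorphic_on_subset[OF F2(3)])
    then have "(\<lambda>t. M (exp t)) holomorphic_on half_plane \<rho>" "(\<lambda>t. M' (exp t)) holomorphic_on half_plane \<rho>"
      using that(1) by (auto intro: compose_exp_holomorphic)
    then show "G holomorphic_on half_plane \<rho>" "G' holomorphic_on half_plane \<rho>"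
      unfolding G_def G'_def by (auto intro!: holomorphic_intros)
  qed
  show ?thesis
  proof
    assume "apparent_singularity \<omega>1 \<omega>3 m E k"
    then obtain s r and Y :: "complex \<Rightarrow> complex ^ 2" where r: "r > 0" and Y: "\<And>j. multivalued_solution \<omega>1 \<omega>3 m E (hp k) r (\<lambda>t. Y t $ j)"
      and indep: "\<And>c :: complex ^ 2. (\<And>t. Re t < ln r \<Longrightarrow> (\<Sum>j\<in>UNIV. c $ j * Y t $ j) = 0) \<Longrightarrow> c = 0"
      and mono: "\<And>t. Re t < ln r \<Longrightarrow> Y (t + 2 * of_real pi * \<i>) = Y t v* mat s"
      unfolding apparent_singularity_def is_monodromy_matrix_def by blast
    define \<rho> where "\<rho> = min r (min \<rho>1 \<rho>2)"
    have \<rho>: "\<rho> > 0" "\<rho> \<le> r" "\<rho> \<le> \<rho>1" "\<rho> \<le> \<rho>2" "\<rho> \<le> r0" using r F1(1,2) F2(1) by (auto simp: \<rho>_def)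
    have "ln \<rho> \<le> ln r" using \<rho> by simp
    then have sub: "half_plane \<rho> \<subseteq> half_plane r" by auto
    define q where "q = (\<lambda>t. exp (2 * t) * pot (v (hp k + exp t)) + 1 / 4)"
    define Y' :: "complex \<Rightarrow> complex ^ 2" where "Y' = (\<lambda>t. \<chi> j. exp (- t / 2) * Y t $ j)"
    define y1 where "y1 = (\<lambda>t. exp (of_nat (Suc p) * t) * M' (exp t))"
    define h where "h = (\<lambda>t. exp (- of_nat (Suc p) * t) * M (exp t))"
    have y1G: "y1 = (\<lambda>t. exp (- t / 2) * G' t)"
    proof
      fix t
      have "of_nat (Suc p) * t = - t / 2 + 2 * (1 / 2 - g0) * t"
        by (simp add: g0_eq field_simps)
      then show "y1 t = exp (- t / 2) * G' t"
        unfolding y1_def G'_def by (simp only: exp_add mult.assoc)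
    qed
    have hG: "h = (\<lambda>t. exp (- t / 2) * G t)"
    proof
      fix t
      have "- of_nat (Suc p) * t = - t / 2 + 2 * g0 * t"
        by (simp add: g0_eq field_simps)
      then show "h t = exp (- t / 2) * G t"
        unfolding h_def G_def by (simp only: exp_add mult.assoc)
    qed
    \<comment> \<open>The multiplier is \<open>- s\<close>, because \<open>exp (- t / 2)\<close>
      changes sign under the shift by \<open>2 * pi * \<i>\<close>.\<close>
    have "\<delta> * N 0 = 0"
    proof (rule resonance_vanishes[OF \<rho>(1), of "Suc p" M' M "\<lambda>\<xi>. \<delta> * N \<xi>" y1 h q Y' "- s"])
      show "M' holomorphic_on ball 0 \<rho>" "M holomorphic_on ball 0 \<rho>" "(\<lambda>\<xi>. \<delta> * N \<xi>) holomorphic_on ball 0 \<rho>"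
        using \<rho> F1 F2 by (auto intro!: holomorphic_intros elim: holomorphic_on_subset)
      show "M' z \<noteq> 0" if "z \<in> ball 0 \<rho>" for z using F2(5)[of z] that \<rho> by simp
      fix t assume t: "t \<in> half_plane \<rho>"
      have "deriv (deriv y1) t = exp (- t / 2) * (exp (2 * t) * (pot (v (hp k + exp t)) * G' t) + G' t / 4)"
        unfolding y1G
        by (rule reduced_second_derivative[OF Ghol(2) \<rho>(1) _ t, where ?z0.0 = "hp k" and F = "\<lambda>t. pot (v (hp k + exp t)) * G' t"])
           (use \<rho> eq2 in auto)
      then show "deriv (deriv y1) t = q t * y1 t" unfolding y1G q_def by (simp add: algebra_simps)
      have "deriv (deriv h) t = exp (- t / 2) * (exp (2 * t) * (pot (v (hp k + exp t)) * G t
          + \<delta> * (exp (2 * g0 * t) * (exp t ^ (2 * p) * N (exp t)))) + G t / 4)"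
        unfolding hG
        by (rule reduced_second_derivative[OF Ghol(1) \<rho>(1) _ t, where ?z0.0 = "hp k" and
            F = "\<lambda>t. pot (v (hp k + exp t)) * G t + \<delta> * (exp (2 * g0 * t) * (exp t ^ (2 * p) * N (exp t)))"])
           (use \<rho> eq1 in auto)
      also have "\<dots> = q t * h t + (exp (- t / 2) * exp (2 * t) * exp (2 * g0 * t) * exp t ^ (2 * p)) * (\<delta> * N (exp t))"
        unfolding hG q_def by (simp add: algebra_simps)
      also have "exp (- t / 2) * exp (2 * t) * exp (2 * g0 * t) * exp t ^ (2 * p) = exp (of_nat (Suc p) * t)"
      proof -
        have "- t / 2 + 2 * t + 2 * g0 * t + of_nat (2 * p) * t = of_nat (Suc p) * t"
          by (simp add: g0_eq field_simps)
        then show ?thesis by (simp only: exp_add[symmetric] exp_of_nat_mult[symmetric])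
      qed
      finally show "deriv (deriv h) t = q t * h t + exp (of_nat (Suc p) * t) * (\<delta> * N (exp t))" .
      show "deriv (deriv (\<lambda>t. Y' t $ j)) t = q t * Y' t $ j" for j
        using multivalued_solution_reduced(2)[OF Y[of j] \<rho>(1,2,5) t] by (simp add: Y'_def q_def)
      have half: "exp (- (t + 2 * of_real pi * \<i>) / 2) = - exp (- t / 2)"
      proof -
        have "exp (- (t + 2 * of_real pi * \<i>) / 2) = exp (- t / 2) * exp (- (of_real pi * \<i>))"
          unfolding exp_add[symmetric] by (rule arg_cong[where f = exp]) (simp add: field_simps)
        then show ?thesis by (simp add: exp_minus)
      qed
      have "Y (t + 2 * of_real pi * \<i>) $ j = s * Y t $ j" for j
      proof -
        have "Re t < ln r" using t sub by auto
        from mono[OF this] show ?thesis by (simp add: vector_mult_scalar_mat)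
      qed
      then show "Y' (t + 2 * of_real pi * \<i>) $ j = - s * Y' t $ j" for j
        unfolding Y'_def vec_lambda_beta half by simp
    next
      show "(\<lambda>t. Y' t $ j) holomorphic_on half_plane \<rho>" for j
        using multivalued_solution_reduced(1)[OF Y[of j] \<rho>(1,2,5)]
        by (auto simp: Y'_def intro!: holomorphic_intros)
    next
      fix c :: "complex ^ 2" assume c: "\<And>t. t \<in> half_plane \<rho> \<Longrightarrow> (\<Sum>j\<in>UNIV. c $ j * Y' t $ j) = 0"
      \<comment> \<open>Independence is given on the larger half-plane; a relation on the smaller
        one extends to it by analytic continuation.\<close>
      have "(\<Sum>j\<in>UNIV. c $ j * Y t $ j) = 0" if "t \<in> half_plane r" for t
      proof (rule analytic_continuation_open[of "half_plane \<rho>" "half_plane r" "\<lambda>t. \<Sum>j\<in>UNIV. c $ j * Y t $ j" "\<lambda>_. 0"])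
        show "half_plane \<rho> \<noteq> {}" using half_plane_nonempty[of \<rho>] by blast
        show "connected (half_plane r)" by (rule convex_connected[OF half_plane_convex])
        show "(\<lambda>t. \<Sum>j\<in>UNIV. c $ j * Y t $ j) holomorphic_on half_plane r"
          using Y by (auto intro!: holomorphic_intros simp: multivalued_solution_def)
        fix t assume "t \<in> half_plane \<rho>"
        from c[OF this] have "exp (- t / 2) * (\<Sum>j\<in>UNIV. c $ j * Y t $ j) = 0"
          unfolding sum_distrib_left by (simp add: Y'_def mult_ac)
        then show "(\<Sum>j\<in>UNIV. c $ j * Y t $ j) = 0" by simp
      qed (use sub that half_plane_open in auto)
      then show "c = 0" by (intro indep) auto
    qed (auto simp: y1_def h_def)
    then show "row frobenius p = 0" using F1(6) by (simp add: \<delta>_def)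
  next
    assume "row frobenius p = 0"
    then have \<delta>0: "\<delta> = 0" by (simp add: \<delta>_def)
    define \<rho> where "\<rho> = min \<rho>1 \<rho>2"
    have \<rho>: "\<rho> > 0" "\<rho> \<le> \<rho>1" "\<rho> \<le> \<rho>2" "\<rho> \<le> r0" using F1(1,2) F2(1) by (auto simp: \<rho>_def)
    define Y :: "complex \<Rightarrow> complex ^ 2" where "Y = (\<lambda>t. \<chi> j. if j = 1 then G t else G' t)"
    have sol: "multivalued_solution \<omega>1 \<omega>3 m E (hp k) \<rho> g"
      if hol: "g holomorphic_on half_plane \<rho>" and eq: "\<And>U L x. open U \<Longrightarrow> U \<subseteq> ball (hp k) \<rho> - {hp k} \<Longrightarrow>
        log_branch U (\<lambda>x. x - hp k) L \<Longrightarrow> x \<in> U \<Longrightarrow> deriv (deriv (\<lambda>x. g (L x))) x = pot (v (hp k + exp (L x))) * g (L x)"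
      for g
      unfolding multivalued_solution_def
    proof (intro conjI allI impI)
      show "g holomorphic_on half_plane \<rho>" by (rule hol)
      fix U L assume U: "open U \<and> U \<subseteq> ball (hp k) \<rho> - {hp k} \<and> log_branch U (\<lambda>x. x - hp k) L"
      then have L: "L holomorphic_on U" "\<And>x. x \<in> U \<Longrightarrow> exp (L x) = x - hp k" by (auto simp: log_branch_def)
      have "U \<subseteq> ball (hp k) r0 - {hp k}" using U \<rho> by auto
      moreover have "(g \<circ> L) holomorphic_on U"
      proof (rule holomorphic_on_compose_gen[OF L(1) hol])
        show "L ` U \<subseteq> half_plane \<rho>" using log_branch_half_plane U by blast
      qed
      moreover have "deriv (deriv (g \<circ> L)) x = pot (v x) * (g \<circ> L) x" if "x \<in> U" for x
        using eq[of U L x] U that L(2)[OF that] by (simp add: o_def)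
      ultimately show "solves_on \<omega>1 \<omega>3 m E U (g \<circ> L)" by (simp add: solves_on_iff)
    qed
    \<comment> \<open>Both exponents lie in \<open>1/2 + \<int>\<close>, so each basis solution is
      multiplied by -1.\<close>
    have "is_monodromy_matrix \<omega>1 \<omega>3 m E (hp k) (mat (-1))"
      unfolding is_monodromy_matrix_def
    proof (intro exI[of _ \<rho>] conjI exI[of _ Y] allI impI)
      show "(ball (hp k) \<rho> - {hp k}) \<inter> S = {}" using regular \<rho> by (auto simp: disjoint_iff)
      show "multivalued_solution \<omega>1 \<omega>3 m E (hp k) \<rho> (\<lambda>t. Y t $ j)" for j
      proof (cases "j = 1")
        case True
        then show ?thesis unfolding Y_def using sol[OF Ghol(1)] eq1 \<delta>0 \<rho> by simp
      next
        case False
        then show ?thesis unfolding Y_def using sol[OF Ghol(2)] eq2 \<rho> by simp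
      qed
      show "Y (t + 2 * of_real pi * \<i>) = Y t v* mat (- 1)" for t
      proof -
        have "exp (2 * g0 * (2 * of_real pi * \<i>)) = - 1" "exp (2 * (1 / 2 - g0) * (2 * of_real pi * \<i>)) = - 1"
        proof -
          have "2 * g0 * (2 * of_real pi * \<i>) = - (of_real pi * \<i>) - of_nat p * (2 * of_real pi * \<i>)"
            by (simp add: g0_eq field_simps)
          then show "exp (2 * g0 * (2 * of_real pi * \<i>)) = - 1"
            by (simp add: exp_diff exp_minus exp_of_nat_mult)
          have "2 * (1 / 2 - g0) * (2 * of_real pi * \<i>) = of_real pi * \<i> + of_nat (Suc p) * (2 * of_real pi * \<i>)"
            by (simp add: g0_eq field_simps)
          then show "exp (2 * (1 / 2 - g0) * (2 * of_real pi * \<i>)) = - 1"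
            by (simp only: exp_add exp_of_nat_mult) simp
        qed
        then have "G (t + 2 * of_real pi * \<i>) = - G t" "G' (t + 2 * of_real pi * \<i>) = - G' t"
          unfolding G_def G'_def distrib_left exp_add by simp_all
        then show ?thesis unfolding vec_eq_iff vector_mult_scalar_mat by (simp add: Y_def)
      qed
      fix c :: "complex ^ 2" assume c: "\<forall>t. Re t < ln \<rho> \<longrightarrow> (\<Sum>j\<in>UNIV. c $ j * Y t $ j) = 0"
      have GG: "G' t = exp t ^ (2 * Suc p) * (exp (2 * g0 * t) * M' (exp t))" for t
      proof -
        have "2 * (1 / 2 - g0) * t = of_nat (2 * Suc p) * t + 2 * g0 * t"
          by (simp add: g0_eq field_simps)
        then show ?thesis unfolding G'_def by (simp only: exp_add exp_of_nat_mult mult.assoc)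
      qed
      \<comment> \<open>A linear relation divided by the common factor
        \<open>exp (2 * g0 * t)\<close>. The second term vanishes at 0, so
        \<open>M 0 \<noteq> 0\<close> forces \<open>c $ 1 = 0\<close>.\<close>
      define P where "P = (\<lambda>\<xi>. c $ 1 * M \<xi> + c $ 2 * (\<xi> ^ (2 * Suc p) * M' \<xi>))"
      have P0: "P \<xi> = 0" if \<xi>: "\<xi> \<in> ball 0 \<rho> - {0}" for \<xi>
      proof -
        have "Re (Ln \<xi>) < ln \<rho>" using \<xi> \<rho>(1) by simp
        then have "c $ 1 * G (Ln \<xi>) + c $ 2 * G' (Ln \<xi>) = 0" using c by (simp add: sum_2 Y_def)
        then have "exp (2 * g0 * Ln \<xi>) * P \<xi> = 0" 
          unfolding GG unfolding G_def P_def using \<xi> by (simp add: algebra_simps)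
        then show ?thesis by simp
      qed
      have "P holomorphic_on ball 0 \<rho>" unfolding P_def
        by (intro holomorphic_intros holomorphic_on_subset[OF F1(3)] holomorphic_on_subset[OF F2(3)]) (use \<rho> in auto)
      then have "P \<midarrow>0\<rightarrow> P 0"
        using \<rho>(1) holomorphic_on_imp_continuous_on continuous_on_eq_continuous_at isCont_def
        by (metis centre_in_ball open_ball)
      moreover have "P \<midarrow>0\<rightarrow> 0"
        by (rule tendsto_eventually) (use P0 \<rho>(1) in \<open>auto simp: eventually_at intro!: exI[of _ \<rho>]\<close>)
      ultimately have "P 0 = 0" by (rule LIM_unique)
      then have c1: "c $ 1 = 0" using F1(5)[of 0] F1(1) by (simp add: P_def)
      have "P (of_real (\<rho> / 2)) = 0" using \<rho>(1) by (intro P0) auto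
      then have "c $ 2 = 0" using c1 F2(5)[of "of_real (\<rho> / 2)"] \<rho> by (simp add: P_def)
      with c1 show "c = 0" by (simp add: vec_eq_iff forall_2)
    qed (use \<rho> in auto)
    then show "apparent_singularity \<omega>1 \<omega>3 m E k"
      using m unfolding apparent_singularity_def by blast
  qed
qed

end

subsection \<open>Solutions in the spaces V\<close>

text \<open>Two tridiagonal matrices with the same diagonal and the same products of opposite off-diagonal
  entries are conjugate by a diagonal matrix, provided that their upper off-diagonal entries are nonzero.\<close>

lemma tridiagonal_transfer:
  fixes X Y Z X' Z' :: "nat \<Rightarrow> complex" and D :: nat
  defines "R \<equiv> \<lambda>X Z c n. (case n of 0 \<Rightarrow> 0 | Suc m \<Rightarrow> X m * c m) + Y n * c n + Z (Suc n) * c (Suc n)"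
  assumes prod: "\<And>n. X n * Z (Suc n) = X' n * Z' (Suc n)"
    and Z: "\<And>n. n < D \<Longrightarrow> Z (Suc n) \<noteq> 0" and Z': "\<And>n. n < D \<Longrightarrow> Z' (Suc n) \<noteq> 0"
    and ZD: "Z (Suc D) = 0" and XD: "X' D = 0"
    and f: "f 0 = 1" "\<And>n. n < D \<Longrightarrow> R X Z f n = 0"
  shows "R X Z f D = 0 \<longleftrightarrow> (\<exists>c. (\<exists>n\<le>D. c n \<noteq> 0) \<and> (\<forall>n>D. c n = 0) \<and> (\<forall>n. R X' Z' c n = 0))"
proof -
  \<comment> \<open>The diagonal of the conjugating matrix; the upper entries prescribe the ratio of
    successive values. Only \<open>n \<le> D\<close> matters, and there no division by zero
    occurs.\<close>
  define t where "t = rec_nat 1 (\<lambda>n t. t * Z (Suc n) / Z' (Suc n))"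
  have t_simps: "t 0 = 1" "t (Suc n) = t n * Z (Suc n) / Z' (Suc n)" for n
    by (simp_all add: t_def)
  have t_ne: "t n \<noteq> 0" if "n \<le> D" for n
    using that by (induction n) (auto simp: t_simps Z Z')
  have key: "R X' Z' c n = t n * R X Z g n"
    if c: "\<And>n. n \<le> D \<Longrightarrow> c n = t n * g n" "c (Suc D) = 0" and n: "n \<le> D" for c g n
  proof -
    have "(case n of 0 \<Rightarrow> 0 | Suc m \<Rightarrow> X' m * c m) = t n * (case n of 0 \<Rightarrow> 0 | Suc m \<Rightarrow> X m * g m)"
    proof (cases n)
      case (Suc m)
      then have "Z' (Suc m) \<noteq> 0" using n Z' by simp
      then have "X' m = X m * Z (Suc m) / Z' (Suc m)" using prod[of m] by (simp add: field_simps)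
      then show ?thesis using Suc n c(1)[of m] by (simp add: t_simps)
    qed simp
    moreover have "Z' (Suc n) * c (Suc n) = t n * (Z (Suc n) * g (Suc n))"
    proof (cases "n = D")
      case False
      then have "n < D" using n by simp
      then show ?thesis using c(1)[of "Suc n"] Z'[of n] by (simp add: t_simps)
    qed (simp add: c ZD)
    ultimately show ?thesis unfolding R_def using c(1)[OF n] by (simp add: algebra_simps)
  qed
  show ?thesis
  proof
    assume fD: "R X Z f D = 0"
    define c where "c = (\<lambda>n. if n \<le> D then t n * f n else 0)"
    have "R X' Z' c n = 0" for n
    proof (cases "n \<le> D")
      case True
      then have "R X' Z' c n = t n * R X Z f n" by (intro key) (auto simp: c_def)
      then show ?thesis using True f(2) fD by (cases "n = D") auto
    next
      case False
      \<comment> \<open>Row \<open>Suc D\<close> reduces to \<open>X' D * c D\<close>, which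
        \<open>X' D = 0\<close> removes; later rows meet no nonzero coefficient.\<close>
      then show ?thesis using XD by (cases "n = Suc D") (auto simp: R_def c_def split: nat.splits)
    qed
    then show "\<exists>c. (\<exists>n\<le>D. c n \<noteq> 0) \<and> (\<forall>n>D. c n = 0) \<and> (\<forall>n. R X' Z' c n = 0)"
      using f(1) by (intro exI[of _ c]) (auto simp: c_def t_simps intro: exI[of _ 0])
  next
    assume "\<exists>c. (\<exists>n\<le>D. c n \<noteq> 0) \<and> (\<forall>n>D. c n = 0) \<and> (\<forall>n. R X' Z' c n = 0)"
    then obtain c N where c: "N \<le> D" "c N \<noteq> 0" "\<And>n. n > D \<Longrightarrow> c n = 0" "\<And>n. R X' Z' c n = 0" by blast
    define g where "g = (\<lambda>n. c n / t n)"
    have tg: "c n = t n * g n" if "n \<le> D" for n using t_ne[OF that] by (simp add: g_def)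
    have Rg: "R X Z g n = 0" if "n \<le> D" for n
    proof -
      have "R X' Z' c n = t n * R X Z g n" by (rule key) (use tg c that in auto)
      then show ?thesis using c(4) t_ne[OF that] by simp
    qed
    define q where "q = g 0"
    have case_q: "(case n of 0 \<Rightarrow> 0 | Suc m \<Rightarrow> X m * g m) = q * (case n of 0 \<Rightarrow> 0 | Suc m \<Rightarrow> X m * f m)"
      if "\<And>m. n = Suc m \<Longrightarrow> g m = q * f m" for n
      by (cases n) (simp_all add: that mult.left_commute)
    have step: "g (Suc n) = q * f (Suc n)"
      if n: "n < D" "g n = q * f n" and m: "\<And>m. n = Suc m \<Longrightarrow> g m = q * f m" for n
    proof -
      have "R X Z g n - q * R X Z f n = 0" using Rg[of n] f(2)[of n] n by simp
      moreover have "R X Z g n - q * R X Z f n = Z (Suc n) * (g (Suc n) - q * f (Suc n))"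
      proof -
        have "(case n of 0 \<Rightarrow> 0 | Suc m \<Rightarrow> X m * g m) = q * (case n of 0 \<Rightarrow> 0 | Suc m \<Rightarrow> X m * f m)"
          by (rule case_q) (rule m)
        then show ?thesis unfolding R_def by (simp add: n(2) algebra_simps)
      qed
      ultimately show ?thesis using Z[OF n(1)] by simp
    qed
    \<comment> \<open>The upper entries are nonzero, so each row determines the next coefficient,
      and a solution is fixed by its first one.\<close>
    have gf: "g n = q * f n" if "n \<le> D" for n
      using that
    proof (induction n rule: less_induct)
      case (less n)
      show ?case
      proof (cases n)
        case 0
        then show ?thesis by (simp add: f q_def)
      next
        case (Suc m)
        have "g (Suc m) = q * f (Suc m)"
          by (rule step) (use less Suc in auto)
        then show ?thesis using Suc by simp
      qed
    qed
    have "q \<noteq> 0" using tg[OF c(1)] gf[OF c(1)] c(2) by auto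
    moreover have "R X Z g D = q * R X Z f D"
    proof -
      have "(case D of 0 \<Rightarrow> 0 | Suc m \<Rightarrow> X m * g m) = q * (case D of 0 \<Rightarrow> 0 | Suc m \<Rightarrow> X m * f m)"
        by (rule case_q) (simp add: gf)
      then show ?thesis unfolding R_def ZD by (simp add: gf[OF order_refl] algebra_simps)
    qed
    ultimately show "R X Z f D = 0" using Rg[of D] by simp
  qed
qed

lemma sum_four:
  assumes "{p, q, r, s} = {0..3::nat}"
  shows "(\<Sum>i=0..3. f i) = f p + f q + f r + (f s :: complex)"
proof -
  have "card {p, q, r, s} = 4" using assms by simp
  then have "distinct [p, q, r, s]"
    using card_distinct[of "[p, q, r, s]"] by simp
  then show ?thesis unfolding assms[symmetric] by (simp add: add.assoc)
qed

text \<open>\<open>v\<close> is a coordinate with a double zero at the half period \<open>k\<close> in which the equation has the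
  singular values \<open>0, a, b, \<infinity>\<close> at the half periods \<open>k, iA, iB, inf\<close>; \<open>Psi\<close> is the factor
  \<open>\<Phi>\<close> of the space \<open>V\<close>, normalised such that \<open>V\<close> consists of the products of \<open>Psi\<close>
  with polynomials in \<open>v\<close>.\<close>

locale chart = lattice \<omega>1 \<omega>3 for \<omega>1 \<omega>3 :: complex +
  fixes k inf iA iB :: nat and v :: "complex \<Rightarrow> complex" and \<epsilon> a b :: complex
    and Psi :: "(nat \<Rightarrow> complex) \<Rightarrow> nat \<Rightarrow> (nat \<Rightarrow> complex \<Rightarrow> complex) \<Rightarrow> complex \<Rightarrow> complex"
  assumes idx: "{inf, k, iA, iB} = {0..3}"
    and a0: "a \<noteq> 0" and b0: "b \<noteq> 0"
    and v_hol: "v holomorphic_on - (S - {hp k})" and v_centre: "v (hp k) = 0"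
    and v_avoids: "\<And>x. x \<notin> S \<Longrightarrow> v x \<noteq> 0 \<and> v x \<noteq> a \<and> v x \<noteq> b"
    and v_ode: "\<And>x. x \<notin> S - {hp k} \<Longrightarrow> (deriv v x)\<^sup>2 = 4 * (v x * (v x - a) * (v x - b))"
    and v_pot: "\<And>x \<mu>. x \<notin> S \<Longrightarrow> (\<Sum>i=0..3. \<mu> i * wp (x + hp i)) =
      \<mu> inf * (v x + \<epsilon>) + \<mu> k * (\<epsilon> + a * b / v x) + \<mu> iA * (\<epsilon> + a + a * (a - b) / (v x - a))
      + \<mu> iB * (\<epsilon> + b + b * (b - a) / (v x - b))"
    and V_to_chart: "\<And>\<beta> D c. of_nat D = - (\<Sum>i=0..3. \<beta> i / 2) \<Longrightarrow>
      \<exists>c'. \<forall>U L. branch_choice \<omega>1 \<omega>3 U L \<longrightarrow> (\<forall>x\<in>U.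
        (\<Sum>n=0..D. c n * (Phi_hat \<beta> L x * wp x ^ n)) = Psi \<beta> D L x * (\<Sum>n\<le>D. c' n * v x ^ n))"
    and chart_to_V: "\<And>\<beta> D c'. of_nat D = - (\<Sum>i=0..3. \<beta> i / 2) \<Longrightarrow>
      \<exists>c. \<forall>U L. branch_choice \<omega>1 \<omega>3 U L \<longrightarrow> (\<forall>x\<in>U.
        (\<Sum>n=0..D. c n * (Phi_hat \<beta> L x * wp x ^ n)) = Psi \<beta> D L x * (\<Sum>n\<le>D. c' n * v x ^ n))"
    and Psi_nonzero: "\<And>\<beta> D U L x. branch_choice \<omega>1 \<omega>3 U L \<Longrightarrow> x \<in> U \<Longrightarrow> Psi \<beta> D L x \<noteq> 0"
    and Psi_deriv: "\<And>\<beta> D U L x. of_nat D = - (\<Sum>i=0..3. \<beta> i / 2) \<Longrightarrow> branch_choice \<omega>1 \<omega>3 U L \<Longrightarrow> x \<in> U \<Longrightarrow>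
      (Psi \<beta> D L has_field_derivative Psi \<beta> D L x *
        (\<beta> k / 2 / v x + \<beta> iA / 2 / (v x - a) + \<beta> iB / 2 / (v x - b)) * deriv v x) (at x)"
begin

section \<open>Polynomial solutions in a chart\<close>

lemma k_index: "k \<in> {0..3}"
  using idx by auto

lemma v_deriv: "x \<notin> S \<Longrightarrow> (v has_field_derivative deriv v x) (at x)"
  by (rule holomorphic_derivI[OF v_hol open_Compl_singular_subset]) auto

text \<open>A finite connected image would be a point, making \<open>v'\<close> zero, whereas
  \<open>v'^2 = 4 v (v - a) (v - b)\<close> is nonzero off \<open>S\<close>. Consequently a
  polynomial identity in \<open>v\<close> on one branch domain can be compared
  coefficientwise.\<close>

lemma v_image_infinite:
  assumes "open U" "U \<inter> S = {}" "U \<noteq> {}"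
  shows "infinite (v ` U)"
proof
  assume fin: "finite (v ` U)"
  obtain x where "x \<in> U" using assms(3) by blast
  then obtain r where x: "x \<in> U" "r > 0" "ball x r \<subseteq> U" using openE[OF assms(1)] by blast
  have "v holomorphic_on ball x r"
    by (rule holomorphic_on_subset[OF v_hol]) (use x(3) assms(2) in auto)
  then have "connected (v ` ball x r)"
    by (intro connected_continuous_image holomorphic_on_imp_continuous_on) auto
  moreover have "finite (v ` ball x r)" by (rule finite_subset[OF image_mono[OF x(3)] fin])
  ultimately have "\<exists>c. v ` ball x r = {c}"
    using connected_finite_iff_sing x(2) by (metis ball_eq_empty image_is_empty not_le)
  then obtain c where c: "v ` ball x r = {c}" by blast
  have cv: "c = v y" if "y \<in> ball x r" for y
    using imageI[OF that, of v] unfolding c by simp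
  have "(v has_field_derivative 0) (at x)"
  proof (rule has_field_derivative_transform_within_open[OF DERIV_const[of c] open_ball])
    show "x \<in> ball x r" using x(2) by simp
  qed (rule cv)
  then have "deriv v x = 0" by (rule DERIV_imp_deriv)
  moreover have "x \<notin> S" using x(1) assms(2) by auto
  ultimately show False
    using v_ode[of x] v_avoids[of x] by simp
qed

text \<open>Guarantees that a nonzero coefficient vector gives a nonzero element of
  \<open>V\<close>. Logarithms exist on a small disc because \<open>wp\<close> avoids the values
  \<open>ev i\<close> off \<open>S\<close>.\<close>

lemma branch_choice_exists:
  obtains U L where "branch_choice \<omega>1 \<omega>3 U L" "U \<noteq> {}"
proof -
  obtain x0 where "x0 \<notin> S"
    using eventually_happens'[OF at_neq_bot eventually_not_singular[of 0]] by blast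
  then obtain r where r: "r > 0" "ball x0 r \<subseteq> - S"
    using openE[OF Compl_singular_open] by blast
  have "\<exists>l. log_branch (ball x0 r) (\<lambda>x. wp x - ev i) l" if i: "i \<in> {1..3}" for i
  proof -
    have "(\<lambda>x. wp x - ev i) holomorphic_on ball x0 r"
      using r lattice_subset_singular by (intro holomorphic_intros holomorphic_on_subset[OF wp_holomorphic]) auto
    moreover have "wp x - ev i \<noteq> 0" if "x \<in> ball x0 r" for x
      using wp_ne_e_val[OF i, of x] r that by auto
    ultimately obtain l where "l holomorphic_on ball x0 r" "\<And>x. x \<in> ball x0 r \<Longrightarrow> wp x - ev i = exp (l x)"
      using holomorphic_log_ball by blast
    then show ?thesis unfolding log_branch_def by (intro exI[of _ l]) simp
  qed
  then obtain L where "\<And>i. i \<in> {1..3} \<Longrightarrow> log_branch (ball x0 r) (\<lambda>x. wp x - ev i) (L i)" by metis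
  then have "branch_choice \<omega>1 \<omega>3 (ball x0 r) L" using r by (auto simp: branch_choice_def)
  then show ?thesis using that r(1) by auto
qed

lemma polynomial_zero_on_chart:
  assumes "open U" "U \<inter> S = {}" "U \<noteq> {}" "\<And>x. x \<in> U \<Longrightarrow> (\<Sum>n\<le>D. c n * v x ^ n) = 0" "n \<le> D"
  shows "c n = 0"
proof (rule ccontr)
  assume "c n \<noteq> 0"
  then have "finite {z. (\<Sum>n\<le>D. c n * z ^ n) = 0}" using assms(5) polyfun_finite_roots by blast
  moreover have "v ` U \<subseteq> {z. (\<Sum>n\<le>D. c n * z ^ n) = 0}" using assms(4) by auto
  ultimately show False using v_image_infinite[OF assms(1-3)] finite_subset by blast
qed

text \<open>A polynomial is treated as a power series of infinite radius, which makes the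
  computation for Frobenius series applicable. The sum runs to \<open>Suc D\<close> because
  \<open>coeffX\<close> raises the degree by one.\<close>

lemma polynomial_second_derivative:
  fixes \<beta> :: "nat \<Rightarrow> complex"
  assumes D: "of_nat D = - (\<Sum>i=0..3. \<beta> i / 2)" and branch: "branch_choice \<omega>1 \<omega>3 U L" and x: "x \<in> U"
    and c: "\<And>n. n > D \<Longrightarrow> c n = 0"
    and heun: "heun a b"
    and f: "\<And>x. x \<in> U \<Longrightarrow> f x = Psi \<beta> D L x * (\<Sum>n\<le>D. c n * v x ^ n)"
  shows "deriv (deriv f) x = heun.pot a b (\<beta> k / 2) (\<beta> iA / 2) (\<beta> iB / 2) \<mu> e (v x) * f x
    + Psi \<beta> D L x * (\<Sum>n\<le>Suc D. heun.row a b (\<beta> k / 2) (\<beta> iA / 2) (\<beta> iB / 2) \<mu> e c n * v x ^ n)"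
proof -
  interpret heun a b "\<beta> k / 2" "\<beta> iA / 2" "\<beta> iB / 2" \<mu> e by (rule heun)
  have U: "open U" "U \<inter> S = {}" using branch by (auto simp: branch_choice_def)
  define F where "F = Abs_fps c"
  have cF: "fps_nth F = c" by (auto simp: F_def)
  have ev0: "eventually (\<lambda>n. c n = 0) sequentially"
    using c by (auto simp: eventually_sequentially intro!: exI[of _ "Suc D"])
  have radius: "fps_conv_radius F = \<infinity>"
    unfolding fps_conv_radius_def cF using conv_radius_cong'[OF ev0] by simp
  have rad: "ereal (norm z) < fps_conv_radius F" "ereal (norm z) < fps_conv_radius (fps_deriv F)" for z
    using fps_conv_radius_deriv[of F] by (simp_all add: radius)
  have eval: "eval_fps F z = (\<Sum>n\<le>D. c n * z ^ n)" for z
    unfolding eval_fps_def cF by (rule suminf_finite) (auto simp: c)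
  have xS: "y \<notin> S" if "y \<in> U" for y using that U by auto
  have "deriv (deriv (\<lambda>x. Psi \<beta> D L x * eval_fps F (v x))) x
    = pot (v x) * (Psi \<beta> D L x * eval_fps F (v x)) + Psi \<beta> D L x *
      heun_op (v x) (eval_fps F (v x)) (eval_fps (fps_deriv F) (v x)) (eval_fps (fps_deriv (fps_deriv F)) (v x))"
  proof (rule gauged_second_derivative[OF U(1) x, of v "deriv v"])
    fix y assume y: "y \<in> U"
    show "(v has_field_derivative deriv v y) (at y)" by (rule v_deriv[OF xS[OF y]])
    show "(deriv v y)\<^sup>2 = 4 * cubic (v y)" using v_ode[of y] xS[OF y] by (simp add: cubic_def)
    show "v y \<noteq> 0 \<and> v y \<noteq> a \<and> v y \<noteq> b" by (rule v_avoids[OF xS[OF y]])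
    show "(Psi \<beta> D L has_field_derivative Psi \<beta> D L y * gauge (v y) * deriv v y) (at y)"
      unfolding gauge_def by (rule Psi_deriv[OF D branch y])
  qed (auto intro: has_field_derivative_eval_fps rad)
  moreover have "heun_op (v x) (eval_fps F (v x)) (eval_fps (fps_deriv F) (v x)) (eval_fps (fps_deriv (fps_deriv F)) (v x))
    = (\<Sum>n\<le>Suc D. row c n * v x ^ n)"
  proof (rule sums_unique2)
    show "(\<lambda>n. row c n * v x ^ n) sums
      heun_op (v x) (eval_fps F (v x)) (eval_fps (fps_deriv F) (v x)) (eval_fps (fps_deriv (fps_deriv F)) (v x))"
      using heun_op_sums[OF rad(1)] by (simp add: cF)
    show "(\<lambda>n. row c n * v x ^ n) sums (\<Sum>n\<le>Suc D. row c n * v x ^ n)"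
      by (rule sums_finite) (auto simp: row_def c split: nat.splits)
  qed
  moreover have "deriv (deriv f) x = deriv (deriv (\<lambda>x. Psi \<beta> D L x * eval_fps F (v x))) x"
    by (rule second_deriv_cong[OF U(1) x]) (simp only: f eval)
  ultimately show ?thesis by (simp only: f[OF x] eval)
qed

text \<open>One nonempty branch domain already forces all rows to vanish, and vanishing rows give a
  solution on every branch domain: the multivaluedness is confined to the zero-free factor
  \<open>Psi\<close>.\<close>

lemma V_solution_iff:
  fixes M \<beta> :: "nat \<Rightarrow> complex"
  assumes D: "of_nat D = - (\<Sum>i=0..3. \<beta> i / 2)"
    and heun: "heun a b"
    and pot: "\<And>x. x \<notin> S \<Longrightarrow> (\<Sum>i=0..3. M i * (M i + 1) * wp (x + hp i)) - E
      = heun.pot a b (\<beta> k / 2) (\<beta> iA / 2) (\<beta> iB / 2) \<mu> e (v x)"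
  shows "has_nonzero_solution_in_V \<omega>1 \<omega>3 M E \<beta> \<longleftrightarrow>
    (\<exists>c. (\<exists>n\<le>D. c n \<noteq> 0) \<and> (\<forall>n>D. c n = 0) \<and>
       (\<forall>n. heun.row a b (\<beta> k / 2) (\<beta> iA / 2) (\<beta> iB / 2) \<mu> e c n = 0))" (is "?L \<longleftrightarrow> ?R")
proof -
  interpret heun a b "\<beta> k / 2" "\<beta> iA / 2" "\<beta> iB / 2" \<mu> e by (rule heun)
  have H: "H_op \<omega>1 \<omega>3 M f x = E * f x \<longleftrightarrow> deriv (deriv f) x = pot (v x) * f x" if "x \<notin> S" for f x
  proof -
    have pf: "pot (v x) * f x = (\<Sum>i=0..3. M i * (M i + 1) * wp (x + hp i)) * f x - E * f x"
      by (simp only: pot[OF that, symmetric] left_diff_distrib)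
    have "- d + A = B \<longleftrightarrow> d = A - B" for A B d :: complex by (auto simp: algebra_simps)
    then show ?thesis unfolding H_op_def pf .
  qed
  show ?thesis
  proof
    assume ?L
    then obtain F where F: "F \<in> V_space \<omega>1 \<omega>3 \<beta>" "\<exists>U L. branch_choice \<omega>1 \<omega>3 U L \<and> (\<exists>x\<in>U. F L x \<noteq> 0)"
      "\<And>U L. branch_choice \<omega>1 \<omega>3 U L \<Longrightarrow> solves_on \<omega>1 \<omega>3 M E U (F L)"
      unfolding has_nonzero_solution_in_V_def by blast
    obtain D' c0 where c0: "F = (\<lambda>L x. \<Sum>n=0..D'. c0 n * (Phi_hat \<beta> L x * wp x ^ n))"
      "of_nat D' = - (\<Sum>i=0..3. \<beta> i / 2)"
      using F(1) unfolding V_space_def by blast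
    have "D' = D" using c0(2) D by (metis of_nat_eq_iff)
    obtain c' where c': "\<And>U L x. branch_choice \<omega>1 \<omega>3 U L \<Longrightarrow> x \<in> U \<Longrightarrow>
        F L x = Psi \<beta> D L x * (\<Sum>n\<le>D. c' n * v x ^ n)"
      using V_to_chart[OF D, of c0] unfolding c0(1) \<open>D' = D\<close> by blast
    define c where "c = (\<lambda>n. if n \<le> D then c' n else 0)"
    have c: "F L x = Psi \<beta> D L x * (\<Sum>n\<le>D. c n * v x ^ n)" if "branch_choice \<omega>1 \<omega>3 U L" "x \<in> U" for U L x
      using c'[OF that] by (simp add: c_def)
    obtain U L x where UL: "branch_choice \<omega>1 \<omega>3 U L" "x \<in> U" "F L x \<noteq> 0" using F(2) by blast
    have U: "open U" "U \<inter> S = {}" using UL(1) by (auto simp: branch_choice_def)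
    have "row c n = 0" if "n \<le> Suc D" for n
    proof (rule polynomial_zero_on_chart[OF U _ _ that])
      show "U \<noteq> {}" using UL by auto
      fix y assume y: "y \<in> U"
      then have "H_op \<omega>1 \<omega>3 M (F L) y = E * F L y" "y \<notin> S"
        using F(3)[OF UL(1)] U(2) unfolding solves_on_def by blast+
      then have "deriv (deriv (F L)) y = pot (v y) * F L y" using H[of y "F L"] by simp
      moreover have "deriv (deriv (F L)) y = pot (v y) * F L y + Psi \<beta> D L y * (\<Sum>n\<le>Suc D. row c n * v y ^ n)"
        by (rule polynomial_second_derivative[OF D UL(1) y _ heun c[OF UL(1)]]) (auto simp: c_def)
      ultimately show "(\<Sum>n\<le>Suc D. row c n * v y ^ n) = 0" using Psi_nonzero[OF UL(1) y] by simp
    qed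
    moreover have "row c n = 0" if "\<not> n \<le> Suc D" for n
      using that by (auto simp: row_def c_def split: nat.splits)
    moreover have "\<exists>n\<le>D. c n \<noteq> 0"
    proof (rule ccontr)
      assume "\<not> (\<exists>n\<le>D. c n \<noteq> 0)"
      then have "(\<Sum>n\<le>D. c n * v x ^ n) = 0" by simp
      then show False using UL(3) c[OF UL(1,2)] by simp
    qed
    ultimately show ?R by (intro exI[of _ c]) (auto simp: c_def)
  next
    assume ?R
    then obtain c N where c: "N \<le> D" "c N \<noteq> 0" "\<And>n. n > D \<Longrightarrow> c n = 0" "\<And>n. row c n = 0" by blast
    obtain c0 where c0: "\<And>U L x. branch_choice \<omega>1 \<omega>3 U L \<Longrightarrow> x \<in> U \<Longrightarrow>
        (\<Sum>n=0..D. c0 n * (Phi_hat \<beta> L x * wp x ^ n)) = Psi \<beta> D L x * (\<Sum>n\<le>D. c n * v x ^ n)"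
      using chart_to_V[OF D, of c] by blast
    define F where "F = (\<lambda>L x. \<Sum>n=0..D. c0 n * (Phi_hat \<beta> L x * wp x ^ n))"
    have F: "F L x = Psi \<beta> D L x * (\<Sum>n\<le>D. c n * v x ^ n)" if "branch_choice \<omega>1 \<omega>3 U L" "x \<in> U" for U L x
      unfolding F_def using c0[OF that] .
    have "F \<in> V_space \<omega>1 \<omega>3 \<beta>" unfolding V_space_def F_def using D by blast
    moreover have "\<exists>U L. branch_choice \<omega>1 \<omega>3 U L \<and> (\<exists>x\<in>U. F L x \<noteq> 0)"
    proof -
      obtain U L where UL: "branch_choice \<omega>1 \<omega>3 U L" "U \<noteq> {}" by (rule branch_choice_exists)
      have U: "open U" "U \<inter> S = {}" using UL(1) by (auto simp: branch_choice_def)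
      have "\<exists>x\<in>U. (\<Sum>n\<le>D. c n * v x ^ n) \<noteq> 0"
        using polynomial_zero_on_chart[OF U UL(2) _ c(1), of c] c(2) by blast
      then show ?thesis using UL(1) F[OF UL(1)] Psi_nonzero[OF UL(1)] by (metis mult_eq_0_iff)
    qed
    moreover have "solves_on \<omega>1 \<omega>3 M E U (F L)" if UL: "branch_choice \<omega>1 \<omega>3 U L" for U L
    proof -
      have U: "open U" "U \<inter> S = {}" using UL(1) by (auto simp: branch_choice_def)
      have "(F L has_field_derivative deriv (F L) x) (at x)" if x: "x \<in> U" for x
      proof -
        have xS: "x \<notin> S" using x U by auto
        have "(\<lambda>x. Psi \<beta> D L x * (\<Sum>n\<le>D. c n * v x ^ n)) field_differentiable (at x)"
        proof (intro field_differentiable_mult)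
          show "Psi \<beta> D L field_differentiable (at x)"
            using Psi_deriv[OF D UL x] field_differentiable_def by blast
          have "(\<lambda>x. \<Sum>n\<le>D. c n * v x ^ n) holomorphic_on U"
            by (intro holomorphic_intros holomorphic_on_subset[OF v_hol]) (use U in auto)
          then show "(\<lambda>x. \<Sum>n\<le>D. c n * v x ^ n) field_differentiable (at x)"
            using U(1) x holomorphic_on_imp_differentiable_at by blast
        qed
        then obtain d where "((\<lambda>x. Psi \<beta> D L x * (\<Sum>n\<le>D. c n * v x ^ n)) has_field_derivative d) (at x)"
          unfolding field_differentiable_def by blast
        then have "(F L has_field_derivative d) (at x)"
          by (rule has_field_derivative_transform_within_open[OF _ U(1) x]) (simp add: F[OF UL])
        then show ?thesis by (simp add: DERIV_imp_deriv)
      qed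
      then have "F L holomorphic_on U" using U(1) holomorphic_on_open by blast
      moreover have "H_op \<omega>1 \<omega>3 M (F L) x = E * F L x" if x: "x \<in> U" for x
      proof -
        have "deriv (deriv (F L)) x = pot (v x) * F L x + Psi \<beta> D L x * (\<Sum>n\<le>Suc D. row c n * v x ^ n)"
          by (rule polynomial_second_derivative[OF D UL x c(3) heun F[OF UL]])
        then have "deriv (deriv (F L)) x = pot (v x) * F L x" by (simp add: c(4))
        moreover have "x \<notin> S" using x U by auto
        ultimately show ?thesis using H[of x "F L"] by simp
      qed
      ultimately show ?thesis by (simp add: solves_on_def)
    qed
    ultimately show ?L unfolding has_nonzero_solution_in_V_def by blast
  qed
qed

text \<open>Each translate of \<open>wp\<close> contributes \<open>\<epsilon>\<close> times its
  coupling constant; together these shift the eigenvalue.\<close>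

lemma potential_in_chart:
  fixes \<mu> :: "nat \<Rightarrow> complex"
  assumes x: "x \<notin> S" and "heun a b"
    and "\<mu> k = 2 * g0 * (2 * g0 - 1)" "\<mu> iA = 2 * gA * (2 * gA - 1)" "\<mu> iB = 2 * gB * (2 * gB - 1)"
  shows "(\<Sum>i=0..3. \<mu> i * wp (x + hp i)) - E =
    heun.pot a b g0 gA gB (\<mu> inf) (E - \<epsilon> * (\<mu> inf + \<mu> k + \<mu> iA + \<mu> iB)) (v x)"
  unfolding v_pot[OF x] heun.pot_def[OF assms(2)] assms(3-5)[symmetric] by (simp add: algebra_simps)

text \<open>(A) is expanded with the smaller exponent \<open>1 - \<alpha> k\<close> at
  \<open>k\<close> and with \<open>\<alpha> i\<close> at \<open>iA\<close> and \<open>iB\<close>;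
  \<open>\<beta>\<close> supplies the exponents for (B). The diagonals agree because
  \<open>d\<close> cancels: \<open>\<beta> k + \<beta> i = 1 - \<alpha> k + \<alpha> i\<close> for
  \<open>i \<noteq> k\<close>.\<close>

lemma apparent_iff_V_solution:
  fixes \<alpha> l M :: "nat \<Rightarrow> complex"
  assumes l: "\<And>i. i \<in> {0..3} \<Longrightarrow> l i * (l i + 1) = \<alpha> i * (\<alpha> i - 1)"
    and M: "\<And>i. i \<in> {0..3} \<Longrightarrow> M i * (M i + 1) = (\<alpha> i + d) * (\<alpha> i + d + 1)"
    and d: "d = - (\<Sum>i=0..3. \<alpha> i / 2)" "d \<notin> \<int>"
    and \<alpha>k: "\<alpha> k - 3 / 2 \<in> \<nat>" and lk: "l k - 1 / 2 \<in> \<int>"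
  shows "apparent_singularity \<omega>1 \<omega>3 l E k \<longleftrightarrow>
    has_nonzero_solution_in_V \<omega>1 \<omega>3 M E (\<lambda>i. if i = k then - \<alpha> i - d else \<alpha> i + d + 1)"
proof -
  obtain D where D: "\<alpha> k - 3 / 2 = of_nat D" using \<alpha>k by (auto elim: Nats_cases)
  then have ak: "\<alpha> k = of_nat D + 3 / 2" by (simp add: algebra_simps)
  have "card {inf, k, iA, iB} = 4" using idx by simp
  then have dist: "distinct [inf, k, iA, iB]"
    using card_distinct[of "[inf, k, iA, iB]"] by simp
  have in4: "inf \<in> {0..3}" "k \<in> {0..3}" "iA \<in> {0..3}" "iB \<in> {0..3}" using idx by auto
  have dsum: "d = - ((\<alpha> inf + \<alpha> k + \<alpha> iA + \<alpha> iB) / 2)"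
    unfolding d(1) sum_four[OF idx] by (simp add: add_divide_distrib)
  have "\<alpha> inf + \<alpha> k + \<alpha> iA + \<alpha> iB = - 2 * d" unfolding dsum mult_minus_left mult_minus_right by simp
  then have ainf: "\<alpha> inf = - 2 * d - \<alpha> k - \<alpha> iA - \<alpha> iB" by algebra
  have heun: "heun a b" by unfold_locales (rule a0 b0)+
  define \<beta> where "\<beta> = (\<lambda>i. if i = k then - \<alpha> i - d else \<alpha> i + d + 1)"
  have \<beta>: "\<beta> k = - \<alpha> k - d" "\<beta> iA = \<alpha> iA + d + 1" "\<beta> iB = \<alpha> iB + d + 1" "\<beta> inf = \<alpha> inf + d + 1"
    using dist by (auto simp: \<beta>_def)
  have \<beta>D: "of_nat D = - (\<Sum>i=0..3. \<beta> i / 2)"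
    unfolding sum_four[OF idx] \<beta> ainf ak by (simp add: field_simps)
  define \<mu> \<mu>' where "\<mu> = (\<lambda>i. l i * (l i + 1))" and "\<mu>' = (\<lambda>i. M i * (M i + 1))"
  have \<mu>: "\<mu> i = \<alpha> i * (\<alpha> i - 1)" "\<mu>' i = (\<alpha> i + d) * (\<alpha> i + d + 1)" if "i \<in> {0..3}" for i
    using l[OF that] M[OF that] by (simp_all add: \<mu>_def \<mu>'_def)
  define e where "e = E - \<epsilon> * (\<mu> inf + \<mu> k + \<mu> iA + \<mu> iB)"
  \<comment> \<open>The four \<open>\<alpha>\<close> add up to \<open>- 2 * d\<close>, which makes
    the sums of the coupling constants of (A) and (B) equal.\<close>
  have e': "E - \<epsilon> * (\<mu>' inf + \<mu>' k + \<mu>' iA + \<mu>' iB) = e"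
    unfolding e_def \<mu>[OF in4(1)] \<mu>[OF in4(2)] \<mu>[OF in4(3)] \<mu>[OF in4(4)] ainf by (simp add: algebra_simps)
  have half: "2 * (z / 2) = z" for z :: complex by simp
  have potV: "(\<Sum>i=0..3. M i * (M i + 1) * wp (x + hp i)) - E
      = heun.pot a b (\<beta> k / 2) (\<beta> iA / 2) (\<beta> iB / 2) (\<mu>' inf) e (v x)" if "x \<notin> S" for x
  proof -
    have "\<mu>' k = 2 * (\<beta> k / 2) * (2 * (\<beta> k / 2) - 1)" "\<mu>' iA = 2 * (\<beta> iA / 2) * (2 * (\<beta> iA / 2) - 1)"
      "\<mu>' iB = 2 * (\<beta> iB / 2) * (2 * (\<beta> iB / 2) - 1)"
      unfolding half \<mu>(2)[OF in4(2)] \<mu>(2)[OF in4(3)] \<mu>(2)[OF in4(4)] \<beta> by (simp_all add: algebra_simps)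
    from potential_in_chart[OF that heun this, of E]
    have "(\<Sum>i=0..3. \<mu>' i * wp (x + hp i)) - E
      = heun.pot a b (\<beta> k / 2) (\<beta> iA / 2) (\<beta> iB / 2) (\<mu>' inf) e (v x)" unfolding e' .
    then show ?thesis unfolding \<mu>'_def .
  qed
  have potA: "(\<Sum>i=0..3. l i * (l i + 1) * wp (x + hp i)) - E
      = heun.pot a b ((1 - \<alpha> k) / 2) (\<alpha> iA / 2) (\<alpha> iB / 2) (\<mu> inf) e (v x)" if "x \<notin> S" for x
  proof -
    have "\<mu> k = 2 * ((1 - \<alpha> k) / 2) * (2 * ((1 - \<alpha> k) / 2) - 1)" "\<mu> iA = 2 * (\<alpha> iA / 2) * (2 * (\<alpha> iA / 2) - 1)"
      "\<mu> iB = 2 * (\<alpha> iB / 2) * (2 * (\<alpha> iB / 2) - 1)"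
      unfolding half \<mu>(1)[OF in4(2)] \<mu>(1)[OF in4(3)] \<mu>(1)[OF in4(4)] by (simp_all add: algebra_simps)
    from potential_in_chart[OF that heun this, of E]
    have "(\<Sum>i=0..3. \<mu> i * wp (x + hp i)) - E
      = heun.pot a b ((1 - \<alpha> k) / 2) (\<alpha> iA / 2) (\<alpha> iB / 2) (\<mu> inf) e (v x)" unfolding e_def[symmetric] .
    then show ?thesis unfolding \<mu>_def .
  qed
  obtain r0 where r0: "r0 > 0" "ball (hp k) r0 \<inter> (S - {hp k}) = {}"
    using singular_discrete[of "S - {hp k}" "hp k"] by auto
  interpret A: heun_chart \<omega>1 \<omega>3 a b "(1 - \<alpha> k) / 2" "\<alpha> iA / 2" "\<alpha> iB / 2" "\<mu> inf" e v k l E r0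
  proof unfold_locales
    show "v holomorphic_on ball (hp k) r0"
      by (rule holomorphic_on_subset[OF v_hol]) (use r0 in auto)
    show "v x \<noteq> 0 \<and> v x \<noteq> a \<and> v x \<noteq> b" if "x \<in> ball (hp k) r0 - {hp k}" for x
      by (rule v_avoids) (use that r0 in blast)
    show "(deriv v x)\<^sup>2 = 4 * heun.cubic a b (v x)" if "x \<in> ball (hp k) r0" for x
      unfolding heun.cubic_def[OF heun] by (rule v_ode) (use that r0 in blast)
    show "(\<Sum>i=0..3. l i * (l i + 1) * wp (x + hp i)) - E
      = heun.pot a b ((1 - \<alpha> k) / 2) (\<alpha> iA / 2) (\<alpha> iB / 2) (\<mu> inf) e (v x)" if "x \<in> ball (hp k) r0 - {hp k}" for x
      by (rule potA) (use that r0 in blast)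
  qed (use a0 b0 k_index r0 v_centre in auto)
  interpret V: heun a b "\<beta> k / 2" "\<beta> iA / 2" "\<beta> iB / 2" "\<mu>' inf" e by (rule heun)
  have "apparent_singularity \<omega>1 \<omega>3 l E k \<longleftrightarrow> A.row A.frobenius D = 0"
    by (rule A.apparent_iff) (use lk in \<open>simp_all add: ak\<close>)
  also have "\<dots> \<longleftrightarrow> (\<exists>c. (\<exists>n\<le>D. c n \<noteq> 0) \<and> (\<forall>n>D. c n = 0) \<and> (\<forall>n. V.row c n = 0))"
  proof -
    have Y: "V.coeffY = A.coeffY"
    proof
      fix n
      have "of_nat n + \<beta> k / 2 + \<beta> iA / 2 = of_nat n + (1 - \<alpha> k) / 2 + \<alpha> iA / 2"
        "of_nat n + \<beta> k / 2 + \<beta> iB / 2 = of_nat n + (1 - \<alpha> k) / 2 + \<alpha> iB / 2"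
        unfolding \<beta> by (simp_all add: field_simps)
      then show "V.coeffY n = A.coeffY n" by (simp only: V.coeffY_def A.coeffY_def)
    qed
    have ZA: "A.coeffZ n = 4 * a * b * of_nat n * (of_nat n - of_nat (Suc D))" for n
      unfolding A.coeffZ_def unfolding ak by (simp add: field_simps)
    have ZV: "V.coeffZ n = 4 * a * b * of_nat n * (of_nat n - of_nat D - 2 - d)" for n
      unfolding V.coeffZ_def unfolding \<beta> ak by (simp add: field_simps)
    \<comment> \<open>The second factor is common to (A) and (B). The first is the one that
      \<open>coeffZ (Suc n)\<close> carries for (B).\<close>
    have XA: "A.coeffX n = 4 * (of_nat n - of_nat D - 1 - d) * (of_nat n - 1 / 2 - of_nat D - d - \<alpha> inf)" for n
      unfolding A.coeffX_def unfolding \<mu>(1)[OF in4(1)] ainf ak by (simp add: field_simps power2_eq_square)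
    have XV: "V.coeffX n = 4 * (of_nat n - of_nat D) * (of_nat n - 1 / 2 - of_nat D - d - \<alpha> inf)" for n
      unfolding V.coeffX_def unfolding \<mu>(2)[OF in4(1)] \<beta> ainf ak by (simp add: field_simps power2_eq_square)
    show ?thesis unfolding A.row_def V.row_def Y
    proof (rule tridiagonal_transfer)
      show "A.coeffX n * A.coeffZ (Suc n) = V.coeffX n * V.coeffZ (Suc n)" for n
        unfolding XA ZA XV ZV by (simp add: algebra_simps)
      show "A.coeffZ (Suc n) \<noteq> 0" if "n < D" for n
        using that a0 b0 unfolding ZA by (simp del: of_nat_Suc)
      show "V.coeffZ (Suc n) \<noteq> 0" if "n < D" for n
      proof -
        \<comment> \<open>The only factor of this entry that could vanish; it would make
          \<open>d\<close> an integer.\<close>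
        have "of_nat (Suc n) - of_nat D - 2 - d \<noteq> 0"
        proof
          assume "of_nat (Suc n) - of_nat D - 2 - d = 0"
          then have "d = of_int (int (Suc n) - int D - 2)" by (simp add: algebra_simps)
          then show False using d(2) Ints_of_int by metis
        qed
        then show ?thesis using a0 b0 unfolding ZV by (simp del: of_nat_Suc)
      qed
      show "A.coeffZ (Suc D) = 0" unfolding ZA by simp
      show "V.coeffX D = 0" unfolding XV by simp
      show "A.frobenius 0 = 1" by simp
      fix n assume "n < D"
      then have "A.coeffZ (Suc n) \<noteq> 0" using a0 b0 unfolding ZA by (simp del: of_nat_Suc)
      from A.row_frobenius[OF this]
      show "(case n of 0 \<Rightarrow> 0 | Suc m \<Rightarrow> A.coeffX m * A.frobenius m) + A.coeffY n * A.frobenius n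
        + A.coeffZ (Suc n) * A.frobenius (Suc n) = 0" by (simp add: A.row_def)
    qed
  qed
  also have "\<dots> \<longleftrightarrow> has_nonzero_solution_in_V \<omega>1 \<omega>3 M E \<beta>"
    by (rule V_solution_iff[OF \<beta>D heun potV, symmetric])
  finally show ?thesis unfolding \<beta>_def .
qed

end

subsection \<open>Charts at the four half periods\<close>

lemma polynomial_recentre:
  fixes e :: complex
  shows "\<exists>c'. \<forall>z. (\<Sum>n\<le>D. c n * z ^ n) = (\<Sum>n\<le>D. c' n * (z - e) ^ n)"
proof -
  define p where "p = (\<Sum>n\<le>D. monom (c n) n)"
  define q where "q = pcompose p [:e, 1:]"
  have "degree p \<le> D"
    unfolding p_def by (intro degree_sum_le) (auto intro: order_trans[OF degree_monom_le])
  then have deg: "degree q \<le> D" unfolding q_def by (simp add: degree_pcompose)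
  have "(\<Sum>n\<le>D. c n * z ^ n) = (\<Sum>n\<le>D. coeff q n * (z - e) ^ n)" for z
  proof -
    have "(\<Sum>n\<le>D. c n * z ^ n) = poly q (z - e)"
      by (simp add: p_def q_def poly_pcompose poly_sum poly_monom)
    also have "\<dots> = (\<Sum>n\<le>degree q. coeff q n * (z - e) ^ n)" by (rule poly_altdef)
    also have "\<dots> = (\<Sum>n\<le>D. coeff q n * (z - e) ^ n)"
      using deg by (intro sum.mono_neutral_left) (auto simp: coeff_eq_0)
    finally show ?thesis .
  qed
  then show ?thesis by blast
qed

text \<open>Meant for the half period 0, whose coordinate is a constant over
  \<open>wp - ev 1\<close>: reversing the coefficients preserves the polynomials of degree at most
  \<open>D\<close>.\<close>

lemma polynomial_reverse:
  fixes w u :: complex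
  assumes "w * u = 1"
  shows "(\<Sum>n\<le>D. c n * w ^ n) = w ^ D * (\<Sum>n\<le>D. c (D - n) * u ^ n)"
proof -
  have "w ^ D * (\<Sum>n\<le>D. c (D - n) * u ^ n) = (\<Sum>n\<le>D. c (D - n) * w ^ (D - n))"
    unfolding sum_distrib_left
  proof (rule sum.cong)
    fix n assume "n \<in> {..D}"
    then have "w ^ D = w ^ (D - n) * w ^ n" by (simp flip: power_add)
    then have "w ^ D * u ^ n = w ^ (D - n) * (w * u) ^ n" by (simp add: power_mult_distrib)
    then show "w ^ D * (c (D - n) * u ^ n) = c (D - n) * w ^ (D - n)" using assms by (simp add: mult_ac)
  qed simp
  also have "\<dots> = (\<Sum>n\<le>D. c n * w ^ n)"
    by (rule sum.reindex_bij_witness[of _ "\<lambda>n. D - n" "\<lambda>n. D - n"]) auto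
  finally show ?thesis ..
qed

context lattice begin

lemma wp_shift:
  assumes "i \<in> {1..3}" "j \<in> {1..3}" "k \<in> {1..3}" "distinct [i, j, k]" "x \<notin> S"
  shows "wp (x + hp i) = ev i + (ev j - ev i) * (ev k - ev i) / (wp x - ev i)"
  using wp_shift_product[OF assms] wp_ne_e_val[OF assms(1,5)] by (simp add: field_simps)

lemma branch_derivative:
  assumes "branch_choice \<omega>1 \<omega>3 U L" "x \<in> U" "i \<in> {1..3}"
  shows "(L i has_field_derivative deriv wp x / (wp x - ev i)) (at x)"
proof -
  have U: "open U" "U \<inter> S = {}" and L: "log_branch U (\<lambda>x. wp x - ev i) (L i)"
    using assms by (auto simp: branch_choice_def)
  have hol: "(\<lambda>x. wp x - ev i) holomorphic_on U"
    using U lattice_subset_singular by (intro holomorphic_intros holomorphic_on_subset[OF wp_holomorphic]) auto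
  have Lh: "L i holomorphic_on U" "\<And>x. x \<in> U \<Longrightarrow> wp x - ev i = exp (L i x)"
    using L by (auto simp: log_branch_def)
  have xS: "x \<notin> S" using assms(2) U by auto
  then have "x \<notin> \<Lambda>" using lattice_subset_singular by auto
  have "deriv (\<lambda>x. wp x - ev i) x = deriv wp x"
    by (rule DERIV_imp_deriv) (auto intro!: derivative_eq_intros wp_derivs(1)[OF \<open>x \<notin> \<Lambda>\<close>])
  then have "deriv wp x = (wp x - ev i) * deriv (L i) x"
    using log_derivative_mult[OF hol Lh(1) U(1) assms(2) Lh(2)] by simp
  then have "deriv (L i) x = deriv wp x / (wp x - ev i)"
    using wp_ne_e_val[OF assms(3) xS] by simp
  then show ?thesis using holomorphic_derivI[OF Lh(1) U(1) assms(2)] by simp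
qed

lemma Phi_hat_derivative:
  assumes "branch_choice \<omega>1 \<omega>3 U L" "x \<in> U"
  shows "(Phi_hat \<beta> L has_field_derivative
    Phi_hat \<beta> L x * (\<Sum>i=1..3. \<beta> i / 2 * (deriv wp x / (wp x - ev i)))) (at x)"
proof -
  have Phi: "Phi_hat \<beta> L = (\<lambda>x. exp (\<Sum>i=1..3. \<beta> i / 2 * L i x))"
    by (simp add: Phi_hat_def[abs_def] exp_sum)
  have "((\<lambda>x. \<Sum>i=1..3. \<beta> i / 2 * L i x) has_field_derivative
      (\<Sum>i=1..3. \<beta> i / 2 * (deriv wp x / (wp x - ev i)))) (at x)"
    by (intro DERIV_sum DERIV_cmult branch_derivative[OF assms])
  then show ?thesis unfolding Phi by (rule DERIV_chain2[OF DERIV_exp])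
qed

lemma Phi_hat_nonzero: "Phi_hat \<beta> L x \<noteq> 0"
  by (simp add: Phi_hat_def)

text \<open>\<open>wp - ev k\<close> has its double zero at \<open>hp k\<close> and its pole at 0,
  so 0 takes the role of \<open>inf\<close>, and \<open>V\<close> only needs recentring of
  polynomials.\<close>

lemma chart_positive_index:
  assumes idx: "i \<in> {1..3}" "j \<in> {1..3}" "k \<in> {1..3}" "distinct [i, j, k]"
  shows "chart \<omega>1 \<omega>3 k 0 i j (\<lambda>x. wp x - ev k) (ev k) (ev i - ev k) (ev j - ev k) (\<lambda>\<beta> D. Phi_hat \<beta>)"
proof (unfold_locales)
  have cases: "k = 1 \<or> k = 2 \<or> k = 3" "i = 1 \<or> i = 2 \<or> i = 3" "j = 1 \<or> j = 2 \<or> j = 3" using idx by auto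
  have "{0..3::nat} = {0, 1, 2, 3}" by auto
  then show set4: "{0, k, i, j} = {0..3}" using cases idx(4) by auto
  have "{1..3::nat} = {1, 2, 3}" by auto
  then have set3: "{1..3} = {k, i, j}" using cases idx(4) by auto
  show "ev i - ev k \<noteq> 0" "ev j - ev k \<noteq> 0"
    using e_val_distinct[of i k] e_val_distinct[of j k] idx by auto
  show "(\<lambda>x. wp x - ev k) holomorphic_on - (S - {hp k})"
    by (intro holomorphic_intros holomorphic_on_subset[OF wp_holomorphic])
       (use lattice_subset_singular half_period_not_lattice[OF idx(3)] in auto)
  show "wp (hp k) - ev k = 0" by (simp add: e_val_def)
  show "wp x - ev k \<noteq> 0 \<and> wp x - ev k \<noteq> ev i - ev k \<and> wp x - ev k \<noteq> ev j - ev k" if "x \<notin> S" for x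
    using wp_ne_e_val[OF idx(1) that] wp_ne_e_val[OF idx(2) that] wp_ne_e_val[OF idx(3) that] by simp
  have der: "deriv (\<lambda>x. wp x - ev k) x = deriv wp x" if "x \<notin> \<Lambda>" for x
    by (rule DERIV_imp_deriv) (auto intro!: derivative_eq_intros wp_derivs(1)[OF that])
  show "(deriv (\<lambda>x. wp x - ev k) x)\<^sup>2 =
      4 * ((wp x - ev k) * (wp x - ev k - (ev i - ev k)) * (wp x - ev k - (ev j - ev k)))" if "x \<notin> S - {hp k}" for x
  proof -
    have x: "x \<notin> \<Lambda>" using that lattice_subset_singular half_period_not_lattice[OF idx(3)] by auto
    have "(wp x - ev 1) * (wp x - ev 2) * (wp x - ev 3) = (wp x - ev k) * (wp x - ev i) * (wp x - ev j)"
      using cases idx(4) by (elim disjE) (auto simp: mult_ac)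
    moreover have "(deriv wp x)\<^sup>2 = 4 * ((wp x - ev 1) * (wp x - ev 2) * (wp x - ev 3))"
      using wp_ode[OF x] by (simp only: mult.assoc)
    moreover have "wp x - ev k - (ev i - ev k) = wp x - ev i" "wp x - ev k - (ev j - ev k) = wp x - ev j"
      by simp_all
    ultimately show ?thesis by (simp only: der[OF x])
  qed
  show "(\<Sum>m=0..3. \<mu> m * wp (x + hp m)) =
      \<mu> 0 * (wp x - ev k + ev k) + \<mu> k * (ev k + (ev i - ev k) * (ev j - ev k) / (wp x - ev k)) +
      \<mu> i * (ev k + (ev i - ev k) + (ev i - ev k) * (ev i - ev k - (ev j - ev k)) / (wp x - ev k - (ev i - ev k))) +
      \<mu> j * (ev k + (ev j - ev k) + (ev j - ev k) * (ev j - ev k - (ev i - ev k)) / (wp x - ev k - (ev j - ev k)))"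
    if x: "x \<notin> S" for x \<mu>
  proof -
    have s: "wp (x + hp 0) = wp x" by (simp add: half_period_def)
    have sk: "wp (x + hp k) = ev k + (ev i - ev k) * (ev j - ev k) / (wp x - ev k)"
      by (rule wp_shift) (use idx x in auto)
    have si: "wp (x + hp i) = ev i + (ev k - ev i) * (ev j - ev i) / (wp x - ev i)"
      by (rule wp_shift) (use idx x in auto)
    have sj: "wp (x + hp j) = ev j + (ev k - ev j) * (ev i - ev j) / (wp x - ev j)"
      by (rule wp_shift) (use idx x in auto)
    have "(ev k - ev i) * (ev j - ev i) = (ev i - ev k) * (ev i - ev j)"
      "(ev k - ev j) * (ev i - ev j) = (ev j - ev k) * (ev j - ev i)" by (simp_all add: algebra_simps)
    then show ?thesis unfolding sum_four[OF set4] s sk si sj by simp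
  qed
  show "\<exists>c'. \<forall>U L. branch_choice \<omega>1 \<omega>3 U L \<longrightarrow> (\<forall>x\<in>U.
      (\<Sum>n=0..D. c n * (Phi_hat \<beta> L x * wp x ^ n)) = Phi_hat \<beta> L x * (\<Sum>n\<le>D. c' n * (wp x - ev k) ^ n))"
    for \<beta> D c
  proof -
    obtain c' where c': "\<And>z. (\<Sum>n\<le>D. c n * z ^ n) = (\<Sum>n\<le>D. c' n * (z - ev k) ^ n)"
      using polynomial_recentre[where c = c and D = D and e = "ev k"] by blast
    then show ?thesis
      by (intro exI[of _ c']) (simp add: c'[symmetric] sum_distrib_left atLeast0AtMost mult_ac)
  qed
  show "\<exists>c. \<forall>U L. branch_choice \<omega>1 \<omega>3 U L \<longrightarrow> (\<forall>x\<in>U.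
      (\<Sum>n=0..D. c n * (Phi_hat \<beta> L x * wp x ^ n)) = Phi_hat \<beta> L x * (\<Sum>n\<le>D. c' n * (wp x - ev k) ^ n))"
    for \<beta> D c'
  proof -
    obtain c where c: "\<And>z. (\<Sum>n\<le>D. c' n * z ^ n) = (\<Sum>n\<le>D. c n * (z - (- ev k)) ^ n)"
      using polynomial_recentre[where c = c' and D = D and e = "- ev k"] by blast
    then show ?thesis
      by (intro exI[of _ c]) (simp add: c sum_distrib_left atLeast0AtMost mult_ac)
  qed
  show "Phi_hat \<beta> L x \<noteq> 0" for \<beta> L x by (rule Phi_hat_nonzero)
  show "(Phi_hat \<beta> L has_field_derivative Phi_hat \<beta> L x *
      (\<beta> k / 2 / (wp x - ev k) + \<beta> i / 2 / (wp x - ev k - (ev i - ev k)) + \<beta> j / 2 / (wp x - ev k - (ev j - ev k)))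
      * deriv (\<lambda>x. wp x - ev k) x) (at x)"
    if "branch_choice \<omega>1 \<omega>3 U L" "x \<in> U" for \<beta> U L x
  proof -
    have "x \<notin> S" using that by (auto simp: branch_choice_def)
    then have x: "x \<notin> \<Lambda>" using lattice_subset_singular by auto
    have "(\<Sum>m=1..3. \<beta> m / 2 * (deriv wp x / (wp x - ev m))) =
      (\<beta> k / 2 / (wp x - ev k) + \<beta> i / 2 / (wp x - ev i) + \<beta> j / 2 / (wp x - ev j)) * deriv wp x"
      unfolding set3 using idx(4) by (simp add: algebra_simps)
    then show ?thesis using Phi_hat_derivative[OF that, of \<beta>] unfolding der[OF x] by (simp add: mult.assoc)
  qed
qed

text \<open>\<open>wp\<close> has its pole at 0, so the coordinate is translated by
  \<open>\<omega>1\<close>, which gives \<open>v = a b / (wp - ev 1)\<close>. The translation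
  exchanges 0 with 1 and 2 with 3; hence \<open>v\<close> takes the value \<open>ev 3 - ev 1\<close>
  at the half period 2. Reversing polynomials of degree \<open>D\<close> moves
  \<open>(wp - ev 1)^D\<close> into \<open>Psi\<close>.\<close>

lemma chart_zero_index:
  "chart \<omega>1 \<omega>3 0 1 2 3 (\<lambda>x. wp (x + hp 1) - ev 1) (ev 1) (ev 3 - ev 1) (ev 2 - ev 1)
    (\<lambda>\<beta> D L x. Phi_hat \<beta> L x * (wp x - ev 1) ^ D)"
proof (unfold_locales)
  define v where "v = (\<lambda>x. wp (x + hp 1) - ev 1)"
  define a b where "a = ev 3 - ev 1" and "b = ev 2 - ev 1"
  have ab: "a \<noteq> 0" "b \<noteq> 0" using e_val_distinct[of 3 1] e_val_distinct[of 2 1] by (simp_all add: a_def b_def)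
  show set4: "{1, 0, 2, 3} = {0..3::nat}" by auto
  show "ev 3 - ev 1 \<noteq> 0" "ev 2 - ev 1 \<noteq> 0" using ab by (simp_all add: a_def b_def)
  have hp0: "hp 0 = 0" by (simp add: half_period_def)
  have shiftS: "x + hp 1 \<notin> S" if "x \<notin> S" for x
    using that shift_half_period_singular_iff[of 1 x] by simp
  have shiftL: "x + hp 1 \<notin> \<Lambda>" if "x \<notin> S - {hp 0}" for x
    using that shiftS[of x] lattice_subset_singular half_period_not_lattice[of 1] by (cases "x = 0") (auto simp: hp0)
  have dv: "(v has_field_derivative deriv wp (x + hp 1)) (at x)" if "x \<notin> S - {hp 0}" for x
  proof -
    have "((\<lambda>x. wp (x + hp 1)) has_field_derivative deriv wp (x + hp 1)) (at x)"
      using wp_derivs(1)[OF shiftL[OF that]] by (simp add: DERIV_shift)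
    then show ?thesis unfolding v_def by (auto intro!: derivative_eq_intros)
  qed
  have "open (- (S - {hp 0}))" by (rule open_Compl_singular_subset) auto
  moreover have "\<exists>f'. (v has_field_derivative f') (at x)" if "x \<in> - (S - {hp 0})" for x
    using dv[of x] that by blast
  ultimately have "v holomorphic_on - (S - {hp 0})" by (simp only: holomorphic_on_open) blast
  then show "(\<lambda>x. wp (x + hp 1) - ev 1) holomorphic_on - (S - {hp 0})" unfolding v_def .
  show "wp (hp 0 + hp 1) - ev 1 = 0" by (simp add: hp0 e_val_def)
  have ne: "v x \<noteq> 0 \<and> v x \<noteq> a \<and> v x \<noteq> b" if "x \<notin> S" for x
    using wp_ne_e_val[OF _ shiftS[OF that], of 1] wp_ne_e_val[OF _ shiftS[OF that], of 2]
      wp_ne_e_val[OF _ shiftS[OF that], of 3] by (simp add: v_def a_def b_def)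
  then show "wp (x + hp 1) - ev 1 \<noteq> 0 \<and> wp (x + hp 1) - ev 1 \<noteq> ev 3 - ev 1 \<and> wp (x + hp 1) - ev 1 \<noteq> ev 2 - ev 1"
    if "x \<notin> S" for x using that by (simp add: v_def a_def b_def)
  show "(deriv (\<lambda>x. wp (x + hp 1) - ev 1) x)\<^sup>2 = 4 * ((wp (x + hp 1) - ev 1) *
      (wp (x + hp 1) - ev 1 - (ev 3 - ev 1)) * (wp (x + hp 1) - ev 1 - (ev 2 - ev 1)))" if "x \<notin> S - {hp 0}" for x
  proof -
    have "deriv (\<lambda>x. wp (x + hp 1) - ev 1) x = deriv wp (x + hp 1)"
      using DERIV_imp_deriv[OF dv[OF that]] unfolding v_def .
    moreover have "4 * (wp (x + hp 1) - ev 1) * (wp (x + hp 1) - ev 2) * (wp (x + hp 1) - ev 3) =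
      4 * ((wp (x + hp 1) - ev 1) * (wp (x + hp 1) - ev 3) * (wp (x + hp 1) - ev 2))"
      by (simp only: mult_ac)
    moreover have "wp (x + hp 1) - ev 1 - (ev m - ev 1) = wp (x + hp 1) - ev m" for m by simp
    ultimately show ?thesis using wp_ode[OF shiftL[OF that]] by (simp only:)
  qed
  have inv: "wp x = ev 1 + a * b / v x" if "x \<notin> S" for x
  proof -
    have "wp (x + 2 * hp 1) = wp x" by (rule wp_periodic[OF lattice_twice]) simp
    then have "wp x = wp (x + hp 1 + hp 1)" by (simp only: mult_2 add.assoc)
    also have "wp (x + hp 1 + hp 1) = ev 1 + (ev 3 - ev 1) * (ev 2 - ev 1) / (wp (x + hp 1) - ev 1)"
      by (rule wp_shift) (use shiftS[OF that] in auto)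
    finally show ?thesis unfolding v_def a_def b_def .
  qed
  show "(\<Sum>m=0..3. \<mu> m * wp (x + hp m)) =
      \<mu> 1 * (wp (x + hp 1) - ev 1 + ev 1) + \<mu> 0 * (ev 1 + (ev 3 - ev 1) * (ev 2 - ev 1) / (wp (x + hp 1) - ev 1)) +
      \<mu> 2 * (ev 1 + (ev 3 - ev 1) + (ev 3 - ev 1) * (ev 3 - ev 1 - (ev 2 - ev 1)) / (wp (x + hp 1) - ev 1 - (ev 3 - ev 1))) +
      \<mu> 3 * (ev 1 + (ev 2 - ev 1) + (ev 2 - ev 1) * (ev 2 - ev 1 - (ev 3 - ev 1)) / (wp (x + hp 1) - ev 1 - (ev 2 - ev 1)))"
    if x: "x \<notin> S" for x \<mu>
  proof -
    \<comment> \<open>\<open>hp 1 + hp j\<close> is \<open>- hp i\<close>, which differs from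
      \<open>hp i\<close> by a period.\<close>
    have per: "wp (x + hp i) = wp (x + hp 1 + hp j)" if "i \<in> {1..3}" "j \<in> {1..3}" "distinct [1, j, i]" for i j
    proof -
      have "hp 1 + hp j = - hp i" using half_period_sum[of 1 j i] that by auto
      then have "x + hp 1 + hp j + 2 * hp i = x + hp i" by (simp add: add.assoc)
      moreover have "wp (x + hp 1 + hp j + 2 * hp i) = wp (x + hp 1 + hp j)"
        by (rule wp_periodic[OF lattice_twice]) (use that in auto)
      ultimately show ?thesis by (simp only:)
    qed
    have s2: "wp (x + hp 2) = ev 3 + (ev 1 - ev 3) * (ev 2 - ev 3) / (wp (x + hp 1) - ev 3)"
      using per[of 2 3] wp_shift[of 3 1 2 "x + hp 1"] shiftS[OF x] by simp
    have s3: "wp (x + hp 3) = ev 2 + (ev 1 - ev 2) * (ev 3 - ev 2) / (wp (x + hp 1) - ev 2)"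
      using per[of 3 2] wp_shift[of 2 1 3 "x + hp 1"] shiftS[OF x] by simp
    have s0: "wp (x + hp 0) = ev 1 + (ev 3 - ev 1) * (ev 2 - ev 1) / (wp (x + hp 1) - ev 1)"
      using inv[OF x] by (simp add: hp0 v_def a_def b_def)
    have "(ev 1 - ev 3) * (ev 2 - ev 3) = (ev 3 - ev 1) * (ev 3 - ev 2)"
      "(ev 1 - ev 2) * (ev 3 - ev 2) = (ev 2 - ev 1) * (ev 2 - ev 3)" by (simp_all add: algebra_simps)
    then show ?thesis unfolding sum_four[OF set4] s0 s2 s3 by simp
  qed
  have rev: "(\<Sum>n\<le>D. c n * (wp x - ev 1) ^ n) = (wp x - ev 1) ^ D * (\<Sum>n\<le>D. c (D - n) / (a * b) ^ n * v x ^ n)"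
    if "x \<notin> S" for x c D
  proof -
    have "(wp x - ev 1) * (v x / (a * b)) = 1" using inv[OF that] ne[OF that] ab by simp
    from polynomial_reverse[OF this, of c D] show ?thesis by (simp add: power_divide)
  qed
  have xS: "x \<notin> S" if "branch_choice \<omega>1 \<omega>3 U L" "x \<in> U" for U L x
    using that by (auto simp: branch_choice_def)
  show "\<exists>c'. \<forall>U L. branch_choice \<omega>1 \<omega>3 U L \<longrightarrow> (\<forall>x\<in>U.
      (\<Sum>n=0..D. c n * (Phi_hat \<beta> L x * wp x ^ n)) =
      Phi_hat \<beta> L x * (wp x - ev 1) ^ D * (\<Sum>n\<le>D. c' n * (wp (x + hp 1) - ev 1) ^ n))" for \<beta> D c
  proof -
    obtain c' where c': "\<And>z. (\<Sum>n\<le>D. c n * z ^ n) = (\<Sum>n\<le>D. c' n * (z - ev 1) ^ n)"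
      using polynomial_recentre[where c = c and D = D and e = "ev 1"] by blast
    have "(\<Sum>n=0..D. c n * (Phi_hat \<beta> L x * wp x ^ n)) =
      Phi_hat \<beta> L x * (wp x - ev 1) ^ D * (\<Sum>n\<le>D. c' (D - n) / (a * b) ^ n * v x ^ n)"
      if "branch_choice \<omega>1 \<omega>3 U L" "x \<in> U" for U L x
    proof -
      have "(\<Sum>n=0..D. c n * (Phi_hat \<beta> L x * wp x ^ n)) = Phi_hat \<beta> L x * (\<Sum>n\<le>D. c n * wp x ^ n)"
        by (simp add: sum_distrib_left atLeast0AtMost mult_ac)
      then show ?thesis unfolding c' rev[OF xS[OF that]] by (simp only: mult.assoc)
    qed
    then show ?thesis unfolding v_def by (intro exI[of _ "\<lambda>n. c' (D - n) / (a * b) ^ n"]) blast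
  qed
  show "\<exists>c. \<forall>U L. branch_choice \<omega>1 \<omega>3 U L \<longrightarrow> (\<forall>x\<in>U.
      (\<Sum>n=0..D. c n * (Phi_hat \<beta> L x * wp x ^ n)) =
      Phi_hat \<beta> L x * (wp x - ev 1) ^ D * (\<Sum>n\<le>D. c' n * (wp (x + hp 1) - ev 1) ^ n))" for \<beta> D c'
  proof -
    define c1 where "c1 = (\<lambda>n. c' (D - n) * (a * b) ^ (D - n))"
    obtain c where c: "\<And>z. (\<Sum>n\<le>D. c1 n * z ^ n) = (\<Sum>n\<le>D. c n * (z - (- ev 1)) ^ n)"
      using polynomial_recentre[where c = c1 and D = D and e = "- ev 1"] by blast
    have "(\<Sum>n=0..D. c n * (Phi_hat \<beta> L x * wp x ^ n)) =
      Phi_hat \<beta> L x * (wp x - ev 1) ^ D * (\<Sum>n\<le>D. c' n * v x ^ n)"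
      if "branch_choice \<omega>1 \<omega>3 U L" "x \<in> U" for U L x
    proof -
      have "(\<Sum>n=0..D. c n * (Phi_hat \<beta> L x * wp x ^ n)) = Phi_hat \<beta> L x * (\<Sum>n\<le>D. c n * wp x ^ n)"
        by (simp add: sum_distrib_left atLeast0AtMost mult_ac)
      also have "(\<Sum>n\<le>D. c n * wp x ^ n) = (\<Sum>n\<le>D. c1 n * (wp x - ev 1) ^ n)"
        unfolding c by simp
      also have "\<dots> = (wp x - ev 1) ^ D * (\<Sum>n\<le>D. c' n * v x ^ n)"
        unfolding rev[OF xS[OF that]] using ab by (simp add: c1_def)
      finally show ?thesis by (simp only: mult.assoc)
    qed
    then show ?thesis unfolding v_def by (intro exI[of _ c]) blast
  qed
  show "Phi_hat \<beta> L x * (wp x - ev 1) ^ D \<noteq> 0" if "branch_choice \<omega>1 \<omega>3 U L" "x \<in> U" for \<beta> D U L x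
    using Phi_hat_nonzero[of \<beta> L x] wp_ne_e_val[OF _ xS[OF that], of 1] by simp
  show "((\<lambda>x. Phi_hat \<beta> L x * (wp x - ev 1) ^ D) has_field_derivative Phi_hat \<beta> L x * (wp x - ev 1) ^ D *
      (\<beta> 0 / 2 / (wp (x + hp 1) - ev 1) + \<beta> 2 / 2 / (wp (x + hp 1) - ev 1 - (ev 3 - ev 1))
        + \<beta> 3 / 2 / (wp (x + hp 1) - ev 1 - (ev 2 - ev 1))) * deriv (\<lambda>x. wp (x + hp 1) - ev 1) x) (at x)"
    if D: "of_nat D = - (\<Sum>i=0..3. \<beta> i / 2)" and B: "branch_choice \<omega>1 \<omega>3 U L" "x \<in> U" for \<beta> D U L x
  proof -
    have x: "x \<notin> S" by (rule xS[OF B])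
    then have xL: "x \<notin> \<Lambda>" using lattice_subset_singular by auto
    define w where "w = wp x - ev 1"
    define v' where "v' = deriv v x"
    have nv: "v x \<noteq> 0" "v x - a \<noteq> 0" "v x - b \<noteq> 0" using ne[OF x] by auto
    have w: "w = a * b / v x" using inv[OF x] by (simp add: w_def)
    then have w0: "w \<noteq> 0" using nv ab by simp
    have vd: "(v has_field_derivative v') (at x)" using dv[of x] x by (simp add: v'_def DERIV_imp_deriv)
    have w': "deriv wp x = - (a * b * v' / (v x)\<^sup>2)"
    proof (rule DERIV_imp_deriv, rule has_field_derivative_transform_within_open[OF _ Compl_singular_open])
      show "((\<lambda>x. ev 1 + a * b / v x) has_field_derivative - (a * b * v' / (v x)\<^sup>2)) (at x)"
        using nv(1) by (auto intro!: derivative_eq_intros vd simp: power2_eq_square)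
    qed (use x inv in auto)
    have q1: "deriv wp x / (wp x - ev 1) = - (v' / v x)"
      unfolding w_def[symmetric] unfolding w w' using nv ab by (simp add: power2_eq_square)
    have "wp x - ev 2 = w - b" "wp x - ev 3 = w - a" by (simp_all add: w_def a_def b_def)
    then have wab: "wp x - ev 2 = - (b * (v x - a)) / v x" "wp x - ev 3 = - (a * (v x - b)) / v x"
      unfolding w using nv by (simp_all add: field_simps)
    have q2: "deriv wp x / (wp x - ev 2) = v' / (v x - a) - v' / v x"
      unfolding wab w' using nv ab by (simp add: divide_simps power2_eq_square) (simp add: algebra_simps)
    have q3: "deriv wp x / (wp x - ev 3) = v' / (v x - b) - v' / v x"
      unfolding wab w' using nv ab by (simp add: divide_simps power2_eq_square) (simp add: algebra_simps)
    have "{1..3::nat} = {1, 2, 3}" by auto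
    then have exp3: "(\<Sum>i=1..3. f i) = f 1 + f 2 + f 3" for f :: "nat \<Rightarrow> complex" by (simp add: add.assoc)
    have sum3: "(\<Sum>i=1..3. \<beta> i / 2 * (deriv wp x / (wp x - ev i))) =
      \<beta> 1 / 2 * (- (v' / v x)) + \<beta> 2 / 2 * (v' / (v x - a) - v' / v x) + \<beta> 3 / 2 * (v' / (v x - b) - v' / v x)"
      unfolding exp3 q1 q2 q3 ..
    have pw: "((\<lambda>x. (wp x - ev 1) ^ D) has_field_derivative w ^ D * (of_nat D * (- (v' / v x)))) (at x)"
    proof -
      have "((\<lambda>x. (wp x - ev 1) ^ D) has_field_derivative of_nat D * (w ^ (D - 1) * deriv wp x)) (at x)"
        unfolding w_def by (auto intro!: derivative_eq_intros wp_derivs(1)[OF xL])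
      moreover have "of_nat D * (w ^ (D - 1) * deriv wp x) = w ^ D * (of_nat D * (- (v' / v x)))"
        unfolding q1[symmetric] w_def[symmetric] using w0 by (cases D) simp_all
      ultimately show ?thesis by simp
    qed
    \<comment> \<open>Each \<open>wp - ev i\<close>, as a function of \<open>v\<close>, has a simple
      pole at \<open>v = 0\<close>, so the exponent of \<open>Psi\<close> there is minus the sum of
      \<open>D\<close> and the three \<open>\<beta> i / 2\<close>. By the definition of
      \<open>D\<close> this is \<open>\<beta> 0 / 2\<close>.\<close>
    have b0: "\<beta> 0 / 2 = - of_nat D - \<beta> 1 / 2 - \<beta> 2 / 2 - \<beta> 3 / 2"
      unfolding D sum_four[OF set4] by simp
    have "z / v x * v' = z * (v' / v x)" for z by simp
    from this[of "\<beta> 0 / 2"]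
    have \<beta>0: "\<beta> 0 / 2 / v x * v' = (- of_nat D - \<beta> 1 / 2 - \<beta> 2 / 2 - \<beta> 3 / 2) * (v' / v x)"
      unfolding b0 .
    have tot: "\<beta> 1 / 2 * (- (v' / v x)) + \<beta> 2 / 2 * (v' / (v x - a) - v' / v x) + \<beta> 3 / 2 * (v' / (v x - b) - v' / v x)
        + of_nat D * (- (v' / v x)) = (\<beta> 0 / 2 / v x + \<beta> 2 / 2 / (v x - a) + \<beta> 3 / 2 / (v x - b)) * v'"
      unfolding distrib_right \<beta>0 by (simp add: algebra_simps)
    have "((\<lambda>x. Phi_hat \<beta> L x * (wp x - ev 1) ^ D) has_field_derivative
      Phi_hat \<beta> L x * w ^ D * (\<beta> 1 / 2 * (- (v' / v x)) + \<beta> 2 / 2 * (v' / (v x - a) - v' / v x)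
        + \<beta> 3 / 2 * (v' / (v x - b) - v' / v x) + of_nat D * (- (v' / v x)))) (at x)"
      by (rule DERIV_cong[OF DERIV_mult[OF Phi_hat_derivative[OF B, of \<beta>, unfolded sum3] pw]])
         (simp add: w_def algebra_simps)
    then show ?thesis unfolding tot by (simp add: w_def v'_def v_def a_def b_def mult.assoc)
  qed
qed

lemma apparent_iff_V_solution:
  fixes \<alpha> l M :: "nat \<Rightarrow> complex"
  assumes k: "k \<in> {0..3}"
    and l: "\<And>i. i \<in> {0..3} \<Longrightarrow> l i * (l i + 1) = \<alpha> i * (\<alpha> i - 1)"
    and M: "\<And>i. i \<in> {0..3} \<Longrightarrow> M i * (M i + 1) = (\<alpha> i + d) * (\<alpha> i + d + 1)"
    and d: "d = - (\<Sum>i=0..3. \<alpha> i / 2)" "d \<notin> \<int>"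
    and \<alpha>k: "\<alpha> k - 3 / 2 \<in> \<nat>" and lk: "l k - 1 / 2 \<in> \<int>"
  shows "apparent_singularity \<omega>1 \<omega>3 l E k \<longleftrightarrow>
    has_nonzero_solution_in_V \<omega>1 \<omega>3 M E (\<lambda>i. if i = k then - \<alpha> i - d else \<alpha> i + d + 1)"
proof -
  have "\<exists>inf iA iB v \<epsilon> a b Psi. chart \<omega>1 \<omega>3 k inf iA iB v \<epsilon> a b Psi"
  proof (cases "k = 0")
    case True
    then show ?thesis using chart_zero_index by blast
  next
    case False
    then have "k = 1 \<or> k = 2 \<or> k = 3" using k by auto
    then have "\<exists>i j. i \<in> {1..3} \<and> j \<in> {1..3} \<and> k \<in> {1..3} \<and> distinct [i, j, k]"
      by (elim disjE) (simp_all add: numeral_eq_Suc, presburger+)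
    then show ?thesis using chart_positive_index by blast
  qed
  then obtain inf iA iB v \<epsilon> a b Psi where "chart \<omega>1 \<omega>3 k inf iA iB v \<epsilon> a b Psi" by blast
  then show ?thesis using l M d \<alpha>k lk by (rule chart.apparent_iff_V_solution)
qed

end

section \<open>Symmetries relating the four parts\<close>

theorem proposition6p8:
  fixes \<omega>1 \<omega>3 E d :: complex and l \<alpha> :: "nat \<Rightarrow> complex"
  assumes "Im (\<omega>3 / \<omega>1) \<noteq> 0"
    and "\<And>i. i \<in> {0..3} \<Longrightarrow> \<alpha> i \<in> {- l i, l i + 1}"
    and "d = - (\<Sum>i=0..3. \<alpha> i / 2)"
  shows
    "(\<forall>k\<in>{0..3}.
        \<alpha> k - 3/2 \<in> \<nat> \<and>
        d \<notin> \<int> \<and>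
        apparent_singularity \<omega>1 \<omega>3 l E k
        \<longrightarrow> has_nonzero_solution_in_V \<omega>1 \<omega>3 (\<lambda>i. \<alpha> i + d) E
              (\<lambda>i. if i = k then - \<alpha> i - d else \<alpha> i + d + 1))
   \<and> (\<forall>k\<in>{0..3}.
        \<alpha> k + 1/2 \<in> \<int>\<^sub>\<le>\<^sub>0 \<and>
        (\<forall>i\<in>{0..3} - {k}. \<alpha> i + d - 1/2 \<notin> \<int>) \<and>
        d \<notin> \<int> \<and>
        apparent_singularity \<omega>1 \<omega>3 l E k
        \<longrightarrow> has_nonzero_solution_in_V \<omega>1 \<omega>3 (\<lambda>i. \<alpha> i + d) E
              (\<lambda>i. if i = k then \<alpha> i + d + 1 else - \<alpha> i - d))
   \<and> (\<forall>k\<in>{0..3}.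
        \<alpha> k + d - 1/2 \<in> \<nat> \<and>
        (\<forall>i\<in>{0..3} - {k}. l i - 1/2 \<notin> \<int>) \<and>
        d \<notin> \<int> \<and>
        has_nonzero_solution_in_V \<omega>1 \<omega>3 l E (\<lambda>i. if i = k then 1 - \<alpha> i else \<alpha> i)
        \<longrightarrow> apparent_singularity \<omega>1 \<omega>3 (\<lambda>i. \<alpha> i + d) E k)
   \<and> (\<forall>k\<in>{0..3}.
        \<alpha> k + d + 3/2 \<in> \<int>\<^sub>\<le>\<^sub>0 \<and>
        (\<forall>i\<in>{0..3} - {k}. l i - 1/2 \<notin> \<int>) \<and>
        d \<notin> \<int> \<and>
        has_nonzero_solution_in_V \<omega>1 \<omega>3 l E (\<lambda>i. if i = k then \<alpha> i else 1 - \<alpha> i)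
        \<longrightarrow> apparent_singularity \<omega>1 \<omega>3 (\<lambda>i. \<alpha> i + d) E k)"
proof -
  interpret lattice \<omega>1 \<omega>3 by unfold_locales (rule assms(1))
  have l: "l i * (l i + 1) = \<alpha> i * (\<alpha> i - 1)" if "i \<in> {0..3}" for i
    using assms(2)[OF that] by (auto simp: algebra_simps)
  have sum\<alpha>: "(\<Sum>i=0..3. \<alpha> i / 2) = - d" using assms(3) by simp
  have nonpos: "- z \<in> \<nat>" if "z \<in> \<int>\<^sub>\<le>\<^sub>0" for z :: complex
    using that by (auto elim!: nonpos_Ints_cases')
  have d'Z: "- 2 - d \<notin> \<int>" if "d \<notin> \<int>"
  proof
    assume "- 2 - d \<in> \<int>"
    then have "- 2 - (- 2 - d) \<in> \<int>" by (intro Ints_diff) auto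
    then show False using that by simp
  qed
  have "has_nonzero_solution_in_V \<omega>1 \<omega>3 (\<lambda>i. \<alpha> i + d) E (\<lambda>i. if i = k then - \<alpha> i - d else \<alpha> i + d + 1)"
    if k: "k \<in> {0..3}" and h: "\<alpha> k - 3/2 \<in> \<nat>" "d \<notin> \<int>" "apparent_singularity \<omega>1 \<omega>3 l E k" for k
  proof -
    have "l k - 1/2 \<in> \<int>" using h(3) by (simp add: apparent_singularity_def)
    from apparent_iff_V_solution[OF k l _ assms(3) h(2,1) this, of "\<lambda>i. \<alpha> i + d" E] h(3)
    show ?thesis by simp
  qed
  moreover have "has_nonzero_solution_in_V \<omega>1 \<omega>3 (\<lambda>i. \<alpha> i + d) E (\<lambda>i. if i = k then \<alpha> i + d + 1 else - \<alpha> i - d)"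
    if k: "k \<in> {0..3}" and h: "\<alpha> k + 1/2 \<in> \<int>\<^sub>\<le>\<^sub>0" "d \<notin> \<int>" "apparent_singularity \<omega>1 \<omega>3 l E k" for k
  proof -
    have lk: "l k - 1/2 \<in> \<int>" using h(3) by (simp add: apparent_singularity_def)
    \<comment> \<open>For \<open>1 - \<alpha>\<close> the sum condition turns \<open>d\<close> into
      \<open>- 2 - d\<close>, and \<open>\<alpha> + d\<close> becomes
      \<open>- 1 - (\<alpha> + d)\<close>, so both equations stay the same.\<close>
    have "apparent_singularity \<omega>1 \<omega>3 l E k \<longleftrightarrow> has_nonzero_solution_in_V \<omega>1 \<omega>3 (\<lambda>i. \<alpha> i + d) E
      (\<lambda>i. if i = k then - (1 - \<alpha> i) - (- 2 - d) else 1 - \<alpha> i + (- 2 - d) + 1)"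
    proof (rule apparent_iff_V_solution[OF k])
      show "l i * (l i + 1) = (1 - \<alpha> i) * (1 - \<alpha> i - 1)" if "i \<in> {0..3}" for i
        using l[OF that] by (simp add: algebra_simps)
      show "- 2 - d = - (\<Sum>i=0..3. (1 - \<alpha> i) / 2)"
        by (simp add: diff_divide_distrib sum_subtractf sum\<alpha>)
      show "1 - \<alpha> k - 3 / 2 \<in> \<nat>" using nonpos[OF h(1)] by (simp add: algebra_simps)
    qed (use lk d'Z[OF h(2)] in \<open>simp_all add: algebra_simps\<close>)
    moreover have "(\<lambda>i. if i = k then - (1 - \<alpha> i) - (- 2 - d) else 1 - \<alpha> i + (- 2 - d) + 1)
      = (\<lambda>i. if i = k then \<alpha> i + d + 1 else - \<alpha> i - d)" by (rule ext) simp
    ultimately show ?thesis using h(3) by simp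
  qed
  moreover have "apparent_singularity \<omega>1 \<omega>3 (\<lambda>i. \<alpha> i + d) E k"
    if k: "k \<in> {0..3}" and h: "\<alpha> k + d - 1/2 \<in> \<nat>" "d \<notin> \<int>"
      "has_nonzero_solution_in_V \<omega>1 \<omega>3 l E (\<lambda>i. if i = k then 1 - \<alpha> i else \<alpha> i)" for k
  proof -
    \<comment> \<open>For \<open>\<alpha> + d + 1\<close> the sum condition again gives
      \<open>- 2 - d\<close>. The shifted parameters are \<open>\<alpha> - 1\<close>, with the
      coupling constants of (A): the two equations change places.\<close>
    have "apparent_singularity \<omega>1 \<omega>3 (\<lambda>i. \<alpha> i + d) E k \<longleftrightarrow> has_nonzero_solution_in_V \<omega>1 \<omega>3 l E
      (\<lambda>i. if i = k then - (\<alpha> i + d + 1) - (- 2 - d) else \<alpha> i + d + 1 + (- 2 - d) + 1)"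
    proof (rule apparent_iff_V_solution[OF k])
      show "l i * (l i + 1) = (\<alpha> i + d + 1 + (- 2 - d)) * (\<alpha> i + d + 1 + (- 2 - d) + 1)" if "i \<in> {0..3}" for i
        using l[OF that] by (simp add: algebra_simps)
      show "- 2 - d = - (\<Sum>i=0..3. (\<alpha> i + d + 1) / 2)"
        by (simp add: add_divide_distrib sum.distrib sum\<alpha>)
      show "\<alpha> k + d + 1 - 3 / 2 \<in> \<nat>" using h(1) by simp
      show "\<alpha> k + d - 1 / 2 \<in> \<int>" using h(1) Nats_subset_Ints by blast
    qed (use d'Z[OF h(2)] in \<open>simp_all add: algebra_simps\<close>)
    moreover have "(\<lambda>i. if i = k then - (\<alpha> i + d + 1) - (- 2 - d) else \<alpha> i + d + 1 + (- 2 - d) + 1)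
      = (\<lambda>i. if i = k then 1 - \<alpha> i else \<alpha> i)" by (rule ext) simp
    ultimately show ?thesis using h(3) by simp
  qed
  moreover have "apparent_singularity \<omega>1 \<omega>3 (\<lambda>i. \<alpha> i + d) E k"
    if k: "k \<in> {0..3}" and h: "\<alpha> k + d + 3/2 \<in> \<int>\<^sub>\<le>\<^sub>0" "d \<notin> \<int>"
      "has_nonzero_solution_in_V \<omega>1 \<omega>3 l E (\<lambda>i. if i = k then \<alpha> i else 1 - \<alpha> i)" for k
  proof -
    have nat: "- (\<alpha> k + d + 3/2) \<in> \<nat>" by (rule nonpos[OF h(1)])
    \<comment> \<open>For \<open>- \<alpha> - d\<close> the sum condition gives back
      \<open>d\<close>. The shifted parameters are \<open>- \<alpha>\<close>, and again the two
      equations change places.\<close>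
    have "apparent_singularity \<omega>1 \<omega>3 (\<lambda>i. \<alpha> i + d) E k \<longleftrightarrow> has_nonzero_solution_in_V \<omega>1 \<omega>3 l E
      (\<lambda>i. if i = k then - (- \<alpha> i - d) - d else - \<alpha> i - d + d + 1)"
    proof (rule apparent_iff_V_solution[OF k])
      show "l i * (l i + 1) = (- \<alpha> i - d + d) * (- \<alpha> i - d + d + 1)" if "i \<in> {0..3}" for i
        using l[OF that] by (simp add: algebra_simps)
      show "d = - (\<Sum>i=0..3. (- \<alpha> i - d) / 2)"
        by (simp add: diff_divide_distrib sum_subtractf sum_negf sum\<alpha>)
      have "- \<alpha> k - d - 3 / 2 = - (\<alpha> k + d + 3/2)" by simp
      with nat show "- \<alpha> k - d - 3 / 2 \<in> \<nat>" by (simp only:)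
      have "- (\<alpha> k + d + 3/2) \<in> \<int>" using nat Nats_subset_Ints by blast
      then have "- (- (\<alpha> k + d + 3/2)) - 2 \<in> \<int>" by (rule Ints_diff[OF Ints_minus Ints_numeral])
      moreover have "- (- (\<alpha> k + d + 3/2)) - 2 = \<alpha> k + d - 1 / 2" by simp
      ultimately show "\<alpha> k + d - 1 / 2 \<in> \<int>" by (simp only:)
    qed (use h(2) in \<open>simp_all add: algebra_simps\<close>)
    moreover have "(\<lambda>i. if i = k then - (- \<alpha> i - d) - d else - \<alpha> i - d + d + 1)
      = (\<lambda>i. if i = k then \<alpha> i else 1 - \<alpha> i)" by (rule ext) simp
    ultimately show ?thesis using h(3) by simp
  qed
  ultimately show ?thesis by blast
qed

end
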